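(* Let $(\mathcal{B},\mathcal{A},e,i,l)$ be a cleft extension of abelian categories which is compatible, and let $q:\mathcal{A}\to\mathcal{B}$ be the left adjoint of $i$. Then both $l$ and $q$ preserve Gorenstein projective objects, i.e. $l(X)$ is Gorenstein projective in $\mathcal{A}$ for every Gorenstein projective object $X$ of $\mathcal{B}$, and $q(X)$ is Gorenstein projective in $\mathcal{B}$ for every Gorenstein projective object $X$ of $\mathcal{A}$.
   Context: Gorenstein projectives. For an abelian category $\mathcal{C}$, $\mathrm{Proj}\,\mathcal{C}$ is the full subcategory of projective objects. A complete $\mathcal{C}$-projective resolution is an exact complex $P^\bullet=\cdots\to P^{-1}\xrightarrow{d^{-1}}P^0\xrightarrow{d^0}P^1\to\cdots$ with all $P^i\in\mathrm{Proj}\,\mathcal{C}$ such that $\mathrm{Hom}_{\mathcal{C}}(P^\bullet,Q)$ is exact for every $Q\in\mathrm{Proj}\,\mathcal{C}$. An object is Gorenstein projective if it is $\mathrm{Im}(d^0)$ for some complete $\mathcal{C}$-projective resolution. Cleft extensions. A cleft extension $(\mathcal{B},\mathcal{A},e,i,l)$ of an abelian category $\mathcal{B}$ is an abelian category $\mathcal{A}$ together with functors $i:\mathcal{B}\to\mathcal{A}$, $e:\mathcal{A}\to\mathcal{B}$, $l:\mathcal{B}\to\mathcal{A}$ such that $e$ is faithful exact, $l$ is left adjoint to $e$, and there is a natural isomorphism $ei\cong\mathrm{Id}_{\mathcal{B}}$. It is known that then $i$ is fully faithful and exact and has a left adjoint $q:\mathcal{A}\to\mathcal{B}$, and $ql\cong\mathrm{Id}_{\mathcal{B}}$.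 Let $G:\mathcal{A}\to\mathcal{A}$ be the kernel of the counit $le\to\mathrm{Id}_{\mathcal{A}}$ (an epimorphism), so $0\to G\to le\to\mathrm{Id}_{\mathcal{A}}\to0$ is exact, and put $F=eGi:\mathcal{B}\to\mathcal{B}$; there is a split short exact sequence $0\to F\to el\to\mathrm{Id}_{\mathcal{B}}\to0$. $F^j$ is the $j$-fold composite; $F$ is nilpotent if $F^s=0$ for some $s$. $\mathbb{L}_i$ denotes the $i$-th left derived functor; the categories are assumed to have enough projectives. Compatible. The cleft extension is compatible if both of the following hold. (C1) For any complete $\mathcal{B}$-projective resolution $P^\bullet$ and any $P'\in\mathrm{Proj}\,\mathcal{B}$, the complexes $F(P^\bullet)$ and $\mathrm{Hom}_{\mathcal{B}}(P^\bullet,F(P'))$ are acyclic. (C2) At least one of the following holds: (i) for any complete $\mathcal{A}$-projective resolution $Q^\bullet$ and any $P\in\mathrm{Proj}\,\mathcal{B}$, the complexes $q(Q^\bullet)$ and $\mathrm{Hom}_{\mathcal{A}}(Q^\bullet,i(P))$ are acyclic; (ii) $F$ is nilpotent, $\mathbb{L}_iF^j(F(P))=0$ for all $i,j>0$ and $P\in\mathrm{Proj}\,\mathcal{B}$, and for any complete $\mathcal{A}$-projective resolution $Q^\bullet$, any $P\in\mathrm{Proj}\,\mathcal{B}$ and any $j>0$, the complexes $F^j(eQ^\bullet)$ and $\mathrm{Hom}_{\mathcal{A}}(Q^\bullet,lF^j(P))$ are acyclic. *)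

theory Defs
  imports "HOL-Algebra.Exact_Sequence"
begin

section \<open>Abelian categories\<close>

text \<open>
  A category comes with the data of an enrichment in abelian groups: \<open>Add\<close> and \<open>Zero X Y\<close> are
  the addition and the neutral element of the morphism sets. Each arrow determines its domain and
  codomain. The composite of \<open>f\<close> followed by \<open>g\<close> is \<open>g \<odot> f\<close>.
\<close>

record ('o, 'm) cat =
  Obj :: "'o set"
  Arr :: "'m set"
  Dom :: "'m \<Rightarrow> 'o"
  Cod :: "'m \<Rightarrow> 'o"
  Idn :: "'o \<Rightarrow> 'm"
  Cmp :: "'m \<Rightarrow> 'm \<Rightarrow> 'm"  (infixr "\<odot>\<index>" 70)
  Add :: "'m \<Rightarrow> 'm \<Rightarrow> 'm"
  Zero :: "'o \<Rightarrow> 'o \<Rightarrow> 'm"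

definition Hom :: "('o, 'm) cat \<Rightarrow> 'o \<Rightarrow> 'o \<Rightarrow> 'm set" where
  "Hom C X Y = {f \<in> Arr C. Dom C f = X \<and> Cod C f = Y}"

definition hom_group :: "('o, 'm) cat \<Rightarrow> 'o \<Rightarrow> 'o \<Rightarrow> 'm monoid" where
  "hom_group C X Y = \<lparr>carrier = Hom C X Y, mult = Add C, one = Zero C X Y\<rparr>"

locale category =
  fixes C :: "('o, 'm) cat" (structure)
  assumes Dom_Obj: "f \<in> Arr C \<Longrightarrow> Dom C f \<in> Obj C"
    and Cod_Obj: "f \<in> Arr C \<Longrightarrow> Cod C f \<in> Obj C"
    and Idn_Hom: "X \<in> Obj C \<Longrightarrow> Idn C X \<in> Hom C X X"
    and Cmp_Hom: "\<lbrakk>f \<in> Hom C X Y; g \<in> Hom C Y Z\<rbrakk> \<Longrightarrow> g \<odot> f \<in> Hom C X Z"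
    and Cmp_assoc: "\<lbrakk>f \<in> Hom C W X; g \<in> Hom C X Y; h \<in> Hom C Y Z\<rbrakk> \<Longrightarrow> (h \<odot> g) \<odot> f = h \<odot> (g \<odot> f)"
    and Idn_left: "f \<in> Hom C X Y \<Longrightarrow> Idn C Y \<odot> f = f"
    and Idn_right: "f \<in> Hom C X Y \<Longrightarrow> f \<odot> Idn C X = f"

locale preadditive_category = category +
  assumes hom_group: "\<lbrakk>X \<in> Obj C; Y \<in> Obj C\<rbrakk> \<Longrightarrow> comm_group (hom_group C X Y)"
    and Cmp_Add_left: "\<lbrakk>f \<in> Hom C X Y; g \<in> Hom C Y Z; g' \<in> Hom C Y Z\<rbrakk>
      \<Longrightarrow> Add C g g' \<odot> f = Add C (g \<odot> f) (g' \<odot> f)"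
    and Cmp_Add_right: "\<lbrakk>f \<in> Hom C X Y; f' \<in> Hom C X Y; g \<in> Hom C Y Z\<rbrakk>
      \<Longrightarrow> g \<odot> Add C f f' = Add C (g \<odot> f) (g \<odot> f')"

definition is_zero_object :: "('o, 'm) cat \<Rightarrow> 'o \<Rightarrow> bool" where
  "is_zero_object C Z \<longleftrightarrow> Z \<in> Obj C \<and>
     (\<forall>X\<in>Obj C. (\<exists>!f. f \<in> Hom C Z X) \<and> (\<exists>!f. f \<in> Hom C X Z))"

definition is_biproduct ::
    "('o, 'm) cat \<Rightarrow> 'o \<Rightarrow> 'o \<Rightarrow> 'o \<Rightarrow> 'm \<Rightarrow> 'm \<Rightarrow> 'm \<Rightarrow> 'm \<Rightarrow> bool" where
  "is_biproduct C X Y S i\<^sub>1 i\<^sub>2 p\<^sub>1 p\<^sub>2 \<longleftrightarrow>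
     i\<^sub>1 \<in> Hom C X S \<and> i\<^sub>2 \<in> Hom C Y S \<and> p\<^sub>1 \<in> Hom C S X \<and> p\<^sub>2 \<in> Hom C S Y \<and>
     p\<^sub>1 \<odot>\<^bsub>C\<^esub> i\<^sub>1 = Idn C X \<and> p\<^sub>2 \<odot>\<^bsub>C\<^esub> i\<^sub>2 = Idn C Y \<and>
     p\<^sub>1 \<odot>\<^bsub>C\<^esub> i\<^sub>2 = Zero C Y X \<and> p\<^sub>2 \<odot>\<^bsub>C\<^esub> i\<^sub>1 = Zero C X Y \<and>
     Add C (i\<^sub>1 \<odot>\<^bsub>C\<^esub> p\<^sub>1) (i\<^sub>2 \<odot>\<^bsub>C\<^esub> p\<^sub>2) = Idn C S"

definition is_mono :: "('o, 'm) cat \<Rightarrow> 'm \<Rightarrow> bool" where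
  "is_mono C f \<longleftrightarrow> f \<in> Arr C \<and>
     (\<forall>X\<in>Obj C. \<forall>g\<in>Hom C X (Dom C f). \<forall>h\<in>Hom C X (Dom C f). f \<odot>\<^bsub>C\<^esub> g = f \<odot>\<^bsub>C\<^esub> h \<longrightarrow> g = h)"

definition is_epi :: "('o, 'm) cat \<Rightarrow> 'm \<Rightarrow> bool" where
  "is_epi C f \<longleftrightarrow> f \<in> Arr C \<and>
     (\<forall>Y\<in>Obj C. \<forall>g\<in>Hom C (Cod C f) Y. \<forall>h\<in>Hom C (Cod C f) Y. g \<odot>\<^bsub>C\<^esub> f = h \<odot>\<^bsub>C\<^esub> f \<longrightarrow> g = h)"

definition is_iso :: "('o, 'm) cat \<Rightarrow> 'm \<Rightarrow> bool" where
  "is_iso C f \<longleftrightarrow> f \<in> Arr C \<and>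
     (\<exists>g\<in>Hom C (Cod C f) (Dom C f). g \<odot>\<^bsub>C\<^esub> f = Idn C (Dom C f) \<and> f \<odot>\<^bsub>C\<^esub> g = Idn C (Cod C f))"

definition is_kernel :: "('o, 'm) cat \<Rightarrow> 'm \<Rightarrow> 'm \<Rightarrow> bool" where
  "is_kernel C k f \<longleftrightarrow>
     f \<in> Arr C \<and> k \<in> Arr C \<and> Cod C k = Dom C f \<and> f \<odot>\<^bsub>C\<^esub> k = Zero C (Dom C k) (Cod C f) \<and>
     (\<forall>X\<in>Obj C. \<forall>h\<in>Hom C X (Dom C f). f \<odot>\<^bsub>C\<^esub> h = Zero C X (Cod C f) \<longrightarrow>
        (\<exists>!u. u \<in> Hom C X (Dom C k) \<and> k \<odot>\<^bsub>C\<^esub> u = h))"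

definition is_cokernel :: "('o, 'm) cat \<Rightarrow> 'm \<Rightarrow> 'm \<Rightarrow> bool" where
  "is_cokernel C c f \<longleftrightarrow>
     f \<in> Arr C \<and> c \<in> Arr C \<and> Dom C c = Cod C f \<and> c \<odot>\<^bsub>C\<^esub> f = Zero C (Dom C f) (Cod C c) \<and>
     (\<forall>Y\<in>Obj C. \<forall>h\<in>Hom C (Cod C f) Y. h \<odot>\<^bsub>C\<^esub> f = Zero C (Dom C f) Y \<longrightarrow>
        (\<exists>!u. u \<in> Hom C (Cod C c) Y \<and> u \<odot>\<^bsub>C\<^esub> c = h))"

locale abelian_category = preadditive_category +
  assumes has_zero_object: "\<exists>Z. is_zero_object C Z"
    and has_biproducts: "\<lbrakk>X \<in> Obj C; Y \<in> Obj C\<rbrakk>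
      \<Longrightarrow> \<exists>S i\<^sub>1 i\<^sub>2 p\<^sub>1 p\<^sub>2. is_biproduct C X Y S i\<^sub>1 i\<^sub>2 p\<^sub>1 p\<^sub>2"
    and has_kernels: "f \<in> Arr C \<Longrightarrow> \<exists>k. is_kernel C k f"
    and has_cokernels: "f \<in> Arr C \<Longrightarrow> \<exists>c. is_cokernel C c f"
    and mono_is_kernel: "is_mono C f \<Longrightarrow> \<exists>g. is_kernel C f g"
    and epi_is_cokernel: "is_epi C f \<Longrightarrow> \<exists>g. is_cokernel C f g"

text \<open>The image of \<open>f\<close> is the kernel of its cokernel.\<close>

definition is_image :: "('o, 'm) cat \<Rightarrow> 'm \<Rightarrow> 'm \<Rightarrow> bool" where
  "is_image C m f \<longleftrightarrow> (\<exists>c. is_cokernel C c f \<and> is_kernel C m c)"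

definition exact_at :: "('o, 'm) cat \<Rightarrow> 'm \<Rightarrow> 'm \<Rightarrow> bool" where
  "exact_at C f g \<longleftrightarrow> Cod C f = Dom C g \<and> (\<exists>m. is_image C m f \<and> is_kernel C m g)"

definition short_exact :: "('o, 'm) cat \<Rightarrow> 'm \<Rightarrow> 'm \<Rightarrow> bool" where
  "short_exact C f g \<longleftrightarrow> is_kernel C f g \<and> is_cokernel C g f"

text \<open>For \<open>g \<odot> f = 0\<close>, the homology is the cokernel of the map induced by \<open>f\<close> into the kernel
  of \<open>g\<close>; it is determined up to isomorphism only, whence a relation.\<close>

definition is_homology :: "('o, 'm) cat \<Rightarrow> 'm \<Rightarrow> 'm \<Rightarrow> 'o \<Rightarrow> bool" where
  "is_homology C f g H \<longleftrightarrow>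
     (\<exists>k u c. is_kernel C k g \<and> u \<in> Hom C (Dom C f) (Dom C k) \<and> k \<odot>\<^bsub>C\<^esub> u = f \<and>
        is_cokernel C c u \<and> Cod C c = H)"


section \<open>Functors\<close>

record ('o, 'm, 'p, 'n) func =
  FObj :: "'o \<Rightarrow> 'p"
  FArr :: "'m \<Rightarrow> 'n"

definition is_functor :: "('o, 'm) cat \<Rightarrow> ('p, 'n) cat \<Rightarrow> ('o, 'm, 'p, 'n) func \<Rightarrow> bool" where
  "is_functor C D T \<longleftrightarrow>
     (\<forall>X\<in>Obj C. FObj T X \<in> Obj D \<and> FArr T (Idn C X) = Idn D (FObj T X)) \<and>
     (\<forall>f\<in>Arr C. FArr T f \<in> Hom D (FObj T (Dom C f)) (FObj T (Cod C f))) \<and>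
     (\<forall>f\<in>Arr C. \<forall>g\<in>Arr C. Cod C f = Dom C g \<longrightarrow>
        FArr T (g \<odot>\<^bsub>C\<^esub> f) = FArr T g \<odot>\<^bsub>D\<^esub> FArr T f)"

definition fid :: "('o, 'm, 'o, 'm) func" where
  "fid = \<lparr>FObj = (\<lambda>X. X), FArr = (\<lambda>f. f)\<rparr>"

definition fcomp ::
    "('p, 'n, 'r, 'k) func \<Rightarrow> ('o, 'm, 'p, 'n) func \<Rightarrow> ('o, 'm, 'r, 'k) func"
    (infixr "\<circ>\<^sub>F" 55) where
  "S \<circ>\<^sub>F T = \<lparr>FObj = FObj S \<circ> FObj T, FArr = FArr S \<circ> FArr T\<rparr>"

primrec fpow :: "('o, 'm, 'o, 'm) func \<Rightarrow> nat \<Rightarrow> ('o, 'm, 'o, 'm) func" where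
  "fpow T 0 = fid"
| "fpow T (Suc j) = T \<circ>\<^sub>F fpow T j"

definition nilpotent_functor :: "('o, 'm) cat \<Rightarrow> ('o, 'm, 'o, 'm) func \<Rightarrow> bool" where
  "nilpotent_functor C T \<longleftrightarrow> (\<exists>s. \<forall>X\<in>Obj C. is_zero_object C (FObj (fpow T s) X))"

definition faithful_functor :: "('o, 'm) cat \<Rightarrow> ('o, 'm, 'p, 'n) func \<Rightarrow> bool" where
  "faithful_functor C T \<longleftrightarrow> (\<forall>X\<in>Obj C. \<forall>Y\<in>Obj C. inj_on (FArr T) (Hom C X Y))"

definition exact_functor ::
    "('o, 'm) cat \<Rightarrow> ('p, 'n) cat \<Rightarrow> ('o, 'm, 'p, 'n) func \<Rightarrow> bool" where
  "exact_functor C D T \<longleftrightarrow> (\<forall>f g. short_exact C f g \<longrightarrow> short_exact D (FArr T f) (FArr T g))"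

definition nat_trans :: "('o, 'm) cat \<Rightarrow> ('p, 'n) cat \<Rightarrow>
    ('o, 'm, 'p, 'n) func \<Rightarrow> ('o, 'm, 'p, 'n) func \<Rightarrow> ('o \<Rightarrow> 'n) \<Rightarrow> bool" where
  "nat_trans C D S T \<tau> \<longleftrightarrow>
     (\<forall>X\<in>Obj C. \<tau> X \<in> Hom D (FObj S X) (FObj T X)) \<and>
     (\<forall>f\<in>Arr C. FArr T f \<odot>\<^bsub>D\<^esub> \<tau> (Dom C f) = \<tau> (Cod C f) \<odot>\<^bsub>D\<^esub> FArr S f)"

definition nat_iso :: "('o, 'm) cat \<Rightarrow> ('p, 'n) cat \<Rightarrow>
    ('o, 'm, 'p, 'n) func \<Rightarrow> ('o, 'm, 'p, 'n) func \<Rightarrow> ('o \<Rightarrow> 'n) \<Rightarrow> bool" where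
  "nat_iso C D S T \<tau> \<longleftrightarrow> nat_trans C D S T \<tau> \<and> (\<forall>X\<in>Obj C. is_iso D (\<tau> X))"

text \<open>\<open>L : C \<rightarrow> D\<close> is left adjoint to \<open>R : D \<rightarrow> C\<close>, with unit \<open>\<eta>\<close> and counit \<open>\<epsilon>\<close>.\<close>

definition adjunction :: "('o, 'm) cat \<Rightarrow> ('p, 'n) cat \<Rightarrow>
    ('o, 'm, 'p, 'n) func \<Rightarrow> ('p, 'n, 'o, 'm) func \<Rightarrow> ('o \<Rightarrow> 'm) \<Rightarrow> ('p \<Rightarrow> 'n) \<Rightarrow> bool" where
  "adjunction C D L R \<eta> \<epsilon> \<longleftrightarrow>
     is_functor C D L \<and> is_functor D C R \<and>
     nat_trans C C fid (R \<circ>\<^sub>F L) \<eta> \<and> nat_trans D D (L \<circ>\<^sub>F R) fid \<epsilon> \<and>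
     (\<forall>X\<in>Obj C. \<epsilon> (FObj L X) \<odot>\<^bsub>D\<^esub> FArr L (\<eta> X) = Idn D (FObj L X)) \<and>
     (\<forall>Y\<in>Obj D. FArr R (\<epsilon> Y) \<odot>\<^bsub>C\<^esub> \<eta> (FObj R Y) = Idn C (FObj R Y))"

text \<open>\<open>K\<close>, together with \<open>\<kappa> : K \<rightarrow> S\<close>, is a kernel of \<open>\<tau> : S \<rightarrow> T\<close>.\<close>

definition kernel_functor :: "('o, 'm) cat \<Rightarrow> ('p, 'n) cat \<Rightarrow> ('o, 'm, 'p, 'n) func \<Rightarrow>
    ('o \<Rightarrow> 'n) \<Rightarrow> ('o, 'm, 'p, 'n) func \<Rightarrow> ('o \<Rightarrow> 'n) \<Rightarrow> bool" where
  "kernel_functor C D S \<tau> K \<kappa> \<longleftrightarrow>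
     is_functor C D K \<and> nat_trans C D K S \<kappa> \<and> (\<forall>X\<in>Obj C. is_kernel D (\<kappa> X) (\<tau> X))"


section \<open>Projectives, resolutions and derived functors\<close>

definition projective :: "('o, 'm) cat \<Rightarrow> 'o \<Rightarrow> bool" where
  "projective C P \<longleftrightarrow> P \<in> Obj C \<and>
     (\<forall>g. is_epi C g \<longrightarrow> (\<forall>f\<in>Hom C P (Cod C g). \<exists>h\<in>Hom C P (Dom C g). g \<odot>\<^bsub>C\<^esub> h = f))"

definition enough_projectives :: "('o, 'm) cat \<Rightarrow> bool" where
  "enough_projectives C \<longleftrightarrow>
     (\<forall>X\<in>Obj C. \<exists>p. is_epi C p \<and> projective C (Dom C p) \<and> Cod C p = X)"

text \<open>A cochain complex is given by its differentials \<open>d n : P\<^sup>n \<rightarrow> P\<^sup>n\<^sup>+\<^sup>1\<close> alone, with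
  \<open>P\<^sup>n = Dom (d n)\<close>. Consequently the complex obtained by applying a functor \<open>T\<close> is
  \<open>FArr T \<circ> d\<close>.\<close>

definition acyclic_complex :: "('o, 'm) cat \<Rightarrow> (int \<Rightarrow> 'm) \<Rightarrow> bool" where
  "acyclic_complex C d \<longleftrightarrow> (\<forall>n. exact_at C (d n) (d (n + 1)))"

text \<open>Acyclicity of the complex of abelian groups \<open>Hom (P\<^sup>\<bullet>, Q)\<close>. In \<open>exact_seq\<close> the groups and
  maps are listed from right to left, so this is exactness at \<open>Hom (P\<^sup>n\<^sup>+\<^sup>1, Q)\<close> of
  \<open>Hom (P\<^sup>n\<^sup>+\<^sup>2, Q) \<rightarrow> Hom (P\<^sup>n\<^sup>+\<^sup>1, Q) \<rightarrow> Hom (P\<^sup>n, Q)\<close>.\<close>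

definition hom_acyclic :: "('o, 'm) cat \<Rightarrow> (int \<Rightarrow> 'm) \<Rightarrow> 'o \<Rightarrow> bool" where
  "hom_acyclic C d Q \<longleftrightarrow>
     (\<forall>n. exact_seq
        ([hom_group C (Dom C (d n)) Q, hom_group C (Dom C (d (n + 1))) Q,
          hom_group C (Dom C (d (n + 2))) Q],
         [\<lambda>f. f \<odot>\<^bsub>C\<^esub> d n, \<lambda>f. f \<odot>\<^bsub>C\<^esub> d (n + 1)]))"

definition complete_projective_resolution :: "('o, 'm) cat \<Rightarrow> (int \<Rightarrow> 'm) \<Rightarrow> bool" where
  "complete_projective_resolution C d \<longleftrightarrow>
     acyclic_complex C d \<and> (\<forall>n. projective C (Dom C (d n))) \<and>
     (\<forall>Q. projective C Q \<longrightarrow> hom_acyclic C d Q)"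

definition gorenstein_projective :: "('o, 'm) cat \<Rightarrow> 'o \<Rightarrow> bool" where
  "gorenstein_projective C X \<longleftrightarrow>
     (\<exists>d m. complete_projective_resolution C d \<and> is_image C m (d 0) \<and> Dom C m = X)"

text \<open>Projective resolutions are indexed homologically: \<open>d n : P\<^sub>n\<^sub>+\<^sub>1 \<rightarrow> P\<^sub>n\<close>, with augmentation
  \<open>a : P\<^sub>0 \<rightarrow> X\<close>.\<close>

definition projective_resolution :: "('o, 'm) cat \<Rightarrow> 'o \<Rightarrow> (nat \<Rightarrow> 'm) \<Rightarrow> 'm \<Rightarrow> bool" where
  "projective_resolution C X d a \<longleftrightarrow>
     is_epi C a \<and> Cod C a = X \<and> exact_at C (d 0) a \<and> (\<forall>n. exact_at C (d (Suc n)) (d n)) \<and>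
     projective C (Dom C a) \<and> (\<forall>n. projective C (Dom C (d n)))"

text \<open>\<open>H\<close> is (a representative of) the value at \<open>X\<close> of the \<open>n\<close>-th left derived functor of
  \<open>T : C \<rightarrow> D\<close>, i.e. the \<open>n\<close>-th homology object of \<open>T(P\<^sub>\<bullet>)\<close> for a projective resolution
  \<open>P\<^sub>\<bullet>\<close> of \<open>X\<close>. It is unique up to isomorphism.\<close>

definition left_derived_value :: "('o, 'm) cat \<Rightarrow> ('p, 'n) cat \<Rightarrow> ('o, 'm, 'p, 'n) func \<Rightarrow>
    nat \<Rightarrow> 'o \<Rightarrow> 'p \<Rightarrow> bool" where
  "left_derived_value C D T n X H \<longleftrightarrow>
     (\<exists>d a. projective_resolution C X d a \<and>
        (case n of
           0 \<Rightarrow> \<exists>c. is_cokernel D c (FArr T (d 0)) \<and> Cod D c = H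
         | Suc m \<Rightarrow> is_homology D (FArr T (d (Suc m))) (FArr T (d m)) H))"

definition left_derived_vanishes :: "('o, 'm) cat \<Rightarrow> ('p, 'n) cat \<Rightarrow> ('o, 'm, 'p, 'n) func \<Rightarrow>
    nat \<Rightarrow> 'o \<Rightarrow> bool" where
  "left_derived_vanishes C D T n X \<longleftrightarrow>
     (\<forall>H. left_derived_value C D T n X H \<longrightarrow> is_zero_object D H)"


section \<open>Cleft extensions\<close>

text \<open>The unit and counit witnessing that \<open>l\<close> is left adjoint to \<open>e\<close> are carried along, since the
  functors \<open>G\<close> and \<open>F\<close> are built from the counit.\<close>

definition cleft_extension :: "('b, 'g) cat \<Rightarrow> ('a, 'f) cat \<Rightarrow> ('a, 'f, 'b, 'g) func \<Rightarrow>
    ('b, 'g, 'a, 'f) func \<Rightarrow> ('b, 'g, 'a, 'f) func \<Rightarrow> ('b \<Rightarrow> 'g) \<Rightarrow> ('a \<Rightarrow> 'f) \<Rightarrow> bool" where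
  "cleft_extension B A e i l \<eta> \<epsilon> \<longleftrightarrow>
     abelian_category B \<and> abelian_category A \<and>
     is_functor A B e \<and> is_functor B A i \<and> is_functor B A l \<and>
     faithful_functor A e \<and> exact_functor A B e \<and>
     adjunction B A l e \<eta> \<epsilon> \<and>
     (\<exists>\<theta>. nat_iso B B (e \<circ>\<^sub>F i) fid \<theta>)"

definition compatible_C1 :: "('b, 'g) cat \<Rightarrow> ('b, 'g, 'b, 'g) func \<Rightarrow> bool" where
  "compatible_C1 B F \<longleftrightarrow>
     (\<forall>d P'. complete_projective_resolution B d \<and> projective B P' \<longrightarrow>
        acyclic_complex B (FArr F \<circ> d) \<and> hom_acyclic B d (FObj F P'))"

definition compatible_C2i :: "('b, 'g) cat \<Rightarrow> ('a, 'f) cat \<Rightarrow> ('b, 'g, 'a, 'f) func \<Rightarrow>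
    ('a, 'f, 'b, 'g) func \<Rightarrow> bool" where
  "compatible_C2i B A i q \<longleftrightarrow>
     (\<forall>d P. complete_projective_resolution A d \<and> projective B P \<longrightarrow>
        acyclic_complex B (FArr q \<circ> d) \<and> hom_acyclic A d (FObj i P))"

definition compatible_C2ii :: "('b, 'g) cat \<Rightarrow> ('a, 'f) cat \<Rightarrow> ('a, 'f, 'b, 'g) func \<Rightarrow>
    ('b, 'g, 'a, 'f) func \<Rightarrow> ('b, 'g, 'b, 'g) func \<Rightarrow> bool" where
  "compatible_C2ii B A e l F \<longleftrightarrow>
     nilpotent_functor B F \<and>
     (\<forall>n j P. 0 < n \<and> 0 < j \<and> projective B P \<longrightarrow>
        left_derived_vanishes B B (fpow F j) n (FObj F P)) \<and>
     (\<forall>d P j. complete_projective_resolution A d \<and> projective B P \<and> 0 < j \<longrightarrow>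
        acyclic_complex B (FArr (fpow F j \<circ>\<^sub>F e) \<circ> d) \<and>
        hom_acyclic A d (FObj (l \<circ>\<^sub>F fpow F j) P))"

definition compatible :: "('b, 'g) cat \<Rightarrow> ('a, 'f) cat \<Rightarrow> ('a, 'f, 'b, 'g) func \<Rightarrow>
    ('b, 'g, 'a, 'f) func \<Rightarrow> ('b, 'g, 'a, 'f) func \<Rightarrow> ('a, 'f, 'b, 'g) func \<Rightarrow>
    ('b, 'g, 'b, 'g) func \<Rightarrow> bool" where
  "compatible B A e i l q F \<longleftrightarrow>
     compatible_C1 B F \<and> (compatible_C2i B A i q \<or> compatible_C2ii B A e l F)"

end

theory Submission
  imports Defs
begin

text \<open>
  A left adjoint \<open>L\<close> whose right adjoint \<open>R\<close> preserves epimorphisms preserves projectives. If moreover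
  \<open>L d\<close> is acyclic and \<open>Hom (d, R Q)\<close> is acyclic for every complete projective resolution \<open>d\<close> and
  every projective \<open>Q\<close>, then, as \<open>Hom (L d, Q) = Hom (d, R Q)\<close>, the functor \<open>L\<close> maps complete
  projective resolutions to complete projective resolutions. It also respects the image of \<open>d 0\<close>,
  and hence preserves Gorenstein projectives (\<open>L_gorenstein_projective\<close>). This is applied to the
  adjoint pairs \<open>(l, e)\<close> and \<open>(q, i)\<close>, so everything rests on acyclicity.

  \<^bold>\<open>The functor\<close> \<open>l\<close>. Applying \<open>e\<close> to \<open>0 \<rightarrow> G \<rightarrow> le \<rightarrow> Id \<rightarrow> 0\<close> on objects \<open>i X\<close> gives a short exact
  sequence \<open>0 \<rightarrow> F \<rightarrow> elei \<rightarrow> ei \<rightarrow> 0\<close>, whose middle term is isomorphic to \<open>el\<close> and whose last term is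
  isomorphic to the identity. So \<open>el d\<close> is acyclic once \<open>F d\<close> is, and \<open>e\<close> reflects acyclicity
  (\<open>l_acyclic\<close>). A projective \<open>Q\<close> of \<open>A\<close> is a retract of some \<open>l P\<close> with \<open>P\<close> projective, and the same
  sequence yields acyclicity of \<open>Hom (d, el P)\<close> from that of \<open>Hom (d, F P)\<close> and \<open>Hom (d, P)\<close>
  (\<open>hom_acyclic_e_projective\<close>).

  \<^bold>\<open>The functor\<close> \<open>q\<close>. Condition (i) of (C2) is precisely what the criterion asks for, and condition
  (ii) implies it (\<open>compatible_C2i_if_C2ii\<close>). The reason is that \<open>e G Y\<close> is the cokernel of the unit at
  \<open>e Y\<close>, so that it depends on \<open>e Y\<close> only; comparing \<open>Y\<close> with \<open>i e Y\<close> gives \<open>e G \<cong> F e\<close>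
  (\<open>F_e_iso_e_G\<close>). Consequently \<open>e G\<^sup>j \<cong> F\<^sup>j e\<close>, and \<open>G\<close> is nilpotent because \<open>F\<close> is. The sequences
  \<open>0 \<rightarrow> G\<^sup>j\<^sup>+\<^sup>1 Y \<rightarrow> l F\<^sup>j e Y \<rightarrow> G\<^sup>j Y \<rightarrow> 0\<close> thus reduce acyclicity of \<open>Hom (d, Y)\<close> to that of the
  \<open>Hom (d, l F\<^sup>j e Y)\<close>, by descent from a power of \<open>G\<close> that vanishes; take \<open>Y = i P\<close>. For \<open>q d\<close> the same
  descent works with \<open>q l F\<^sup>j e d \<cong> F\<^sup>j e d\<close>, provided that \<open>q\<close> keeps the sequences exact. It does,
  since all of them split termwise: the counit at a projective object splits, and if the counit at
  \<open>Y\<close> splits, then \<open>G Y\<close> is a retract of \<open>l e Y\<close>, so that the counit at \<open>G Y\<close> splits as well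
  (\<open>split_counit_G\<close>).

  Diagram chases are carried out with arrows out of projective objects in place of elements.
\<close>

section \<open>Arrows in additive categories\<close>

lemma Hom_iff: "f \<in> Hom C X Y \<longleftrightarrow> f \<in> Arr C \<and> Dom C f = X \<and> Cod C f = Y"
  by (simp add: Hom_def)

context category
begin

declare Dom_Obj [simp] Cod_Obj [simp]

lemma Cmp_Arr [simp]:
  assumes "f \<in> Arr C" "g \<in> Arr C" "Cod C f = Dom C g"
  shows "g \<odot> f \<in> Arr C" "Dom C (g \<odot> f) = Dom C f" "Cod C (g \<odot> f) = Cod C g"
  using Cmp_Hom[of f "Dom C f" "Cod C f" g "Cod C g"] assms by (simp_all add: Hom_iff)

lemma Cmp_Cmp [simp]:
  "\<lbrakk>f \<in> Arr C; g \<in> Arr C; h \<in> Arr C; Cod C f = Dom C g; Cod C g = Dom C h\<rbrakk>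
    \<Longrightarrow> (h \<odot> g) \<odot> f = h \<odot> (g \<odot> f)"
  using Cmp_assoc[of f "Dom C f" "Cod C f" g "Cod C g" h "Cod C h"] by (simp add: Hom_iff)

lemma Idn_Arr [simp]:
  assumes "X \<in> Obj C"
  shows "Idn C X \<in> Arr C" "Dom C (Idn C X) = X" "Cod C (Idn C X) = X"
  using Idn_Hom[OF assms] by (simp_all add: Hom_iff)

lemma Idn_Cmp [simp]: "\<lbrakk>f \<in> Arr C; Cod C f = Y\<rbrakk> \<Longrightarrow> Idn C Y \<odot> f = f"
  using Idn_left[of f "Dom C f" Y] by (simp add: Hom_iff)

lemma Cmp_Idn [simp]: "\<lbrakk>f \<in> Arr C; Dom C f = X\<rbrakk> \<Longrightarrow> f \<odot> Idn C X = f"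
  using Idn_right[of f X "Cod C f"] by (simp add: Hom_iff)

lemma monoD:
  "\<lbrakk>is_mono C f; f \<odot> g = f \<odot> h; g \<in> Arr C; h \<in> Arr C; Cod C g = Dom C f; Cod C h = Dom C f;
    Dom C g = Dom C h\<rbrakk> \<Longrightarrow> g = h"
  unfolding is_mono_def by (metis Dom_Obj Hom_iff)

lemma epiD:
  "\<lbrakk>is_epi C f; g \<odot> f = h \<odot> f; g \<in> Arr C; h \<in> Arr C; Dom C g = Cod C f; Dom C h = Cod C f;
    Cod C g = Cod C h\<rbrakk> \<Longrightarrow> g = h"
  unfolding is_epi_def by (metis Cod_Obj Hom_iff)

lemma is_epiI:
  assumes "f \<in> Arr C"
    and "\<And>g h. \<lbrakk>g \<in> Arr C; h \<in> Arr C; Dom C g = Cod C f; Dom C h = Cod C f; Cod C g = Cod C h;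
      g \<odot> f = h \<odot> f\<rbrakk> \<Longrightarrow> g = h"
  shows "is_epi C f"
  using assms unfolding is_epi_def by (simp add: Hom_iff)

lemma is_epi_Cmp:
  assumes "is_epi C f" "is_epi C g" "Cod C f = Dom C g"
  shows "is_epi C (g \<odot> f)"
proof (rule is_epiI)
  have ar: "f \<in> Arr C" "g \<in> Arr C" using assms by (auto simp: is_epi_def)
  then show "g \<odot> f \<in> Arr C" using assms by simp
  fix a b assume ab: "a \<in> Arr C" "b \<in> Arr C" "Dom C a = Cod C (g \<odot> f)" "Dom C b = Cod C (g \<odot> f)"
    "Cod C a = Cod C b" "a \<odot> g \<odot> f = b \<odot> g \<odot> f"
  have "a \<odot> g = b \<odot> g"
    by (rule epiD[OF assms(1)]) (use ab ar assms in simp_all)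
  then show "a = b"
    by (rule epiD[OF assms(2)]) (use ab ar assms in simp_all)
qed

lemma split_epi:
  assumes "f \<in> Arr C" "s \<in> Hom C (Cod C f) (Dom C f)" "f \<odot> s = Idn C (Cod C f)"
  shows "is_epi C f"
proof (rule is_epiI)
  fix g h assume gh: "g \<in> Arr C" "h \<in> Arr C" "Dom C g = Cod C f" "Dom C h = Cod C f"
    "g \<odot> f = h \<odot> f"
  have "(g \<odot> f) \<odot> s = (h \<odot> f) \<odot> s" using gh by simp
  then show "g = h" using gh(1-4) assms by (simp add: Hom_iff)
qed (rule assms)

lemma split_mono:
  assumes "f \<in> Arr C" "r \<in> Hom C (Cod C f) (Dom C f)" "r \<odot> f = Idn C (Dom C f)"
  shows "is_mono C f"
  unfolding is_mono_def
proof (intro conjI ballI impI)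
  fix X g h assume gh: "g \<in> Hom C X (Dom C f)" "h \<in> Hom C X (Dom C f)" "f \<odot> g = f \<odot> h"
  have "(r \<odot> f) \<odot> g = (r \<odot> f) \<odot> h" using gh assms(1,2) by (simp add: Hom_iff)
  then show "g = h" using gh assms(3) by (simp add: Hom_iff)
qed (rule assms)

lemma projective_Obj [simp]: "projective C P \<Longrightarrow> P \<in> Obj C"
  by (simp add: projective_def)

lemma projective_lift:
  assumes "projective C P" "is_epi C g" "f \<in> Arr C" "Dom C f = P" "Cod C f = Cod C g"
  obtains h where "h \<in> Arr C" "Dom C h = P" "Cod C h = Dom C g" "g \<odot> h = f"
  using assms unfolding projective_def by (fastforce simp: Hom_iff)

lemma zero_object_maps_into:
  "\<lbrakk>is_zero_object C Z; f \<in> Hom C X Z; g \<in> Hom C X Z\<rbrakk> \<Longrightarrow> f = g"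
  unfolding is_zero_object_def by (metis Dom_Obj Hom_iff)

lemma zero_object_maps_out:
  "\<lbrakk>is_zero_object C Z; f \<in> Hom C Z X; g \<in> Hom C Z X\<rbrakk> \<Longrightarrow> f = g"
  unfolding is_zero_object_def by (metis Cod_Obj Hom_iff)

lemma is_isoD:
  assumes "is_iso C u"
  obtains v where "v \<in> Arr C" "Dom C v = Cod C u" "Cod C v = Dom C u"
    "v \<odot> u = Idn C (Dom C u)" "u \<odot> v = Idn C (Cod C u)"
  using assms unfolding is_iso_def by (auto simp: Hom_iff)

lemma is_isoI:
  assumes "u \<in> Arr C" "v \<in> Arr C" "Dom C v = Cod C u" "Cod C v = Dom C u"
    "v \<odot> u = Idn C (Dom C u)" "u \<odot> v = Idn C (Cod C u)"
  shows "is_iso C u"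
  using assms unfolding is_iso_def by (auto simp: Hom_iff)

lemma kernel_factor:
  assumes "is_kernel C k f" "h \<in> Arr C" "Cod C h = Dom C f" "f \<odot> h = Zero C (Dom C h) (Cod C f)"
  obtains u where "u \<in> Arr C" "Dom C u = Dom C h" "Cod C u = Dom C k" "k \<odot> u = h"
proof -
  have "\<exists>!u. u \<in> Hom C (Dom C h) (Dom C k) \<and> k \<odot> u = h"
    using assms unfolding is_kernel_def by (metis Dom_Obj Hom_iff)
  then show thesis using that by (auto simp: Hom_iff)
qed

lemma cokernel_factor:
  assumes "is_cokernel C c f" "h \<in> Arr C" "Dom C h = Cod C f" "h \<odot> f = Zero C (Dom C f) (Cod C h)"
  obtains u where "u \<in> Arr C" "Cod C u = Cod C h" "Dom C u = Cod C c" "u \<odot> c = h"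
proof -
  have "\<exists>!u. u \<in> Hom C (Cod C c) (Cod C h) \<and> u \<odot> c = h"
    using assms unfolding is_cokernel_def by (metis Cod_Obj Hom_iff)
  then show thesis using that by (auto simp: Hom_iff)
qed

end

lemma is_kernelD:
  assumes "is_kernel C k f"
  shows "f \<in> Arr C" "k \<in> Arr C" "Cod C k = Dom C f" "f \<odot>\<^bsub>C\<^esub> k = Zero C (Dom C k) (Cod C f)"
  using assms by (auto simp: is_kernel_def)

lemma is_cokernelD:
  assumes "is_cokernel C c f"
  shows "f \<in> Arr C" "c \<in> Arr C" "Dom C c = Cod C f" "c \<odot>\<^bsub>C\<^esub> f = Zero C (Dom C f) (Cod C c)"
  using assms by (auto simp: is_cokernel_def)

definition Diff :: "('o, 'm) cat \<Rightarrow> 'm \<Rightarrow> 'm \<Rightarrow> 'm" where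
  "Diff C f g = Add C f (inv\<^bsub>hom_group C (Dom C f) (Cod C f)\<^esub> g)"

context preadditive_category
begin

lemma Zero_Arr [simp]:
  assumes "X \<in> Obj C" "Y \<in> Obj C"
  shows "Zero C X Y \<in> Arr C" "Dom C (Zero C X Y) = X" "Cod C (Zero C X Y) = Y"
proof -
  interpret H: comm_group "hom_group C X Y" using hom_group assms .
  show "Zero C X Y \<in> Arr C" "Dom C (Zero C X Y) = X" "Cod C (Zero C X Y) = Y"
    using H.one_closed by (simp_all add: hom_group_def Hom_iff)
qed

lemma Add_Arr [simp]:
  assumes "f \<in> Arr C" "g \<in> Arr C" "Dom C f = Dom C g" "Cod C f = Cod C g"
  shows "Add C f g \<in> Arr C" "Dom C (Add C f g) = Dom C g" "Cod C (Add C f g) = Cod C g"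
proof -
  interpret H: comm_group "hom_group C (Dom C g) (Cod C g)" using hom_group assms by simp
  show "Add C f g \<in> Arr C" "Dom C (Add C f g) = Dom C g" "Cod C (Add C f g) = Cod C g"
    using H.m_closed[of f g] assms by (simp_all add: hom_group_def Hom_iff)
qed

lemma Diff_Arr [simp]:
  assumes "f \<in> Arr C" "g \<in> Arr C" "Dom C f = Dom C g" "Cod C f = Cod C g"
  shows "Diff C f g \<in> Arr C" "Dom C (Diff C f g) = Dom C g" "Cod C (Diff C f g) = Cod C g"
proof -
  interpret H: comm_group "hom_group C (Dom C g) (Cod C g)" using hom_group assms by simp
  show "Diff C f g \<in> Arr C" "Dom C (Diff C f g) = Dom C g" "Cod C (Diff C f g) = Cod C g"
    using H.m_closed[of f "inv\<^bsub>hom_group C (Dom C g) (Cod C g)\<^esub> g"] H.inv_closed[of g] assms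
    by (simp_all add: hom_group_def Hom_iff Diff_def)
qed

lemma Add_Diff:
  assumes "f \<in> Arr C" "g \<in> Arr C" "Dom C f = Dom C g" "Cod C f = Cod C g"
  shows "Add C (Diff C f g) g = f"
proof -
  interpret H: comm_group "hom_group C (Dom C g) (Cod C g)" using hom_group assms by simp
  show ?thesis
    using H.m_assoc[of f "inv\<^bsub>hom_group C (Dom C g) (Cod C g)\<^esub> g" g] H.inv_closed[of g]
      H.l_inv[of g] H.r_one[of f] assms
    by (simp add: hom_group_def Hom_iff Diff_def)
qed

lemma Diff_unique:
  assumes "f \<in> Arr C" "g \<in> Arr C" "Dom C f = Dom C g" "Cod C f = Cod C g" "Add C f g = h"
  shows "f = Diff C h g"
proof -
  interpret H: comm_group "hom_group C (Dom C g) (Cod C g)" using hom_group assms by simp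
  have h: "h \<in> Arr C" "Dom C h = Dom C g" "Cod C h = Cod C g" using assms by auto
  have "Add C (Diff C h g) g = Add C f g" using Add_Diff[of h g] h assms by simp
  then show ?thesis
    using H.right_cancel[of g f "Diff C h g"] h assms by (simp add: hom_group_def Hom_iff)
qed

lemma Add_Zero [simp]:
  assumes "f \<in> Arr C" "Dom C f = X" "Cod C f = Y"
  shows "Add C (Zero C X Y) f = f"
proof -
  interpret H: comm_group "hom_group C X Y" using hom_group assms by auto
  show ?thesis using H.l_one[of f] assms by (simp add: hom_group_def Hom_iff)
qed

lemma Diff_self [simp]: "f \<in> Arr C \<Longrightarrow> Diff C f f = Zero C (Dom C f) (Cod C f)"
  using Diff_unique[of "Zero C (Dom C f) (Cod C f)" f f] by simp

lemma Diff_eq_Zero: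
  assumes "Diff C f g = Zero C X Y" "f \<in> Arr C" "g \<in> Arr C"
    "Dom C f = X" "Dom C g = X" "Cod C f = Y" "Cod C g = Y"
  shows "f = g"
  using Add_Diff[of f g] assms by simp

lemma Cmp_Add:
  "\<lbrakk>f \<in> Arr C; g \<in> Arr C; Dom C f = Dom C g; Cod C f = Cod C g; h \<in> Arr C; Dom C h = Cod C g\<rbrakk>
    \<Longrightarrow> h \<odot> Add C f g = Add C (h \<odot> f) (h \<odot> g)"
  using Cmp_Add_right[of f "Dom C g" "Cod C g" g h "Cod C h"] by (simp add: Hom_iff)

lemma Add_Cmp:
  "\<lbrakk>f \<in> Arr C; g \<in> Arr C; Dom C f = Dom C g; Cod C f = Cod C g; h \<in> Arr C; Cod C h = Dom C g\<rbrakk>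
    \<Longrightarrow> Add C f g \<odot> h = Add C (f \<odot> h) (g \<odot> h)"
  using Cmp_Add_left[of h "Dom C h" "Cod C h" f "Cod C g" g] by (simp add: Hom_iff)

lemma Cmp_Diff:
  assumes "f \<in> Arr C" "g \<in> Arr C" "Dom C f = Dom C g" "Cod C f = Cod C g"
    "h \<in> Arr C" "Dom C h = Cod C g"
  shows "h \<odot> Diff C f g = Diff C (h \<odot> f) (h \<odot> g)"
proof (rule Diff_unique)
  show "Add C (h \<odot> Diff C f g) (h \<odot> g) = h \<odot> f"
    using Cmp_Add[of "Diff C f g" g h] Add_Diff[of f g] assms by simp
qed (use assms in simp_all)

lemma Diff_Cmp:
  assumes "f \<in> Arr C" "g \<in> Arr C" "Dom C f = Dom C g" "Cod C f = Cod C g"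
    "h \<in> Arr C" "Cod C h = Dom C g"
  shows "Diff C f g \<odot> h = Diff C (f \<odot> h) (g \<odot> h)"
proof (rule Diff_unique)
  show "Add C (Diff C f g \<odot> h) (g \<odot> h) = f \<odot> h"
    using Add_Cmp[of "Diff C f g" g h] Add_Diff[of f g] assms by simp
qed (use assms in simp_all)

lemma Cmp_Zero [simp]:
  assumes "h \<in> Arr C" "Dom C h = Y" "X \<in> Obj C"
  shows "h \<odot> Zero C X Y = Zero C X (Cod C h)"
  using Cmp_Diff[of "Zero C X Y" "Zero C X Y" h] assms by auto

lemma Zero_Cmp [simp]:
  assumes "h \<in> Arr C" "Cod C h = Y" "Z \<in> Obj C"
  shows "Zero C Y Z \<odot> h = Zero C (Dom C h) Z"
  using Diff_Cmp[of "Zero C Y Z" "Zero C Y Z" h] assms by auto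

lemma Diff_Zero [simp]:
  "\<lbrakk>f \<in> Arr C; Dom C f = X; Cod C f = Y\<rbrakk> \<Longrightarrow> Diff C f (Zero C X Y) = f"
proof -
  assume a: "f \<in> Arr C" "Dom C f = X" "Cod C f = Y"
  interpret H: comm_group "hom_group C X Y" using hom_group a by auto
  have "Add C f (Zero C X Y) = f" using H.r_one[of f] a by (simp add: hom_group_def Hom_iff)
  then show ?thesis using Diff_unique[of f "Zero C X Y" f] a by auto
qed

lemma is_zero_object_iff:
  "is_zero_object C Z \<longleftrightarrow> Z \<in> Obj C \<and> Idn C Z = Zero C Z Z"
proof
  assume "is_zero_object C Z"
  then show "Z \<in> Obj C \<and> Idn C Z = Zero C Z Z"
    using zero_object_maps_into[of Z "Idn C Z" Z "Zero C Z Z"]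
    by (auto simp: is_zero_object_def Hom_iff)
next
  assume Z: "Z \<in> Obj C \<and> Idn C Z = Zero C Z Z"
  have into: "f = Zero C X Z" if "f \<in> Hom C X Z" for f X
    using Idn_left[OF that] that Z by (auto simp: Hom_iff)
  have out: "f = Zero C Z X" if "f \<in> Hom C Z X" for f X
    using Idn_right[OF that] that Z by (auto simp: Hom_iff)
  show "is_zero_object C Z"
    unfolding is_zero_object_def
  proof (intro conjI ballI)
    fix X assume X: "X \<in> Obj C"
    show "\<exists>!f. f \<in> Hom C Z X" by (rule ex1I[of _ "Zero C Z X"]) (use X Z out in \<open>auto simp: Hom_iff\<close>)
    show "\<exists>!f. f \<in> Hom C X Z" by (rule ex1I[of _ "Zero C X Z"]) (use X Z into in \<open>auto simp: Hom_iff\<close>)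
  qed (use Z in simp)
qed

lemma zero_object_projective:
  assumes Z: "is_zero_object C Z"
  shows "projective C Z"
  unfolding projective_def
proof (intro conjI allI impI ballI)
  show ZO: "Z \<in> Obj C" using Z by (simp add: is_zero_object_def)
  fix g f assume "is_epi C g" and f: "f \<in> Hom C Z (Cod C g)"
  then have g: "g \<in> Arr C" by (simp add: is_epi_def)
  have "g \<odot> Zero C Z (Dom C g) = f"
    by (rule zero_object_maps_out[OF Z _ f]) (use g ZO in \<open>simp add: Hom_iff\<close>)
  then show "\<exists>h\<in>Hom C Z (Dom C g). g \<odot> h = f"
    using g ZO by (intro bexI[of _ "Zero C Z (Dom C g)"]) (simp_all add: Hom_iff)
qed

lemma iso_zero_object:
  assumes "is_iso C u" "is_zero_object C (Dom C u)"
  shows "is_zero_object C (Cod C u)"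
proof -
  have u: "u \<in> Arr C" using assms by (simp add: is_iso_def)
  obtain v where v: "v \<in> Arr C" "Dom C v = Cod C u" "Cod C v = Dom C u" "u \<odot> v = Idn C (Cod C u)"
    using is_isoD[OF assms(1)] by metis
  have "Idn C (Cod C u) = u \<odot> Idn C (Dom C u) \<odot> v" using u v by simp
  also have "\<dots> = Zero C (Cod C u) (Cod C u)"
    using assms(2) u v by (simp add: is_zero_object_iff)
  finally show ?thesis using u by (simp add: is_zero_object_iff)
qed

end

section \<open>Images and exactness in abelian categories\<close>

lemma ex1_equal: "\<lbrakk>\<exists>!x. P x; P a; P b\<rbrakk> \<Longrightarrow> a = b"
  by blast

context preadditive_category
begin

lemma mono_if_no_kernel:
  assumes "f \<in> Arr C"
    and "\<And>x. \<lbrakk>x \<in> Arr C; Cod C x = Dom C f; f \<odot> x = Zero C (Dom C x) (Cod C f)\<rbrakk>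
      \<Longrightarrow> x = Zero C (Dom C x) (Dom C f)"
  shows "is_mono C f"
  unfolding is_mono_def
proof (intro conjI ballI impI)
  fix X g h assume gh: "g \<in> Hom C X (Dom C f)" "h \<in> Hom C X (Dom C f)" "f \<odot> g = f \<odot> h"
  have "Diff C g h = Zero C X (Dom C f)"
    using assms(2)[of "Diff C g h"] gh assms(1) by (auto simp: Hom_iff Cmp_Diff)
  then show "g = h" using gh by (auto intro: Diff_eq_Zero simp: Hom_iff)
qed (rule assms)

lemma kernel_mono: 
  assumes "is_kernel C k f"
  shows "is_mono C k"
proof (rule mono_if_no_kernel)
  note k = is_kernelD[OF assms]
  show "k \<in> Arr C" by (rule k)
  fix x assume x: "x \<in> Arr C" "Cod C x = Dom C k" "k \<odot> x = Zero C (Dom C x) (Cod C k)"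
  have ex1: "\<exists>!u. u \<in> Hom C (Dom C x) (Dom C k) \<and> k \<odot> u = Zero C (Dom C x) (Dom C f)"
    using assms x k unfolding is_kernel_def by (auto simp: Hom_iff)
  show "x = Zero C (Dom C x) (Dom C k)"
    by (rule ex1_equal[OF ex1]) (use x k in \<open>auto simp: Hom_iff\<close>)
qed

lemma cokernel_epi: 
  assumes "is_cokernel C c f"
  shows "is_epi C c"
proof (rule is_epiI)
  note c = is_cokernelD[OF assms]
  show "c \<in> Arr C" by (rule c)
  fix g h assume gh: "g \<in> Arr C" "h \<in> Arr C" "Dom C g = Cod C c" "Dom C h = Cod C c"
    "Cod C g = Cod C h" "g \<odot> c = h \<odot> c"
  have "(g \<odot> c) \<odot> f = Zero C (Dom C f) (Cod C g)" using gh(1-5) c by simp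
  then have ex1: "\<exists>!u. u \<in> Hom C (Cod C c) (Cod C g) \<and> u \<odot> c = g \<odot> c"
    using assms gh(1-5) c unfolding is_cokernel_def by (auto simp: Hom_iff)
  show "g = h"
    by (rule ex1_equal[OF ex1]) (use gh in \<open>auto simp: Hom_iff\<close>)
qed

lemma is_kernelI:
  assumes "is_mono C k" "f \<in> Arr C" "Cod C k = Dom C f" "f \<odot> k = Zero C (Dom C k) (Cod C f)"
    and "\<And>h. \<lbrakk>h \<in> Arr C; Cod C h = Dom C f; f \<odot> h = Zero C (Dom C h) (Cod C f)\<rbrakk>
      \<Longrightarrow> \<exists>u. u \<in> Arr C \<and> Dom C u = Dom C h \<and> Cod C u = Dom C k \<and> k \<odot> u = h"
  shows "is_kernel C k f"
  unfolding is_kernel_def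
proof (intro conjI ballI impI)
  show "k \<in> Arr C" using assms(1) by (simp add: is_mono_def)
  fix X h assume h: "h \<in> Hom C X (Dom C f)" "f \<odot> h = Zero C X (Cod C f)"
  then obtain u where u: "u \<in> Arr C" "Dom C u = X" "Cod C u = Dom C k" "k \<odot> u = h"
    using assms(5)[of h] by (auto simp: Hom_iff)
  show "\<exists>!u. u \<in> Hom C X (Dom C k) \<and> k \<odot> u = h"
    by (rule ex1I[of _ u]) (use u in \<open>auto simp: Hom_iff intro: monoD[OF assms(1)]\<close>)
qed (use assms in auto)

lemma is_cokernelI:
  assumes "is_epi C c" "f \<in> Arr C" "Dom C c = Cod C f" "c \<odot> f = Zero C (Dom C f) (Cod C c)"
    and "\<And>h. \<lbrakk>h \<in> Arr C; Dom C h = Cod C f; h \<odot> f = Zero C (Dom C f) (Cod C h)\<rbrakk>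
      \<Longrightarrow> \<exists>u. u \<in> Arr C \<and> Cod C u = Cod C h \<and> Dom C u = Cod C c \<and> u \<odot> c = h"
  shows "is_cokernel C c f"
  unfolding is_cokernel_def
proof (intro conjI ballI impI)
  show "c \<in> Arr C" using assms(1) by (simp add: is_epi_def)
  fix Y h assume h: "h \<in> Hom C (Cod C f) Y" "h \<odot> f = Zero C (Dom C f) Y"
  then obtain u where u: "u \<in> Arr C" "Cod C u = Y" "Dom C u = Cod C c" "u \<odot> c = h"
    using assms(5)[of h] by (auto simp: Hom_iff)
  show "\<exists>!u. u \<in> Hom C (Cod C c) Y \<and> u \<odot> c = h"
    by (rule ex1I[of _ u]) (use u in \<open>auto simp: Hom_iff intro: epiD[OF assms(1)]\<close>)
qed (use assms in auto)

end

context abelian_category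
begin

text \<open>A mono is the kernel of some arrow, and that arrow factors through the cokernel.\<close>

lemma mono_kernel_of_cokernel:
  assumes m: "is_mono C m" and c: "is_cokernel C c m"
  shows "is_kernel C m c"
proof -
  obtain g where g: "is_kernel C m g" using mono_is_kernel[OF m] ..
  note gk = is_kernelD[OF g] and ck = is_cokernelD[OF c]
  obtain t where t: "t \<in> Arr C" "Cod C t = Cod C g" "Dom C t = Cod C c" "t \<odot> c = g"
    using cokernel_factor[OF c, of g] gk by auto
  show ?thesis
  proof (rule is_kernelI[OF m])
    fix h assume h: "h \<in> Arr C" "Cod C h = Dom C c" "c \<odot> h = Zero C (Dom C h) (Cod C c)"
    have "g \<odot> h = (t \<odot> c) \<odot> h" using t by simp
    also have "\<dots> = Zero C (Dom C h) (Cod C g)" using h t(1-3) ck by simp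
    finally show "\<exists>u. u \<in> Arr C \<and> Dom C u = Dom C h \<and> Cod C u = Dom C m \<and> m \<odot> u = h"
      using kernel_factor[OF g, of h] h gk ck by metis
  qed (use ck in simp_all)
qed

lemma epi_cokernel_of_kernel:
  assumes p: "is_epi C p" and k: "is_kernel C k p"
  shows "is_cokernel C p k"
proof -
  obtain g where g: "is_cokernel C p g" using epi_is_cokernel[OF p] ..
  note gk = is_cokernelD[OF g] and kk = is_kernelD[OF k]
  obtain t where t: "t \<in> Arr C" "Dom C t = Dom C g" "Cod C t = Dom C k" "k \<odot> t = g"
    using kernel_factor[OF k, of g] gk by auto
  show ?thesis
  proof (rule is_cokernelI[OF p])
    fix h assume h: "h \<in> Arr C" "Dom C h = Cod C k" "h \<odot> k = Zero C (Dom C k) (Cod C h)"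
    have "h \<odot> g = (h \<odot> k) \<odot> t" using t h(1,2) kk by simp
    also have "\<dots> = Zero C (Dom C g) (Cod C h)" using h t kk by simp
    finally show "\<exists>u. u \<in> Arr C \<and> Cod C u = Cod C h \<and> Dom C u = Cod C p \<and> u \<odot> p = h"
      using cokernel_factor[OF g, of h] h gk kk by metis
  qed (use kk in simp_all)
qed

lemma image_of_epi_mono:
  assumes p: "is_epi C p" and m: "is_mono C m" and pm: "Cod C p = Dom C m"
  shows "is_image C m (m \<odot> p)"
proof -
  have ar: "p \<in> Arr C" "m \<in> Arr C" using p m by (auto simp: is_epi_def is_mono_def)
  obtain c where c: "is_cokernel C c m" using has_cokernels ar by blast
  note ck = is_cokernelD[OF c]
  have "is_cokernel C c (m \<odot> p)"
  proof (rule is_cokernelI[OF cokernel_epi[OF c]])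
    have "c \<odot> m \<odot> p = (c \<odot> m) \<odot> p" using ck(1-3) ar pm by simp
    also have "\<dots> = Zero C (Dom C p) (Cod C c)" using ck ar pm by simp
    finally show "c \<odot> m \<odot> p = Zero C (Dom C (m \<odot> p)) (Cod C c)" using ar pm by simp
    fix h assume h: "h \<in> Arr C" "Dom C h = Cod C (m \<odot> p)"
      "h \<odot> m \<odot> p = Zero C (Dom C (m \<odot> p)) (Cod C h)"
    have "h \<odot> m = Zero C (Dom C m) (Cod C h)"
      by (rule epiD[OF p]) (use h ar pm in simp_all)
    then show "\<exists>u. u \<in> Arr C \<and> Cod C u = Cod C h \<and> Dom C u = Cod C c \<and> u \<odot> c = h"
      using cokernel_factor[OF c, of h] h ar pm by (metis Cmp_Arr(3))
  qed (use ar pm ck in simp_all)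
  then show ?thesis
    unfolding is_image_def using mono_kernel_of_cokernel[OF m c] by blast
qed

text \<open>The map from the source onto the image is epi, because every mono is a kernel.\<close>

lemma epi_onto_image:
  assumes "is_image C m f"
  obtains p where "is_epi C p" "p \<in> Arr C" "Dom C p = Dom C f" "Cod C p = Dom C m" "m \<odot> p = f"
proof -
  obtain c where c: "is_cokernel C c f" and m: "is_kernel C m c"
    using assms by (auto simp: is_image_def)
  note ck = is_cokernelD[OF c] and mk = is_kernelD[OF m]
  have mm: "is_mono C m" by (rule kernel_mono[OF m])
  obtain p where p: "p \<in> Arr C" "Dom C p = Dom C f" "Cod C p = Dom C m" "m \<odot> p = f"
    using kernel_factor[OF m, of f] ck by auto
  have "is_epi C p"
  proof (rule is_epiI)
    fix g h assume gh: "g \<in> Arr C" "h \<in> Arr C" "Dom C g = Cod C p" "Dom C h = Cod C p"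
      "Cod C g = Cod C h" "g \<odot> p = h \<odot> p"
    define w where "w = Diff C g h"
    have w: "w \<in> Arr C" "Dom C w = Dom C m" "Cod C w = Cod C h" using gh p by (simp_all add: w_def)
    obtain k where k: "is_kernel C k w" using has_kernels w by blast
    note kk = is_kernelD[OF k]
    have "w \<odot> p = Zero C (Dom C p) (Cod C w)" using gh p by (simp add: w_def Diff_Cmp)
    then obtain p' where p': "p' \<in> Arr C" "Dom C p' = Dom C f" "Cod C p' = Dom C k" "k \<odot> p' = p"
      using kernel_factor[OF k, of p] p w by auto
    have mk_mono: "is_mono C (m \<odot> k)"
    proof (rule mono_if_no_kernel)
      fix x assume x: "x \<in> Arr C" "Cod C x = Dom C (m \<odot> k)"
        "(m \<odot> k) \<odot> x = Zero C (Dom C x) (Cod C (m \<odot> k))"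
      have kx: "k \<odot> x = Zero C (Dom C x) (Dom C m)"
        by (rule monoD[OF mm]) (use x kk w mk in simp_all)
      show "x = Zero C (Dom C x) (Dom C (m \<odot> k))"
        by (rule monoD[OF kernel_mono[OF k]]) (use kx x kk w mk in simp_all)
    qed (use kk w mk in simp)
    obtain t where t: "is_kernel C (m \<odot> k) t" using mono_is_kernel[OF mk_mono] ..
    have tk: "t \<in> Arr C" "Dom C t = Cod C m" "t \<odot> m \<odot> k = Zero C (Dom C k) (Cod C t)"
      using is_kernelD[OF t] kk w mk by simp_all
    \<comment> \<open>A subobject of the image through which \<open>f\<close> factors is the kernel of some \<open>t\<close>; this \<open>t\<close>
      kills \<open>f\<close>, hence factors through the cokernel of \<open>f\<close> and kills the whole image.\<close>
    have "t \<odot> f = t \<odot> m \<odot> k \<odot> p'" using p p' by simp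
    also have "\<dots> = (t \<odot> m \<odot> k) \<odot> p'"
      using tk(1,2) p' kk w mk by simp
    also have "\<dots> = Zero C (Dom C f) (Cod C t)" using tk p' kk w mk by simp
    finally obtain t' where t': "t' \<in> Arr C" "Cod C t' = Cod C t" "Dom C t' = Cod C c" "t' \<odot> c = t"
      using cokernel_factor[OF c, of t] tk ck mk by auto
    have "t \<odot> m = (t' \<odot> c) \<odot> m" using t' by simp
    also have "\<dots> = t' \<odot> c \<odot> m" using t'(1-3) ck mk by simp
    also have "\<dots> = Zero C (Dom C m) (Cod C t)" using t'(1-3) mk by simp
    finally obtain v where v: "v \<in> Arr C" "Dom C v = Dom C m" "Cod C v = Dom C k" "(m \<odot> k) \<odot> v = m"
      using kernel_factor[OF t, of m] tk mk kk w by auto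
    have "k \<odot> v = Idn C (Dom C m)"
      by (rule monoD[OF mm]) (use v kk w mk in simp_all)
    then have "w = w \<odot> k \<odot> v" using w by simp
    also have "\<dots> = (w \<odot> k) \<odot> v" using w kk(1-3) v by simp
    also have "\<dots> = Zero C (Dom C m) (Cod C h)" using kk v w gh(2) by simp
    finally show "g = h" using gh p by (auto simp: w_def intro: Diff_eq_Zero)
  qed (rule p)
  then show thesis using that p by blast
qed

lemma exact_atD:
  assumes "exact_at C f g"
  shows "f \<in> Arr C" "g \<in> Arr C" "Cod C f = Dom C g" "g \<odot> f = Zero C (Dom C f) (Cod C g)"
proof -
  obtain m where m: "is_image C m f" "is_kernel C m g" using assms by (auto simp: exact_at_def)
  show fg: "f \<in> Arr C" "g \<in> Arr C" "Cod C f = Dom C g"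
    using assms m by (auto simp: exact_at_def is_image_def is_kernel_def is_cokernel_def)
  obtain p where p: "p \<in> Arr C" "Dom C p = Dom C f" "Cod C p = Dom C m" "m \<odot> p = f"
    using epi_onto_image[OF m(1)] by blast
  note mk = is_kernelD[OF m(2)]
  have "g \<odot> f = (g \<odot> m) \<odot> p" using mk(1-3) p by simp
  then show "g \<odot> f = Zero C (Dom C f) (Cod C g)" using mk p by simp
qed

text \<open>Arrows out of a projective object behave like elements: exactness amounts to lifting such arrows.
  For the converse it suffices that every object is covered by some test object in \<open>S\<close>; this
  freedom is used for the objects \<open>l P\<close> of a cleft extension.\<close>

lemma exact_at_lift:
  assumes "exact_at C f g" "projective C P" "y \<in> Arr C" "Dom C y = P" "Cod C y = Dom C g"
    "g \<odot> y = Zero C P (Cod C g)"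
  obtains x where "x \<in> Arr C" "Dom C x = P" "Cod C x = Dom C f" "f \<odot> x = y"
proof -
  obtain m where m: "is_image C m f" "is_kernel C m g" using assms by (auto simp: exact_at_def)
  note mk = is_kernelD[OF m(2)]
  obtain p where p: "is_epi C p" "p \<in> Arr C" "Dom C p = Dom C f" "Cod C p = Dom C m" "m \<odot> p = f"
    using epi_onto_image[OF m(1)] by blast
  obtain y' where y': "y' \<in> Arr C" "Dom C y' = P" "Cod C y' = Dom C m" "m \<odot> y' = y"
    using kernel_factor[OF m(2), of y] assms by auto
  obtain x where x: "x \<in> Arr C" "Dom C x = P" "Cod C x = Dom C p" "p \<odot> x = y'"
    using projective_lift[OF assms(2) p(1), of y'] y' p by auto
  have "f \<odot> x = m \<odot> p \<odot> x" using p x mk by auto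
  then show thesis using that x p y' by auto
qed

lemma exact_atI:
  assumes cover: "\<And>Y. Y \<in> Obj C \<Longrightarrow> \<exists>p. is_epi C p \<and> Dom C p \<in> S \<and> Cod C p = Y"
    and fg: "f \<in> Arr C" "g \<in> Arr C" "Cod C f = Dom C g" "g \<odot> f = Zero C (Dom C f) (Cod C g)"
    and lift: "\<And>y. \<lbrakk>y \<in> Arr C; Dom C y \<in> S; Cod C y = Dom C g;
      g \<odot> y = Zero C (Dom C y) (Cod C g)\<rbrakk>
      \<Longrightarrow> \<exists>x. x \<in> Arr C \<and> Dom C x = Dom C y \<and> Cod C x = Dom C f \<and> f \<odot> x = y"
  shows "exact_at C f g"
proof -
  obtain k where k: "is_kernel C k g" using has_kernels fg by blast
  note kk = is_kernelD[OF k]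
  have km: "is_mono C k" by (rule kernel_mono[OF k])
  obtain p where p: "p \<in> Arr C" "Dom C p = Dom C f" "Cod C p = Dom C k" "k \<odot> p = f"
    using kernel_factor[OF k, of f] fg by auto
  obtain r where r: "is_epi C r" "Dom C r \<in> S" "Cod C r = Dom C k" using cover[of "Dom C k"] kk by auto
  have ra: "r \<in> Arr C" using r by (simp add: is_epi_def)
  have "g \<odot> k \<odot> r = (g \<odot> k) \<odot> r" using kk(1-3) ra r by simp
  also have "\<dots> = Zero C (Dom C r) (Cod C g)" using kk ra r by simp
  finally obtain x where x: "x \<in> Arr C" "Dom C x = Dom C r" "Cod C x = Dom C f" "f \<odot> x = k \<odot> r"
    using lift[of "k \<odot> r"] kk ra r by auto
  have "p \<odot> x = r"
  proof (rule monoD[OF km])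
    have "k \<odot> p \<odot> x = (k \<odot> p) \<odot> x" using kk p(1-3) x by simp
    then show "k \<odot> p \<odot> x = k \<odot> r" using p(4) x by simp
  qed (use kk p x ra r in simp_all)
  have "is_epi C p"
  proof (rule is_epiI)
    fix a b assume ab: "a \<in> Arr C" "b \<in> Arr C" "Dom C a = Cod C p" "Dom C b = Cod C p"
      "Cod C a = Cod C b" "a \<odot> p = b \<odot> p"
    have "(a \<odot> p) \<odot> x = (b \<odot> p) \<odot> x" using ab by simp
    then have "a \<odot> r = b \<odot> r" using ab(1-5) p x \<open>p \<odot> x = r\<close> by simp
    then show "a = b" by (rule epiD[OF r(1)]) (use ab p r in simp_all)
  qed (rule p)
  then have "is_image C k f" using image_of_epi_mono[OF _ km, of p] p by simp
  then show ?thesis using k fg by (auto simp: exact_at_def)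
qed

end

section \<open>Complexes\<close>

definition is_complex :: "('o, 'm) cat \<Rightarrow> (int \<Rightarrow> 'm) \<Rightarrow> bool" where
  "is_complex C d \<longleftrightarrow> (\<forall>n. d n \<in> Arr C \<and> Cod C (d n) = Dom C (d (n + 1)) \<and>
     d (n + 1) \<odot>\<^bsub>C\<^esub> d n = Zero C (Dom C (d n)) (Cod C (d (n + 1))))"

definition chain_map :: "('o, 'm) cat \<Rightarrow> (int \<Rightarrow> 'm) \<Rightarrow> (int \<Rightarrow> 'm) \<Rightarrow> (int \<Rightarrow> 'm) \<Rightarrow> bool" where
  "chain_map C d d' u \<longleftrightarrow> (\<forall>n. u n \<in> Hom C (Dom C (d n)) (Dom C (d' n)) \<and>
     u (n + 1) \<odot>\<^bsub>C\<^esub> d n = d' n \<odot>\<^bsub>C\<^esub> u n)"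

text \<open>The successor index is a variable \<open>n'\<close> with \<open>n' = n + 1\<close>, here and below, so that the facts apply
  to a degree in whatever form it is given.\<close>

lemma is_complexD:
  assumes "is_complex C d"
  shows "d n \<in> Arr C" "n' = n + 1 \<Longrightarrow> Cod C (d n) = Dom C (d n')"
    "n' = n + 1 \<Longrightarrow> d n' \<odot>\<^bsub>C\<^esub> d n = Zero C (Dom C (d n)) (Cod C (d n'))"
  using assms by (simp_all add: is_complex_def)

lemma chain_mapD:
  assumes "chain_map C d d' u"
  shows "u n \<in> Arr C" "Dom C (u n) = Dom C (d n)" "Cod C (u n) = Dom C (d' n)"
    "n' = n + 1 \<Longrightarrow> u n' \<odot>\<^bsub>C\<^esub> d n = d' n \<odot>\<^bsub>C\<^esub> u n"
  using assms by (simp_all add: chain_map_def Hom_iff)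

context category
begin

text \<open>Reassociated form of an equation between composites, for use inside longer composites.\<close>

lemma Cmp_eq_Cmp:
  assumes "a \<odot> b = c \<odot> d" "a \<in> Arr C" "b \<in> Arr C" "c \<in> Arr C" "d \<in> Arr C" "x \<in> Arr C"
    "Cod C b = Dom C a" "Cod C d = Dom C c" "Cod C x = Dom C b" "Dom C d = Dom C b"
  shows "a \<odot> b \<odot> x = c \<odot> d \<odot> x"
proof -
  have "(a \<odot> b) \<odot> x = (c \<odot> d) \<odot> x" by (simp add: assms(1))
  then show ?thesis using assms(2-) by simp
qed

lemma Cmp_eq:
  assumes "a \<odot> b = c" "a \<in> Arr C" "b \<in> Arr C" "x \<in> Arr C"
    "Cod C b = Dom C a" "Cod C x = Dom C b"
  shows "a \<odot> b \<odot> x = c \<odot> x"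
  using assms by auto

end

context preadditive_category
begin

lemma Cmp_eq_Zero:
  assumes "a \<odot> b = Zero C X Y" "a \<in> Arr C" "b \<in> Arr C" "x \<in> Arr C"
    "Cod C b = Dom C a" "Cod C x = Dom C b" "Dom C b = X" "Cod C a = Y"
  shows "a \<odot> b \<odot> x = Zero C (Dom C x) Y"
  using Cmp_eq[OF assms(1-6)] assms by auto

lemma short_exactD:
  assumes "short_exact C a b"
  shows "is_kernel C a b" "is_cokernel C b a" "is_mono C a" "is_epi C b"
    "a \<in> Arr C" "b \<in> Arr C" "Cod C a = Dom C b" "b \<odot> a = Zero C (Dom C a) (Cod C b)"
  using assms kernel_mono cokernel_epi is_kernelD
  by (fastforce simp: short_exact_def)+

lemma mono_Cmp_eq_Zero:
  assumes "is_mono C a" "a \<odot> x = Zero C X Y" "x \<in> Arr C" "Cod C x = Dom C a" "Dom C x = X"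
    "Cod C a = Y"
  shows "x = Zero C X (Dom C a)"
proof -
  have a: "a \<in> Arr C" using assms by (simp add: is_mono_def)
  show ?thesis by (rule monoD[OF assms(1)]) (use assms(2-) a in auto)
qed

end

context abelian_category
begin

lemma acyclic_is_complex: "acyclic_complex C d \<Longrightarrow> is_complex C d"
  unfolding acyclic_complex_def is_complex_def using exact_atD by blast

lemma acyclic_lift:
  assumes "acyclic_complex C d" "n' = n + 1" "projective C P" "y \<in> Arr C" "Dom C y = P"
    "Cod C y = Dom C (d n')" "d n' \<odot> y = Zero C P (Cod C (d n'))"
  obtains x where "x \<in> Arr C" "Dom C x = P" "Cod C x = Dom C (d n)" "d n \<odot> x = y"
  using exact_at_lift[of "d n" "d n'" P y] assms by (auto simp: acyclic_complex_def)

lemma acyclic_complexI: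
  assumes ep: "enough_projectives C" and d: "is_complex C d"
    and lift: "\<And>n n' y. \<lbrakk>n' = n + 1; y \<in> Arr C; projective C (Dom C y); Cod C y = Dom C (d n');
      d n' \<odot> y = Zero C (Dom C y) (Cod C (d n'))\<rbrakk>
      \<Longrightarrow> \<exists>x. x \<in> Arr C \<and> Dom C x = Dom C y \<and> Cod C x = Dom C (d n) \<and> d n \<odot> x = y"
  shows "acyclic_complex C d"
  unfolding acyclic_complex_def
proof
  fix n
  show "exact_at C (d n) (d (n + 1))"
    by (rule exact_atI[of "Collect (projective C)"])
      (use ep is_complexD[OF d] lift in \<open>auto simp: enough_projectives_def\<close>)
qed

text \<open>Two instances of the long exact homology sequence, by chases with arrows out of
  projectives.\<close>

lemma acyclic_quotient:
  assumes ep: "enough_projectives C"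
    and k: "acyclic_complex C k" and l: "acyclic_complex C l" and m: "is_complex C m"
    and a: "chain_map C k l a" and b: "chain_map C l m b"
    and ab: "\<And>n. short_exact C (a n) (b n)"
  shows "acyclic_complex C m"
proof (rule acyclic_complexI[OF ep m])
  fix n n1 :: int and z
  assume n1: "n1 = n + 1" and z: "z \<in> Arr C" "projective C (Dom C z)" "Cod C z = Dom C (m n1)"
    "m n1 \<odot> z = Zero C (Dom C z) (Cod C (m n1))"
  obtain n2 where n2: "n2 = n1 + 1" by simp
  obtain n3 where n3: "n3 = n2 + 1" by simp
  note K = is_complexD[OF acyclic_is_complex[OF k]] and L = is_complexD[OF acyclic_is_complex[OF l]]
    and M = is_complexD[OF m] and A = chain_mapD[OF a] and B = chain_mapD[OF b]
    and E = short_exactD[OF ab]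
  note cod = K(2)[OF n1] K(2)[OF n2] K(2)[OF n3] L(2)[OF n1] L(2)[OF n2] L(2)[OF n3]
    M(2)[OF n1] M(2)[OF n2] M(2)[OF n3]
  note ty = K(1) L(1) M(1) A(1-3) B(1-3) cod
  obtain y where y: "y \<in> Arr C" "Dom C y = Dom C z" "Cod C y = Dom C (l n1)" "b n1 \<odot> y = z"
    using projective_lift[OF z(2) E(4)[of n1], of z] z by (auto simp: ty)
  have "b n2 \<odot> l n1 \<odot> y = m n1 \<odot> b n1 \<odot> y"
    by (rule Cmp_eq_Cmp[OF B(4)[OF n2]]) (simp_all add: ty y)
  also have "\<dots> = Zero C (Dom C z) (Cod C (b n2))" by (simp add: y z ty)
  finally obtain x where x: "x \<in> Arr C" "Dom C x = Dom C z" "Cod C x = Dom C (k n2)"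
    "a n2 \<odot> x = l n1 \<odot> y"
    using kernel_factor[OF E(1)[of n2], of "l n1 \<odot> y"] y by (auto simp: ty)
  have "a n3 \<odot> k n2 \<odot> x = l n2 \<odot> a n2 \<odot> x"
    by (rule Cmp_eq_Cmp[OF A(4)[OF n3]]) (simp_all add: ty x(1-3))
  also have "\<dots> = l n2 \<odot> l n1 \<odot> y" by (simp add: x)
  also have "\<dots> = Zero C (Dom C z) (Cod C (a n3))"
    using Cmp_eq_Zero[OF L(3)[OF n2] L(1) L(1), of y] by (simp add: ty y)
  finally have "k n2 \<odot> x = Zero C (Dom C z) (Dom C (a n3))"
    by (rule mono_Cmp_eq_Zero[OF E(3)]) (simp_all add: ty x(1-3))
  then obtain w where w: "w \<in> Arr C" "Dom C w = Dom C z" "Cod C w = Dom C (k n1)" "k n1 \<odot> w = x"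
    using acyclic_lift[OF k n2 z(2) x(1,2,3)] by (auto simp: ty)
  \<comment> \<open>Correcting the lift \<open>y\<close> of \<open>z\<close> by an arrow from the subcomplex turns it into a cycle.\<close>
  have law: "l n1 \<odot> a n1 \<odot> w = l n1 \<odot> y"
  proof -
    have "l n1 \<odot> a n1 \<odot> w = a n2 \<odot> k n1 \<odot> w"
      by (rule Cmp_eq_Cmp[OF A(4)[OF n2, symmetric]]) (simp_all add: ty w(1-3))
    then show ?thesis by (simp add: w x)
  qed
  define y' where "y' = Diff C y (a n1 \<odot> w)"
  have y': "y' \<in> Arr C" "Dom C y' = Dom C z" "Cod C y' = Dom C (l n1)"
    by (simp_all add: y'_def y w ty)
  have "l n1 \<odot> y' = Zero C (Dom C z) (Cod C (l n1))"
    by (simp add: y'_def Cmp_Diff y w ty law)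
  then obtain v where v: "v \<in> Arr C" "Dom C v = Dom C z" "Cod C v = Dom C (l n)" "l n \<odot> v = y'"
    using acyclic_lift[OF l n1 z(2) y'] by auto
  have "m n \<odot> b n \<odot> v = b n1 \<odot> l n \<odot> v"
    by (rule Cmp_eq_Cmp[OF B(4)[OF n1, symmetric]]) (simp_all add: ty v(1-3))
  also have "\<dots> = Diff C z (b n1 \<odot> a n1 \<odot> w)"
    by (simp add: v y'_def Cmp_Diff y w ty)
  also have "b n1 \<odot> a n1 \<odot> w = Zero C (Dom C z) (Cod C z)"
    using Cmp_eq_Zero[OF E(8)[of n1] E(6) E(5), of w] by (simp add: ty w z)
  finally have "m n \<odot> b n \<odot> v = z" by (simp add: z)
  then show "\<exists>x. x \<in> Arr C \<and> Dom C x = Dom C z \<and> Cod C x = Dom C (m n) \<and> m n \<odot> x = z"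
    by (intro exI[of _ "b n \<odot> v"]) (simp add: ty v)
qed

lemma acyclic_middle:
  assumes ep: "enough_projectives C"
    and k: "acyclic_complex C k" and l: "is_complex C l" and m: "acyclic_complex C m"
    and a: "chain_map C k l a" and b: "chain_map C l m b"
    and ab: "\<And>n. short_exact C (a n) (b n)"
  shows "acyclic_complex C l"
proof (rule acyclic_complexI[OF ep l])
  fix n n1 :: int and y
  assume n1: "n1 = n + 1" and y: "y \<in> Arr C" "projective C (Dom C y)" "Cod C y = Dom C (l n1)"
    "l n1 \<odot> y = Zero C (Dom C y) (Cod C (l n1))"
  obtain n2 where n2: "n2 = n1 + 1" by simp
  note K = is_complexD[OF acyclic_is_complex[OF k]] and L = is_complexD[OF l]
    and M = is_complexD[OF acyclic_is_complex[OF m]] and A = chain_mapD[OF a] and B = chain_mapD[OF b]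
    and E = short_exactD[OF ab]
  note cod = K(2)[OF n1] K(2)[OF n2] L(2)[OF n1] L(2)[OF n2] M(2)[OF n1] M(2)[OF n2]
  note ty = K(1) L(1) M(1) A(1-3) B(1-3) cod
  have "m n1 \<odot> b n1 \<odot> y = b n2 \<odot> l n1 \<odot> y"
    by (rule Cmp_eq_Cmp[OF B(4)[OF n2, symmetric]]) (simp_all add: ty y(1-3))
  also have "\<dots> = Zero C (Dom C y) (Cod C (m n1))" by (simp add: y ty)
  finally obtain z where z: "z \<in> Arr C" "Dom C z = Dom C y" "Cod C z = Dom C (m n)"
    "m n \<odot> z = b n1 \<odot> y"
    using acyclic_lift[OF m n1 y(2), of "b n1 \<odot> y"] y by (auto simp: ty)
  obtain v where v: "v \<in> Arr C" "Dom C v = Dom C y" "Cod C v = Dom C (l n)" "b n \<odot> v = z"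
    using projective_lift[OF y(2) E(4)[of n], of z] z by (auto simp: ty)
  define y' where "y' = Diff C y (l n \<odot> v)"
  have y': "y' \<in> Arr C" "Dom C y' = Dom C y" "Cod C y' = Dom C (l n1)"
    by (simp_all add: y'_def y v ty)
  have "b n1 \<odot> l n \<odot> v = m n \<odot> b n \<odot> v"
    by (rule Cmp_eq_Cmp[OF B(4)[OF n1]]) (simp_all add: ty v(1-3))
  then have "b n1 \<odot> y' = Zero C (Dom C y) (Cod C (b n1))"
    by (simp add: y'_def Cmp_Diff y v ty z)
  then obtain x where x: "x \<in> Arr C" "Dom C x = Dom C y" "Cod C x = Dom C (k n1)" "a n1 \<odot> x = y'"
    using kernel_factor[OF E(1)[of n1], of y'] y' by (auto simp: ty)
  have "a n2 \<odot> k n1 \<odot> x = l n1 \<odot> a n1 \<odot> x"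
    by (rule Cmp_eq_Cmp[OF A(4)[OF n2]]) (simp_all add: ty x(1-3))
  also have "\<dots> = Diff C (l n1 \<odot> y) (l n1 \<odot> l n \<odot> v)" 
    by (simp add: x(4), simp add: y'_def Cmp_Diff y(1-3) v ty)
  also have "l n1 \<odot> l n \<odot> v = Zero C (Dom C y) (Cod C (l n1))"
    using Cmp_eq_Zero[OF L(3)[OF n1] L(1) L(1), of v] by (simp add: ty v)
  finally have "a n2 \<odot> k n1 \<odot> x = Zero C (Dom C y) (Cod C (a n2))" by (simp add: y ty)
  then have "k n1 \<odot> x = Zero C (Dom C y) (Dom C (a n2))"
    by (rule mono_Cmp_eq_Zero[OF E(3)]) (simp_all add: ty x(1-3))
  then obtain w where w: "w \<in> Arr C" "Dom C w = Dom C y" "Cod C w = Dom C (k n)" "k n \<odot> w = x"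
    using acyclic_lift[OF k n1 y(2) x(1,2,3)] by (auto simp: ty)
  have "l n \<odot> a n \<odot> w = a n1 \<odot> k n \<odot> w"
    by (rule Cmp_eq_Cmp[OF A(4)[OF n1, symmetric]]) (simp_all add: ty w(1-3))
  then have law: "l n \<odot> a n \<odot> w = y'" by (simp add: w x)
  have "l n \<odot> Add C (a n \<odot> w) v = Add C y' (l n \<odot> v)"
    by (simp add: Cmp_Add ty w v law)
  also have "\<dots> = y" using Add_Diff[of y "l n \<odot> v"] by (simp add: y'_def y v ty)
  finally show "\<exists>x. x \<in> Arr C \<and> Dom C x = Dom C y \<and> Cod C x = Dom C (l n) \<and> l n \<odot> x = y"
    by (intro exI[of _ "Add C (a n \<odot> w) v"]) (simp add: ty v w)
qed

lemma acyclic_iso: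
  assumes ep: "enough_projectives C" and d: "acyclic_complex C d" and d': "is_complex C d'"
    and u: "chain_map C d d' u" and iso: "\<And>n. is_iso C (u n)"
  shows "acyclic_complex C d'"
proof (rule acyclic_complexI[OF ep d'])
  fix n n1 :: int and y
  assume n1: "n1 = n + 1" and y: "y \<in> Arr C" "projective C (Dom C y)" "Cod C y = Dom C (d' n1)"
    "d' n1 \<odot> y = Zero C (Dom C y) (Cod C (d' n1))"
  obtain n2 where n2: "n2 = n1 + 1" by simp
  note D = is_complexD[OF acyclic_is_complex[OF d]] and D' = is_complexD[OF d'] and U = chain_mapD[OF u]
  note ty = D(1) D'(1) U(1-3) D(2)[OF n1] D(2)[OF n2] D'(2)[OF n1] D'(2)[OF n2]
  obtain v1 where v1: "v1 \<in> Arr C" "Dom C v1 = Dom C (d' n1)" "Cod C v1 = Dom C (d n1)"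
    "u n1 \<odot> v1 = Idn C (Dom C (d' n1))"
    using is_isoD[OF iso[of n1]] by (metis U(2,3))
  have "is_mono C (u n2)"
    using is_isoD[OF iso[of n2]] split_mono[OF U(1), of _ n2] by (metis Hom_iff)
  have uvy: "u n1 \<odot> v1 \<odot> y = y"
    using Cmp_eq[OF v1(4) U(1) v1(1), of y] y(1-3) v1(1-3) ty by simp
  have "u n2 \<odot> d n1 \<odot> v1 \<odot> y = d' n1 \<odot> u n1 \<odot> v1 \<odot> y"
    by (rule Cmp_eq_Cmp[OF U(4)[OF n2]]) (simp_all add: ty v1(1-3) y(1-3))
  also have "\<dots> = Zero C (Dom C y) (Cod C (u n2))" by (simp add: uvy y ty)
  finally have "d n1 \<odot> v1 \<odot> y = Zero C (Dom C y) (Dom C (u n2))"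
    by (rule mono_Cmp_eq_Zero[OF \<open>is_mono C (u n2)\<close>]) (simp_all add: ty v1(1-3) y(1-3))
  then obtain x where x: "x \<in> Arr C" "Dom C x = Dom C y" "Cod C x = Dom C (d n)" "d n \<odot> x = v1 \<odot> y"
    using acyclic_lift[OF d n1 y(2), of "v1 \<odot> y"] by (auto simp: ty v1(1-3) y(1-3))
  have "d' n \<odot> u n \<odot> x = u n1 \<odot> d n \<odot> x"
    by (rule Cmp_eq_Cmp[OF U(4)[OF n1, symmetric]]) (simp_all add: ty x(1-3))
  then show "\<exists>x. x \<in> Arr C \<and> Dom C x = Dom C y \<and> Cod C x = Dom C (d' n) \<and> d' n \<odot> x = y"
    by (intro exI[of _ "u n \<odot> x"]) (simp add: ty x uvy)
qed

end

section \<open>Hom complexes\<close>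

context abelian_category
begin

lemma precompose_hom:
  assumes "a \<in> Arr C" "Q \<in> Obj C"
  shows "(\<lambda>f. f \<odot> a) \<in> hom (hom_group C (Cod C a) Q) (hom_group C (Dom C a) Q)"
  by (rule homI) (use assms in \<open>auto simp: hom_group_def Hom_iff Add_Cmp\<close>)

lemma hom_acyclic_iff:
  assumes d: "is_complex C d" and Q: "Q \<in> Obj C"
  shows "hom_acyclic C d Q \<longleftrightarrow>
    (\<forall>n n'. n' = n + 1 \<longrightarrow> (\<forall>f. f \<in> Arr C \<and> Dom C f = Dom C (d n') \<and> Cod C f = Q \<and>
        f \<odot> d n = Zero C (Dom C (d n)) Q \<longrightarrow>
      (\<exists>g. g \<in> Arr C \<and> Dom C g = Cod C (d n') \<and> Cod C g = Q \<and> g \<odot> d n' = f)))"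
    (is "_ \<longleftrightarrow> ?R")
proof -
  let ?H = "\<lambda>n. hom_group C (Dom C (d n)) Q"
  let ?p = "\<lambda>n f. f \<odot> d n"
  note D = is_complexD[OF d]
  have grp: "group (?H n)" for n
    using comm_group.axioms(2)[OF hom_group] D(1) Q by simp
  have homs: "?p n \<in> hom (?H (n + 1)) (?H n)" for n
    using precompose_hom[OF D(1)[of n] Q] D(2)[of "n + 1" n] by simp
  have homs2: "?p (n + 1) \<in> hom (?H (n + 2)) (?H (n + 1))" for n
    using homs[of "n + 1"] by (simp add: add.commute add.left_commute)
  have gh: "group_hom (?H (n + 2)) (?H (n + 1)) (?p (n + 1))" for n
    using grp homs2 by (simp add: group_hom_def group_hom_axioms_def)
  have cod2: "Cod C (d (n + 1)) = Dom C (d (n + 2))" for n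
    using D(2)[of "n + 2" "n + 1"] by simp
  have "hom_acyclic C d Q \<longleftrightarrow> (\<forall>n. kernel (?H (n + 1)) (?H n) (?p n) = ?p (n + 1) ` carrier (?H (n + 2)))"
    unfolding hom_acyclic_def using grp homs gh by simp
  also have "\<dots> \<longleftrightarrow> ?R"
  proof (intro iffI allI impI)
    fix n n' f
    assume *: "\<forall>n. kernel (?H (n + 1)) (?H n) (?p n) = ?p (n + 1) ` carrier (?H (n + 2))"
      and f: "n' = n + 1" "f \<in> Arr C \<and> Dom C f = Dom C (d n') \<and> Cod C f = Q \<and>
        f \<odot> d n = Zero C (Dom C (d n)) Q"
    have "f \<in> kernel (?H (n + 1)) (?H n) (?p n)"
      using f by (simp add: kernel_def hom_group_def Hom_iff)
    then have "f \<in> ?p (n + 1) ` carrier (?H (n + 2))" using * by blast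
    then show "\<exists>g. g \<in> Arr C \<and> Dom C g = Cod C (d n') \<and> Cod C g = Q \<and> g \<odot> d n' = f"
      using f(1) cod2[of n] by (auto simp: hom_group_def Hom_iff)
  next
    fix n assume R: ?R
    show "kernel (?H (n + 1)) (?H n) (?p n) = ?p (n + 1) ` carrier (?H (n + 2))"
    proof (intro equalityI subsetI)
      fix f assume "f \<in> kernel (?H (n + 1)) (?H n) (?p n)"
      then have "f \<in> Arr C \<and> Dom C f = Dom C (d (n + 1)) \<and> Cod C f = Q \<and>
        f \<odot> d n = Zero C (Dom C (d n)) Q"
        by (simp add: kernel_def hom_group_def Hom_iff)
      then obtain g where "g \<in> Arr C" "Dom C g = Cod C (d (n + 1))" "Cod C g = Q" "g \<odot> d (n + 1) = f"
        using R by blast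
      then show "f \<in> ?p (n + 1) ` carrier (?H (n + 2))"
        using cod2[of n] by (auto simp: hom_group_def Hom_iff)
    next
      fix f assume "f \<in> ?p (n + 1) ` carrier (?H (n + 2))"
      then obtain g where g: "g \<in> Arr C" "Dom C g = Cod C (d (n + 1))" "Cod C g = Q" "f = g \<odot> d (n + 1)"
        using cod2[of n] by (auto simp: hom_group_def Hom_iff)
      have "f \<odot> d n = g \<odot> d (n + 1) \<odot> d n"
        using g D(1) D(2)[of "n + 1" n] by simp
      also have "\<dots> = Zero C (Dom C (d n)) Q"
        using g D(1) D(2)[of "n + 1" n] D(3)[of "n + 1" n] by simp
      finally show "f \<in> kernel (?H (n + 1)) (?H n) (?p n)"
        using g D(1) by (simp add: kernel_def hom_group_def Hom_iff)
    qed
  qed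
  finally show ?thesis .
qed

lemma hom_acyclicI:
  assumes "is_complex C d" "Q \<in> Obj C"
    and "\<And>n n' f. \<lbrakk>n' = n + 1; f \<in> Arr C; Dom C f = Dom C (d n'); Cod C f = Q;
      f \<odot> d n = Zero C (Dom C (d n)) Q\<rbrakk>
      \<Longrightarrow> \<exists>g. g \<in> Arr C \<and> Dom C g = Cod C (d n') \<and> Cod C g = Q \<and> g \<odot> d n' = f"
  shows "hom_acyclic C d Q"
  using assms by (simp add: hom_acyclic_iff)

lemma hom_acyclic_extend:
  assumes "hom_acyclic C d Q" "is_complex C d" "n' = n + 1"
    "f \<in> Arr C" "Dom C f = Dom C (d n')" "Cod C f = Q" "f \<odot> d n = Zero C (Dom C (d n)) Q"
  obtains g where "g \<in> Arr C" "Dom C g = Cod C (d n')" "Cod C g = Q" "g \<odot> d n' = f"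
proof -
  have "Q \<in> Obj C" using assms(4,6) by auto
  with assms hom_acyclic_iff[of d Q] that show thesis by metis
qed

lemma hom_acyclic_zero_object:
  assumes d: "is_complex C d" and Z: "is_zero_object C Z"
  shows "hom_acyclic C d Z"
proof (rule hom_acyclicI[OF d])
  show "Z \<in> Obj C" using Z by (simp add: is_zero_object_iff)
  fix n n' :: int and f
  assume f: "f \<in> Arr C" "Dom C f = Dom C (d n')" "Cod C f = Z"
  note D = is_complexD[OF d]
  have "Zero C (Cod C (d n')) Z \<odot> d n' = f"
    by (rule zero_object_maps_into[OF Z, of _ "Dom C (d n')"])
      (use f D(1) \<open>Z \<in> Obj C\<close> in \<open>simp_all add: Hom_iff\<close>)
  then show "\<exists>g. g \<in> Arr C \<and> Dom C g = Cod C (d n') \<and> Cod C g = Z \<and> g \<odot> d n' = f"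
    using D(1) \<open>Z \<in> Obj C\<close> by (intro exI[of _ "Zero C (Cod C (d n')) Z"]) simp
qed

lemma hom_acyclic_retract:
  assumes d: "is_complex C d" and Q': "hom_acyclic C d Q'"
    and s: "s \<in> Hom C Q Q'" and r: "r \<in> Hom C Q' Q" and rs: "r \<odot> s = Idn C Q"
  shows "hom_acyclic C d Q"
proof (rule hom_acyclicI[OF d])
  note D = is_complexD[OF d]
  note sr = s[unfolded Hom_iff] r[unfolded Hom_iff]
  show "Q \<in> Obj C" using sr by auto
  fix n n' :: int and f
  assume n': "n' = n + 1" and f: "f \<in> Arr C" "Dom C f = Dom C (d n')" "Cod C f = Q"
    "f \<odot> d n = Zero C (Dom C (d n)) Q"
  obtain g where g: "g \<in> Arr C" "Dom C g = Cod C (d n')" "Cod C g = Q'" "g \<odot> d n' = s \<odot> f"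
    by (rule hom_acyclic_extend[OF Q' d n', of "s \<odot> f"])
      (use D(1) D(2)[OF n'] f sr \<open>Q \<in> Obj C\<close> in auto)
  have "r \<odot> s \<odot> f = f" using Cmp_eq[OF rs, of f] f sr by simp
  then show "\<exists>g. g \<in> Arr C \<and> Dom C g = Cod C (d n') \<and> Cod C g = Q \<and> g \<odot> d n' = f"
    using g sr D(1) by (intro exI[of _ "r \<odot> g"]) simp
qed

lemma hom_acyclic_iso:
  assumes "is_complex C d" "hom_acyclic C d Q" "is_iso C u" "Dom C u = Q" "Cod C u = Q'"
  shows "hom_acyclic C d Q'"
proof -
  have u: "u \<in> Arr C" using assms by (simp add: is_iso_def)
  obtain v where "v \<in> Arr C" "Dom C v = Cod C u" "Cod C v = Dom C u" "u \<odot> v = Idn C (Cod C u)"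
    using is_isoD[OF assms(3)] by metis
  then show ?thesis
    using hom_acyclic_retract[OF assms(1,2), of v Q' u] assms u by (simp add: Hom_iff)
qed

text \<open>As the terms of \<open>d\<close> are projective, a short exact sequence of coefficient objects induces a short
  exact sequence of Hom complexes. Two instances of its long exact sequence are needed.\<close>

lemma hom_acyclic_quotient:
  assumes d: "is_complex C d" and proj: "\<And>n. projective C (Dom C (d n))"
    and ab: "short_exact C a b" and K: "hom_acyclic C d (Dom C a)" and L: "hom_acyclic C d (Dom C b)"
  shows "hom_acyclic C d (Cod C b)"
proof (rule hom_acyclicI[OF d])
  note D = is_complexD[OF d] and E = short_exactD[OF ab]
  show "Cod C b \<in> Obj C" using E by simp
  fix n n1 :: int and f
  assume n1: "n1 = n + 1" and f: "f \<in> Arr C" "Dom C f = Dom C (d n1)" "Cod C f = Cod C b"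
    "f \<odot> d n = Zero C (Dom C (d n)) (Cod C b)"
  obtain n0 where n0: "n = n0 + 1" by (metis diff_add_cancel)
  note ty = D(1) D(2)[OF n1] D(2)[OF n0] E(5-7)
  obtain y where y: "y \<in> Arr C" "Dom C y = Dom C (d n1)" "Cod C y = Dom C b" "b \<odot> y = f"
    using projective_lift[OF proj E(4), of f n1] f by auto
  have "b \<odot> y \<odot> d n = f \<odot> d n" by (rule Cmp_eq[OF y(4)]) (simp_all add: y(1-3) ty)
  then obtain x where x: "x \<in> Arr C" "Dom C x = Dom C (d n)" "Cod C x = Dom C a" "a \<odot> x = y \<odot> d n"
    using kernel_factor[OF E(1), of "y \<odot> d n"] f y(1-3) by (auto simp: ty)
  have "a \<odot> x \<odot> d n0 = (a \<odot> x) \<odot> d n0" by (simp add: x(1-3) ty)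
  also have "\<dots> = y \<odot> d n \<odot> d n0" by (simp add: x(4)) (simp add: y ty)
  also have "\<dots> = Zero C (Dom C (d n0)) (Cod C a)"
    by (simp add: D(3)[OF n0] y ty)
  finally have "x \<odot> d n0 = Zero C (Dom C (d n0)) (Dom C a)"
    by (rule mono_Cmp_eq_Zero[OF E(3)]) (simp_all add: ty x(1-3))
  then obtain w where w: "w \<in> Arr C" "Dom C w = Cod C (d n)" "Cod C w = Dom C a" "w \<odot> d n = x"
    using hom_acyclic_extend[OF K d n0 x(1,2,3)] by auto
  define y' where "y' = Diff C y (a \<odot> w)"
  have y': "y' \<in> Arr C" "Dom C y' = Dom C (d n1)" "Cod C y' = Dom C b"
    by (simp_all add: y'_def y w ty)
  have "y' \<odot> d n = Zero C (Dom C (d n)) (Dom C b)"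
    by (simp add: y'_def Diff_Cmp y(1-3) w ty x)
  then obtain v where v: "v \<in> Arr C" "Dom C v = Cod C (d n1)" "Cod C v = Dom C b" "v \<odot> d n1 = y'"
    using hom_acyclic_extend[OF L d n1 y'] by auto
  have "b \<odot> y' = Diff C f (b \<odot> a \<odot> w)" by (simp add: y'_def Cmp_Diff y w ty)
  also have "b \<odot> a \<odot> w = Zero C (Dom C f) (Cod C f)"
    using Cmp_eq_Zero[OF E(8) E(6,5) w(1)] w f by (simp add: ty)
  finally have "b \<odot> v \<odot> d n1 = f" by (simp add: v f)
  then show "\<exists>g. g \<in> Arr C \<and> Dom C g = Cod C (d n1) \<and> Cod C g = Cod C b \<and> g \<odot> d n1 = f"
    using v(1-3) by (intro exI[of _ "b \<odot> v"]) (simp add: ty)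
qed

lemma hom_acyclic_middle:
  assumes d: "is_complex C d" and proj: "\<And>n. projective C (Dom C (d n))"
    and ab: "short_exact C a b" and K: "hom_acyclic C d (Dom C a)" and M: "hom_acyclic C d (Cod C b)"
  shows "hom_acyclic C d (Dom C b)"
proof (rule hom_acyclicI[OF d])
  note D = is_complexD[OF d] and E = short_exactD[OF ab]
  show "Dom C b \<in> Obj C" using E by simp
  fix n n1 :: int and f
  assume n1: "n1 = n + 1" and f: "f \<in> Arr C" "Dom C f = Dom C (d n1)" "Cod C f = Dom C b"
    "f \<odot> d n = Zero C (Dom C (d n)) (Dom C b)"
  obtain n2 where n2: "n2 = n1 + 1" by simp
  note ty = D(1) D(2)[OF n1] D(2)[OF n2] E(5-7)
  obtain h where h: "h \<in> Arr C" "Dom C h = Cod C (d n1)" "Cod C h = Cod C b" "h \<odot> d n1 = b \<odot> f"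
    by (rule hom_acyclic_extend[OF M d n1, of "b \<odot> f"]) (simp_all add: f ty)
  obtain v where v: "v \<in> Arr C" "Dom C v = Cod C (d n1)" "Cod C v = Dom C b" "b \<odot> v = h"
    using projective_lift[OF proj E(4), of h n2] h by (auto simp: ty)
  define f' where "f' = Diff C f (v \<odot> d n1)"
  have f': "f' \<in> Arr C" "Dom C f' = Dom C (d n1)" "Cod C f' = Dom C b"
    by (simp_all add: f'_def f v ty)
  have "b \<odot> v \<odot> d n1 = b \<odot> f"
    using Cmp_eq[OF v(4), of "d n1"] h v(1-3) by (simp add: ty)
  then have "b \<odot> f' = Zero C (Dom C (d n1)) (Cod C b)"
    by (simp add: f'_def Cmp_Diff f(1-3) v(1-3) ty)
  then obtain x where x: "x \<in> Arr C" "Dom C x = Dom C (d n1)" "Cod C x = Dom C a" "a \<odot> x = f'"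
    using kernel_factor[OF E(1), of f'] f' by auto
  have "a \<odot> x \<odot> d n = f' \<odot> d n" by (rule Cmp_eq[OF x(4)]) (simp_all add: x(1-3) ty)
  also have "\<dots> = Zero C (Dom C (d n)) (Cod C a)"
    by (simp add: f'_def Diff_Cmp f v(1-3) ty D(3)[OF n1])
  finally have "x \<odot> d n = Zero C (Dom C (d n)) (Dom C a)"
    by (rule mono_Cmp_eq_Zero[OF E(3)]) (simp_all add: ty x(1-3))
  then obtain w where w: "w \<in> Arr C" "Dom C w = Cod C (d n1)" "Cod C w = Dom C a" "w \<odot> d n1 = x"
    using hom_acyclic_extend[OF K d n1 x(1,2,3)] by auto
  have "Add C (a \<odot> w) v \<odot> d n1 = Add C f' (v \<odot> d n1)"
    by (simp add: Add_Cmp w v(1-3) ty x)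
  also have "\<dots> = f" using Add_Diff[of f "v \<odot> d n1"] by (simp add: f'_def f v(1-3) ty)
  finally show "\<exists>g. g \<in> Arr C \<and> Dom C g = Cod C (d n1) \<and> Cod C g = Dom C b \<and> g \<odot> d n1 = f"
    using v(1-3) w by (intro exI[of _ "Add C (a \<odot> w) v"]) (simp add: ty)
qed

end

section \<open>Functors and adjunctions\<close>

lemma fcomp_simps [simp]:
  "FObj (S \<circ>\<^sub>F T) X = FObj S (FObj T X)" "FArr (S \<circ>\<^sub>F T) f = FArr S (FArr T f)"
  by (simp_all add: fcomp_def)

lemma fid_simps [simp]: "FObj fid X = X" "FArr fid f = f"
  by (simp_all add: fid_def)

text \<open>This is what makes a functor map complexes to complexes.\<close>

definition zero_preserving ::
    "('o, 'm) cat \<Rightarrow> ('p, 'n) cat \<Rightarrow> ('o, 'm, 'p, 'n) func \<Rightarrow> bool" where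
  "zero_preserving C D T \<longleftrightarrow>
     (\<forall>X\<in>Obj C. \<forall>Y\<in>Obj C. FArr T (Zero C X Y) = Zero D (FObj T X) (FObj T Y))"

locale functor_on = C: category C + D: category D
  for C :: "('o, 'm) cat" and D :: "('p, 'n) cat" and T :: "('o, 'm, 'p, 'n) func" +
  assumes is_functor: "is_functor C D T"
begin

lemma T_Obj [simp]: "X \<in> Obj C \<Longrightarrow> FObj T X \<in> Obj D"
  using is_functor by (simp add: is_functor_def)

lemma T_Idn [simp]: "X \<in> Obj C \<Longrightarrow> FArr T (Idn C X) = Idn D (FObj T X)"
  using is_functor by (simp add: is_functor_def)

lemma T_Arr [simp]:
  assumes "f \<in> Arr C"
  shows "FArr T f \<in> Arr D" "Dom D (FArr T f) = FObj T (Dom C f)" "Cod D (FArr T f) = FObj T (Cod C f)"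
  using is_functor assms by (simp_all add: is_functor_def Hom_iff)

lemma T_Cmp [simp]:
  "\<lbrakk>f \<in> Arr C; g \<in> Arr C; Cod C f = Dom C g\<rbrakk> \<Longrightarrow> FArr T (g \<odot>\<^bsub>C\<^esub> f) = FArr T g \<odot>\<^bsub>D\<^esub> FArr T f"
  using is_functor by (simp add: is_functor_def)

lemma T_square:
  assumes "a \<odot>\<^bsub>C\<^esub> b = c \<odot>\<^bsub>C\<^esub> d" "a \<in> Arr C" "b \<in> Arr C" "c \<in> Arr C" "d \<in> Arr C"
    "Cod C b = Dom C a" "Cod C d = Dom C c"
  shows "FArr T a \<odot>\<^bsub>D\<^esub> FArr T b = FArr T c \<odot>\<^bsub>D\<^esub> FArr T d"
  using assms by (metis T_Cmp)

lemma T_eq: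
  assumes "a \<odot>\<^bsub>C\<^esub> b = c" "a \<in> Arr C" "b \<in> Arr C" "Cod C b = Dom C a"
  shows "FArr T a \<odot>\<^bsub>D\<^esub> FArr T b = FArr T c"
  using assms by (metis T_Cmp)

lemma T_iso:
  assumes "is_iso C u"
  shows "is_iso D (FArr T u)"
proof -
  have u: "u \<in> Arr C" using assms by (simp add: is_iso_def)
  obtain v where v: "v \<in> Arr C" "Dom C v = Cod C u" "Cod C v = Dom C u"
    "v \<odot>\<^bsub>C\<^esub> u = Idn C (Dom C u)" "u \<odot>\<^bsub>C\<^esub> v = Idn C (Cod C u)"
    using C.is_isoD[OF assms] by metis
  show ?thesis
    by (rule D.is_isoI[of _ "FArr T v"]) (use u v T_eq[OF v(4)] T_eq[OF v(5)] in simp_all)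
qed

lemma T_is_complex:
  assumes "zero_preserving C D T" "is_complex C d"
  shows "is_complex D (FArr T \<circ> d)"
proof -
  note dd = is_complexD[OF assms(2)]
  have "FArr T (d n') \<odot>\<^bsub>D\<^esub> FArr T (d n) = Zero D (FObj T (Dom C (d n))) (FObj T (Cod C (d n')))"
    if "n' = n + 1" for n n'
    using T_eq[OF dd(3)[OF that]] dd(1) dd(2)[OF that] assms(1) by (simp add: zero_preserving_def)
  then show ?thesis using dd(1,2) by (simp add: is_complex_def)
qed

end

lemma functor_onI: "\<lbrakk>category C; category D; is_functor C D T\<rbrakk> \<Longrightarrow> functor_on C D T"
  by (simp add: functor_on_def functor_on_axioms_def)

lemma functor_on_fid: "category C \<Longrightarrow> functor_on C C fid"
  by (rule functor_onI) (auto simp: is_functor_def Hom_iff category.Dom_Obj category.Cod_Obj)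

lemma functor_on_fcomp:
  assumes "functor_on C D T" "functor_on D E S"
  shows "functor_on C E (S \<circ>\<^sub>F T)"
proof -
  interpret T: functor_on C D T by (rule assms)
  interpret S: functor_on D E S by (rule assms)
  show ?thesis by unfold_locales (simp add: is_functor_def Hom_iff)
qed

lemma functor_on_fpow: "functor_on C C T \<Longrightarrow> functor_on C C (fpow T j)"
proof (induction j)
  case 0
  then have "category C" by (simp add: functor_on_def)
  then show ?case by (simp add: functor_on_fid)
next
  case (Suc j)
  then show ?case using functor_on_fcomp[of C C _ C T] by simp
qed

text \<open>Powers of a functor are defined by composing on the left; inductions that replace \<open>e Y\<close> by
  \<open>e G Y \<cong> F (e Y)\<close> peel off a factor on the right.\<close>

lemma fpow_shift:
  "FObj (fpow T j) (FObj T X) = FObj (fpow T (Suc j)) X"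
  "FArr (fpow T j) (FArr T f) = FArr (fpow T (Suc j)) f"
  by (induction j) simp_all

lemma zero_preserving_fcomp:
  assumes "functor_on C D T" "zero_preserving C D T" "zero_preserving D E S"
  shows "zero_preserving C E (S \<circ>\<^sub>F T)"
  using assms functor_on.T_Obj[OF assms(1)] by (simp add: zero_preserving_def)

lemma zero_preserving_fpow:
  "\<lbrakk>functor_on C C T; zero_preserving C C T\<rbrakk> \<Longrightarrow> zero_preserving C C (fpow T j)"
proof (induction j)
  case 0
  then show ?case by (simp add: zero_preserving_def)
next
  case (Suc j)
  then show ?case using zero_preserving_fcomp[OF functor_on_fpow[OF Suc.prems(1)]] by simp
qed

text \<open>The zero arrows are the arrows that factor through a zero object.\<close>

lemma zero_preserving_if_zero_object:
  assumes "functor_on C D T" "abelian_category C" "abelian_category D"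
    and Z: "is_zero_object C Z" "is_zero_object D (FObj T Z)"
  shows "zero_preserving C D T"
  unfolding zero_preserving_def
proof (intro ballI)
  interpret T: functor_on C D T by (rule assms)
  interpret C: abelian_category C by (rule assms)
  interpret D: abelian_category D by (rule assms)
  fix X Y assume XY: "X \<in> Obj C" "Y \<in> Obj C"
  have z: "Z \<in> Obj C" "Idn D (FObj T Z) = Zero D (FObj T Z) (FObj T Z)"
    using Z C.is_zero_object_iff D.is_zero_object_iff by auto
  have "FArr T (Zero C X Y) = FArr T (Zero C Z Y \<odot>\<^bsub>C\<^esub> Idn C Z \<odot>\<^bsub>C\<^esub> Zero C X Z)"
    using XY z(1) by simp
  also have "\<dots> = FArr T (Zero C Z Y) \<odot>\<^bsub>D\<^esub> FArr T (Idn C Z \<odot>\<^bsub>C\<^esub> Zero C X Z)"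
    by (rule T.T_Cmp) (use XY z(1) in simp_all)
  also have "\<dots> = FArr T (Zero C Z Y) \<odot>\<^bsub>D\<^esub> Idn D (FObj T Z) \<odot>\<^bsub>D\<^esub> FArr T (Zero C X Z)"
    using XY z(1) T.T_Arr[of "Zero C X Z"] by simp
  also have "\<dots> = Zero D (FObj T X) (FObj T Y)" unfolding z(2) using XY z(1) by simp
  finally show "FArr T (Zero C X Y) = Zero D (FObj T X) (FObj T Y)" .
qed

lemma acyclic_nat_iso:
  assumes D: "abelian_category D" "enough_projectives D" and T': "functor_on C D T'"
    and \<tau>: "nat_iso C D T T' \<tau>" and d: "is_complex C d" and T: "functor_on C D T"
    and ac: "acyclic_complex D (FArr T \<circ> d)" and T'd: "is_complex D (FArr T' \<circ> d)"
  shows "acyclic_complex D (FArr T' \<circ> d)"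
proof -
  interpret D: abelian_category D by (rule D)
  interpret T: functor_on C D T by (rule T)
  interpret T': functor_on C D T' by (rule T')
  note dd = is_complexD[OF d]
  have "chain_map D (FArr T \<circ> d) (FArr T' \<circ> d) (\<lambda>n. \<tau> (Dom C (d n)))"
    using \<tau> dd by (auto simp: chain_map_def nat_iso_def nat_trans_def Hom_iff)
  then show ?thesis
    by (rule D.acyclic_iso[OF D(2) ac T'd]) (use \<tau> dd in \<open>auto simp: nat_iso_def\<close>)
qed

locale adjoint_pair = C: abelian_category C + D: abelian_category D
  for C :: "('o, 'm) cat" and D :: "('p, 'n) cat"
    and L :: "('o, 'm, 'p, 'n) func" and R :: "('p, 'n, 'o, 'm) func"
    and \<eta> :: "'o \<Rightarrow> 'm" and \<epsilon> :: "'p \<Rightarrow> 'n" +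
  assumes adjunction: "adjunction C D L R \<eta> \<epsilon>"
begin

sublocale L: functor_on C D L
  using adjunction by unfold_locales (simp add: adjunction_def)

sublocale R: functor_on D C R
  using adjunction by unfold_locales (simp add: adjunction_def)

lemma unit_Arr [simp]:
  assumes "X \<in> Obj C"
  shows "\<eta> X \<in> Arr C" "Dom C (\<eta> X) = X" "Cod C (\<eta> X) = FObj R (FObj L X)"
  using adjunction assms by (auto simp: adjunction_def nat_trans_def Hom_iff)

lemma counit_Arr [simp]:
  assumes "Y \<in> Obj D"
  shows "\<epsilon> Y \<in> Arr D" "Dom D (\<epsilon> Y) = FObj L (FObj R Y)" "Cod D (\<epsilon> Y) = Y"
  using adjunction assms by (auto simp: adjunction_def nat_trans_def Hom_iff)

lemma unit_natural:
  assumes "f \<in> Arr C" "Dom C f = X" "Cod C f = X'"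
  shows "FArr R (FArr L f) \<odot>\<^bsub>C\<^esub> \<eta> X = \<eta> X' \<odot>\<^bsub>C\<^esub> f"
  using adjunction assms by (auto simp: adjunction_def nat_trans_def)

lemma counit_natural:
  assumes "g \<in> Arr D" "Dom D g = Y" "Cod D g = Y'"
  shows "g \<odot>\<^bsub>D\<^esub> \<epsilon> Y = \<epsilon> Y' \<odot>\<^bsub>D\<^esub> FArr L (FArr R g)"
  using adjunction assms by (auto simp: adjunction_def nat_trans_def)

lemma triangle_L: "X \<in> Obj C \<Longrightarrow> \<epsilon> (FObj L X) \<odot>\<^bsub>D\<^esub> FArr L (\<eta> X) = Idn D (FObj L X)"
  using adjunction by (auto simp: adjunction_def)

lemma triangle_R: "Y \<in> Obj D \<Longrightarrow> FArr R (\<epsilon> Y) \<odot>\<^bsub>C\<^esub> \<eta> (FObj R Y) = Idn C (FObj R Y)"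
  using adjunction by (auto simp: adjunction_def)

lemma untranspose_transpose:
  assumes "g \<in> Arr D" "Dom D g = FObj L X" "X \<in> Obj C" "Cod D g = Y"
  shows "\<epsilon> Y \<odot>\<^bsub>D\<^esub> FArr L (FArr R g \<odot>\<^bsub>C\<^esub> \<eta> X) = g"
proof -
  have "\<epsilon> Y \<odot>\<^bsub>D\<^esub> FArr L (FArr R g) \<odot>\<^bsub>D\<^esub> FArr L (\<eta> X) = g \<odot>\<^bsub>D\<^esub> \<epsilon> (FObj L X) \<odot>\<^bsub>D\<^esub> FArr L (\<eta> X)"
    by (rule D.Cmp_eq_Cmp[OF counit_natural[symmetric]]) (use assms in auto)
  then show ?thesis using assms by (auto simp: triangle_L)
qed

lemma transpose_untranspose:
  assumes "f \<in> Arr C" "Cod C f = FObj R Y" "Y \<in> Obj D" "Dom C f = X"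
  shows "FArr R (\<epsilon> Y \<odot>\<^bsub>D\<^esub> FArr L f) \<odot>\<^bsub>C\<^esub> \<eta> X = f"
proof -
  have "FArr R (\<epsilon> Y) \<odot>\<^bsub>C\<^esub> \<eta> (FObj R Y) \<odot>\<^bsub>C\<^esub> f = f"
    using C.Cmp_eq[OF triangle_R, of Y f] assms by auto
  then show ?thesis using assms unit_natural[OF assms(1,4,2)] by auto
qed

lemma transpose_inject:
  assumes "g \<in> Arr D" "Dom D g = FObj L X" "g' \<in> Arr D" "Dom D g' = FObj L X" "X \<in> Obj C"
    "Cod D g = Cod D g'" "FArr R g \<odot>\<^bsub>C\<^esub> \<eta> X = FArr R g' \<odot>\<^bsub>C\<^esub> \<eta> X"
  shows "g = g'"
  using untranspose_transpose[of g X] untranspose_transpose[of g' X] assms by metis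

lemma untranspose_inject:
  assumes "f \<in> Arr C" "Cod C f = FObj R Y" "f' \<in> Arr C" "Cod C f' = FObj R Y" "Y \<in> Obj D"
    "Dom C f = Dom C f'" "\<epsilon> Y \<odot>\<^bsub>D\<^esub> FArr L f = \<epsilon> Y \<odot>\<^bsub>D\<^esub> FArr L f'"
  shows "f = f'"
  using transpose_untranspose[of f Y] transpose_untranspose[of f' Y] assms by metis

text \<open>Adjoints preserve zero objects, left adjoints because a zero object is initial, right adjoints
  because it is terminal.\<close>

lemma L_zero: "zero_preserving C D L"
proof -
  obtain Z where Z: "is_zero_object C Z" using C.has_zero_object ..
  then have z: "Z \<in> Obj C" by (simp add: C.is_zero_object_iff)
  have "Idn D (FObj L Z) = Zero D (FObj L Z) (FObj L Z)"
    by (rule transpose_inject[of _ Z]) (use z in \<open>auto intro!: C.zero_object_maps_out[OF Z] simp: Hom_iff\<close>)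
  then have "is_zero_object D (FObj L Z)" using z by (simp add: D.is_zero_object_iff)
  then show ?thesis
    by (rule zero_preserving_if_zero_object[OF L.functor_on_axioms C.abelian_category_axioms
      D.abelian_category_axioms Z])
qed

lemma R_zero: "zero_preserving D C R"
proof -
  obtain Z where Z: "is_zero_object D Z" using D.has_zero_object ..
  then have z: "Z \<in> Obj D" by (simp add: D.is_zero_object_iff)
  have "Idn C (FObj R Z) = Zero C (FObj R Z) (FObj R Z)"
    by (rule untranspose_inject[of _ Z]) (use z in \<open>auto intro!: D.zero_object_maps_into[OF Z] simp: Hom_iff\<close>)
  then have "is_zero_object C (FObj R Z)" using z by (simp add: C.is_zero_object_iff)
  then show ?thesis
    by (rule zero_preserving_if_zero_object[OF R.functor_on_axioms D.abelian_category_axioms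
      C.abelian_category_axioms Z])
qed

lemma L_Zero [simp]:
  "\<lbrakk>X \<in> Obj C; Y \<in> Obj C\<rbrakk> \<Longrightarrow> FArr L (Zero C X Y) = Zero D (FObj L X) (FObj L Y)"
  using L_zero by (simp add: zero_preserving_def)

lemma R_Zero [simp]:
  "\<lbrakk>X \<in> Obj D; Y \<in> Obj D\<rbrakk> \<Longrightarrow> FArr R (Zero D X Y) = Zero C (FObj R X) (FObj R Y)"
  using R_zero by (simp add: zero_preserving_def)

lemma L_epi:
  assumes "is_epi C p"
  shows "is_epi D (FArr L p)"
proof (rule D.is_epiI)
  have p: "p \<in> Arr C" using assms by (simp add: is_epi_def)
  then show "FArr L p \<in> Arr D" by simp
  fix g h assume gh: "g \<in> Arr D" "h \<in> Arr D" "Dom D g = Cod D (FArr L p)"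
    "Dom D h = Cod D (FArr L p)" "Cod D g = Cod D h" "g \<odot>\<^bsub>D\<^esub> FArr L p = h \<odot>\<^bsub>D\<^esub> FArr L p"
  note un = unit_natural[OF p refl refl]
  have *: "FArr R g' \<odot>\<^bsub>C\<^esub> \<eta> (Cod C p) \<odot>\<^bsub>C\<^esub> p = FArr R (g' \<odot>\<^bsub>D\<^esub> FArr L p) \<odot>\<^bsub>C\<^esub> \<eta> (Dom C p)"
    if "g' \<in> Arr D" "Dom D g' = FObj L (Cod C p)" for g'
    using that p by (simp add: un)
  have "FArr R g \<odot>\<^bsub>C\<^esub> \<eta> (Cod C p) = FArr R h \<odot>\<^bsub>C\<^esub> \<eta> (Cod C p)"
    by (rule C.epiD[OF assms]) (use gh(1-5) p *[of g] *[of h] gh(6) in simp_all)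
  then show "g = h"
    using gh p by (intro transpose_inject[of g "Cod C p" h]) simp_all
qed

lemma L_cokernel:
  assumes c: "is_cokernel C c f"
  shows "is_cokernel D (FArr L c) (FArr L f)"
proof (rule D.is_cokernelI)
  note ck = is_cokernelD[OF c]
  show "is_epi D (FArr L c)" by (rule L_epi[OF C.cokernel_epi[OF c]])
  show "FArr L f \<in> Arr D" "Dom D (FArr L c) = Cod D (FArr L f)" using ck by simp_all
  show "FArr L c \<odot>\<^bsub>D\<^esub> FArr L f = Zero D (Dom D (FArr L f)) (Cod D (FArr L c))"
    using L.T_eq[OF ck(4)] ck(1-3) by simp
  fix h assume h: "h \<in> Arr D" "Dom D h = Cod D (FArr L f)"
    "h \<odot>\<^bsub>D\<^esub> FArr L f = Zero D (Dom D (FArr L f)) (Cod D h)"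
  have "FArr R h \<odot>\<^bsub>C\<^esub> \<eta> (Cod C f) \<odot>\<^bsub>C\<^esub> f = FArr R (h \<odot>\<^bsub>D\<^esub> FArr L f) \<odot>\<^bsub>C\<^esub> \<eta> (Dom C f)"
    using h(1,2) ck(1) by (simp add: unit_natural[OF ck(1) refl refl])
  then have "FArr R h \<odot>\<^bsub>C\<^esub> \<eta> (Cod C f) \<odot>\<^bsub>C\<^esub> f = Zero C (Dom C f) (FObj R (Cod D h))"
    using h ck by simp
  then obtain u where u: "u \<in> Arr C" "Dom C u = Cod C c" "Cod C u = FObj R (Cod D h)"
    "u \<odot>\<^bsub>C\<^esub> c = FArr R h \<odot>\<^bsub>C\<^esub> \<eta> (Cod C f)"
    using C.cokernel_factor[OF c, of "FArr R h \<odot>\<^bsub>C\<^esub> \<eta> (Cod C f)"] h(1,2) ck(1) by auto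
  have "\<epsilon> (Cod D h) \<odot>\<^bsub>D\<^esub> FArr L u \<odot>\<^bsub>D\<^esub> FArr L c = \<epsilon> (Cod D h) \<odot>\<^bsub>D\<^esub> FArr L (FArr R h \<odot>\<^bsub>C\<^esub> \<eta> (Cod C f))"
    using L.T_Cmp[of c u] u ck h by simp
  also have "\<dots> = h" by (rule untranspose_transpose) (use h ck in simp_all)
  finally show "\<exists>u. u \<in> Arr D \<and> Cod D u = Cod D h \<and> Dom D u = Cod D (FArr L c) \<and> u \<odot>\<^bsub>D\<^esub> FArr L c = h"
    using u h ck by (intro exI[of _ "\<epsilon> (Cod D h) \<odot>\<^bsub>D\<^esub> FArr L u"]) simp
qed

lemma L_projective:
  assumes R_epi: "\<And>g. is_epi D g \<Longrightarrow> is_epi C (FArr R g)" and P: "projective C P"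
  shows "projective D (FObj L P)"
  unfolding projective_def
proof (intro conjI allI impI ballI)
  show "FObj L P \<in> Obj D" using P by simp
  fix g f assume g: "is_epi D g" and "f \<in> Hom D (FObj L P) (Cod D g)"
  then have f: "f \<in> Arr D" "Dom D f = FObj L P" "Cod D f = Cod D g" by (simp_all add: Hom_iff)
  have ga: "g \<in> Arr D" using g by (simp add: is_epi_def)
  obtain h where h: "h \<in> Arr C" "Dom C h = P" "Cod C h = FObj R (Dom D g)"
    "FArr R g \<odot>\<^bsub>C\<^esub> h = FArr R f \<odot>\<^bsub>C\<^esub> \<eta> P"
    using C.projective_lift[OF P R_epi[OF g], of "FArr R f \<odot>\<^bsub>C\<^esub> \<eta> P"] f ga P by auto
  have "g \<odot>\<^bsub>D\<^esub> \<epsilon> (Dom D g) \<odot>\<^bsub>D\<^esub> FArr L h = \<epsilon> (Cod D g) \<odot>\<^bsub>D\<^esub> FArr L (FArr R g) \<odot>\<^bsub>D\<^esub> FArr L h"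
    by (rule D.Cmp_eq_Cmp[OF counit_natural]) (use ga h in simp_all)
  also have "\<dots> = \<epsilon> (Cod D g) \<odot>\<^bsub>D\<^esub> FArr L (FArr R f \<odot>\<^bsub>C\<^esub> \<eta> P)"
    using L.T_Cmp[of h "FArr R g"] h ga by simp
  also have "\<dots> = f" by (rule untranspose_transpose) (use f P in simp_all)
  finally show "\<exists>h\<in>Hom D (FObj L P) (Dom D g). g \<odot>\<^bsub>D\<^esub> h = f"
    using h ga by (intro bexI[of _ "\<epsilon> (Dom D g) \<odot>\<^bsub>D\<^esub> FArr L h"]) (simp_all add: Hom_iff)
qed

text \<open>The complexes \<open>Hom (L d, Q)\<close> and \<open>Hom (d, R Q)\<close> are isomorphic by transposition.\<close>

lemma hom_acyclic_adjoint:
  assumes d: "is_complex C d" and Q: "Q \<in> Obj D" and ac: "hom_acyclic C d (FObj R Q)"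
  shows "hom_acyclic D (FArr L \<circ> d) Q"
proof (rule D.hom_acyclicI[OF L.T_is_complex[OF L_zero d] Q])
  note dd = is_complexD[OF d]
  fix n n' :: int and f
  assume n': "n' = n + 1" and "f \<in> Arr D" "Dom D f = Dom D ((FArr L \<circ> d) n')" "Cod D f = Q"
    "f \<odot>\<^bsub>D\<^esub> (FArr L \<circ> d) n = Zero D (Dom D ((FArr L \<circ> d) n)) Q"
  then have f: "f \<in> Arr D" "Dom D f = FObj L (Dom C (d n'))" "Cod D f = Q"
    "f \<odot>\<^bsub>D\<^esub> FArr L (d n) = Zero D (FObj L (Dom C (d n))) Q" by (simp_all add: dd)
  note dn = dd(1)[of n] dd(2)[OF n']
  let ?f = "FArr R f \<odot>\<^bsub>C\<^esub> \<eta> (Dom C (d n'))"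
  have "?f \<odot>\<^bsub>C\<^esub> d n = FArr R (f \<odot>\<^bsub>D\<^esub> FArr L (d n)) \<odot>\<^bsub>C\<^esub> \<eta> (Dom C (d n))"
    using f(1-3) dd(1) dn by (simp add: unit_natural[OF dd(1) refl dn(2)])
  also have "\<dots> = Zero C (Dom C (d n)) (FObj R Q)" using f dd(1) Q by simp
  finally obtain g where g: "g \<in> Arr C" "Dom C g = Cod C (d n')" "Cod C g = FObj R Q" "g \<odot>\<^bsub>C\<^esub> d n' = ?f"
    using C.hom_acyclic_extend[OF ac d n', of ?f] f dd(1) by auto
  have "\<epsilon> Q \<odot>\<^bsub>D\<^esub> FArr L g \<odot>\<^bsub>D\<^esub> FArr L (d n') = \<epsilon> Q \<odot>\<^bsub>D\<^esub> FArr L ?f"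
    using L.T_Cmp[of "d n'" g] g dd(1) by simp
  also have "\<dots> = f" by (rule untranspose_transpose) (use f dd(1) in simp_all)
  finally show "\<exists>g. g \<in> Arr D \<and> Dom D g = Cod D ((FArr L \<circ> d) n') \<and> Cod D g = Q \<and>
      g \<odot>\<^bsub>D\<^esub> (FArr L \<circ> d) n' = f"
    using g dd(1) Q by (intro exI[of _ "\<epsilon> Q \<odot>\<^bsub>D\<^esub> FArr L g"]) simp
qed

text \<open>Write \<open>d 0 = m \<odot> p\<close> with \<open>p\<close> epi. Then \<open>L p\<close> is epi, and \<open>L m\<close> is mono: an arrow killed by \<open>L m\<close>
  lifts along \<open>L p\<close> to one killed by \<open>L (d 0)\<close>, which comes from \<open>L (d (- 1))\<close> by exactness, and
  \<open>p \<odot> d (- 1) = 0\<close>.\<close>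

lemma L_image:
  assumes ep: "enough_projectives D" and d: "acyclic_complex C d"
    and Ld: "acyclic_complex D (FArr L \<circ> d)" and m: "is_image C m (d 0)"
  shows "is_image D (FArr L m) (FArr L (d 0))"
proof -
  note dd = is_complexD[OF C.acyclic_is_complex[OF d]]
  have mk: "m \<in> Arr C" "Cod C m = Cod C (d 0)" and mm: "is_mono C m"
    using m is_kernelD is_cokernelD C.kernel_mono by (fastforce simp: is_image_def)+
  obtain p where p: "is_epi C p" "p \<in> Arr C" "Dom C p = Dom C (d 0)" "Cod C p = Dom C m" "m \<odot>\<^bsub>C\<^esub> p = d 0"
    using C.epi_onto_image[OF m] by metis
  have d1: "Cod C (d (-1)) = Dom C (d 0)" using dd(2)[of 0 "-1"] by simp
  have "m \<odot>\<^bsub>C\<^esub> p \<odot>\<^bsub>C\<^esub> d (-1) = Zero C (Dom C (d (-1))) (Cod C m)"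
    using C.Cmp_eq[OF p(5), of "d (-1)"] mk p dd(1) d1 dd(3)[of 0 "-1"] by simp
  then have pd: "p \<odot>\<^bsub>C\<^esub> d (-1) = Zero C (Dom C (d (-1))) (Dom C m)"
    using p(2-4) dd(1) d1 by (intro C.mono_Cmp_eq_Zero[OF mm]) simp_all
  have Lmp: "FArr L m \<odot>\<^bsub>D\<^esub> FArr L p = FArr L (d 0)"
    by (rule L.T_eq[OF p(5)]) (use p mk in simp_all)
  have Lpd: "FArr L p \<odot>\<^bsub>D\<^esub> FArr L (d (-1)) = Zero D (FObj L (Dom C (d (-1)))) (FObj L (Dom C m))"
    using L.T_eq[OF pd] p(2,3) mk dd(1) d1 by simp
  have "is_mono D (FArr L m)"
  proof (rule D.mono_if_no_kernel)
    show "FArr L m \<in> Arr D" using mk by simp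
    fix x assume x: "x \<in> Arr D" "Cod D x = Dom D (FArr L m)"
      "FArr L m \<odot>\<^bsub>D\<^esub> x = Zero D (Dom D x) (Cod D (FArr L m))"
    obtain r where r: "is_epi D r" "projective D (Dom D r)" "Cod D r = Dom D x"
      using ep D.Dom_Obj[OF x(1)] unfolding enough_projectives_def by blast
    have ra: "r \<in> Arr D" using r by (simp add: is_epi_def)
    obtain y where y: "y \<in> Arr D" "Dom D y = Dom D r" "Cod D y = FObj L (Dom C (d 0))"
      "FArr L p \<odot>\<^bsub>D\<^esub> y = x \<odot>\<^bsub>D\<^esub> r"
      using D.projective_lift[OF r(2) L_epi[OF p(1)], of "x \<odot>\<^bsub>D\<^esub> r"] x r ra p mk by auto
    have "FArr L (d 0) \<odot>\<^bsub>D\<^esub> y = FArr L m \<odot>\<^bsub>D\<^esub> FArr L p \<odot>\<^bsub>D\<^esub> y"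
      using D.Cmp_eq[OF Lmp, of y] y p mk by simp
    also have "\<dots> = FArr L m \<odot>\<^bsub>D\<^esub> x \<odot>\<^bsub>D\<^esub> r" by (simp add: y)
    also have "\<dots> = Zero D (Dom D r) (FObj L (Cod C (d 0)))"
      using D.Cmp_eq_Zero[OF x(3), of r] x(1,2) r ra mk by simp
    finally obtain z where z: "z \<in> Arr D" "Dom D z = Dom D r" "Cod D z = FObj L (Dom C (d (-1)))"
      "FArr L (d (-1)) \<odot>\<^bsub>D\<^esub> z = y"
      using D.acyclic_lift[OF Ld _ r(2), of 0 "-1" y] y dd(1) by auto
    have "x \<odot>\<^bsub>D\<^esub> r = FArr L p \<odot>\<^bsub>D\<^esub> FArr L (d (-1)) \<odot>\<^bsub>D\<^esub> z" using y z by simp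
    also have "\<dots> = Zero D (Dom D r) (FObj L (Dom C m))"
      using D.Cmp_eq_Zero[OF Lpd, of z] z(1-3) p dd(1) d1 by simp
    finally have "x \<odot>\<^bsub>D\<^esub> r = Zero D (Dom D x) (FObj L (Dom C m)) \<odot>\<^bsub>D\<^esub> r"
      using r ra x mk by simp
    then show "x = Zero D (Dom D x) (Dom D (FArr L m))"
      using x mk r by (intro D.epiD[OF r(1), of x]) simp_all
  qed
  then show ?thesis
    using D.image_of_epi_mono[OF L_epi[OF p(1)], of "FArr L m"] Lmp p mk by simp
qed

theorem L_gorenstein_projective:
  assumes ep: "enough_projectives D" and R_epi: "\<And>g. is_epi D g \<Longrightarrow> is_epi C (FArr R g)"
    and ac: "\<And>d. complete_projective_resolution C d \<Longrightarrow> acyclic_complex D (FArr L \<circ> d)"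
    and hom: "\<And>d Q. \<lbrakk>complete_projective_resolution C d; projective D Q\<rbrakk> \<Longrightarrow> hom_acyclic C d (FObj R Q)"
    and X: "gorenstein_projective C X"
  shows "gorenstein_projective D (FObj L X)"
proof -
  obtain d m where d: "complete_projective_resolution C d" and m: "is_image C m (d 0)" "Dom C m = X"
    using X by (auto simp: gorenstein_projective_def)
  have dac: "acyclic_complex C d" and proj: "projective C (Dom C (d n))" for n
    using d by (auto simp: complete_projective_resolution_def)
  note dd = is_complexD[OF C.acyclic_is_complex[OF dac]]
  have "complete_projective_resolution D (FArr L \<circ> d)"
    unfolding complete_projective_resolution_def
    using ac[OF d] L_projective[OF R_epi proj] dd(1)
      hom_acyclic_adjoint[OF C.acyclic_is_complex[OF dac] _ hom[OF d]] by simp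
  moreover have "is_image D (FArr L m) ((FArr L \<circ> d) 0)"
    using L_image[OF ep dac ac[OF d] m(1)] by simp
  moreover have "m \<in> Arr C" using m is_kernelD(2) unfolding is_image_def by metis
  then have "Dom D (FArr L m) = FObj L X" using m by simp
  ultimately show ?thesis unfolding gorenstein_projective_def by blast
qed

end

lemma nat_iso_postcompose:
  assumes "nat_iso C D S T \<tau>" "functor_on C D S" "functor_on C D T" "functor_on D E U"
  shows "nat_iso C E (U \<circ>\<^sub>F S) (U \<circ>\<^sub>F T) (\<lambda>X. FArr U (\<tau> X))"
proof -
  interpret S: functor_on C D S by (rule assms)
  interpret T: functor_on C D T by (rule assms)
  interpret U: functor_on D E U by (rule assms)
  have \<tau>: "\<tau> X \<in> Arr D" "Dom D (\<tau> X) = FObj S X" "Cod D (\<tau> X) = FObj T X" "is_iso D (\<tau> X)"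
    if "X \<in> Obj C" for X
    using assms(1) that by (auto simp: nat_iso_def nat_trans_def Hom_iff)
  have "FArr T f \<odot>\<^bsub>D\<^esub> \<tau> (Dom C f) = \<tau> (Cod C f) \<odot>\<^bsub>D\<^esub> FArr S f" if "f \<in> Arr C" for f
    using assms(1) that by (auto simp: nat_iso_def nat_trans_def)
  then have "FArr U (FArr T f) \<odot>\<^bsub>E\<^esub> FArr U (\<tau> (Dom C f)) = FArr U (\<tau> (Cod C f)) \<odot>\<^bsub>E\<^esub> FArr U (FArr S f)"
    if "f \<in> Arr C" for f
    by (rule U.T_square) (use that \<tau> in auto)
  then show ?thesis using \<tau> U.T_iso by (auto simp: nat_iso_def nat_trans_def Hom_iff)
qed

lemma nat_iso_inverse:
  assumes "nat_iso C D S T \<tau>" "functor_on C D S" "functor_on C D T"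
  obtains \<sigma> where "nat_iso C D T S \<sigma>"
    "\<And>X. X \<in> Obj C \<Longrightarrow> \<tau> X \<odot>\<^bsub>D\<^esub> \<sigma> X = Idn D (FObj T X)"
    "\<And>X. X \<in> Obj C \<Longrightarrow> \<sigma> X \<odot>\<^bsub>D\<^esub> \<tau> X = Idn D (FObj S X)"
proof -
  interpret S: functor_on C D S by (rule assms)
  interpret T: functor_on C D T by (rule assms)
  have \<tau>: "\<tau> X \<in> Arr D" "Dom D (\<tau> X) = FObj S X" "Cod D (\<tau> X) = FObj T X" "is_iso D (\<tau> X)"
    if "X \<in> Obj C" for X
    using assms(1) that by (auto simp: nat_iso_def nat_trans_def Hom_iff)
  have nat: "FArr T f \<odot>\<^bsub>D\<^esub> \<tau> (Dom C f) = \<tau> (Cod C f) \<odot>\<^bsub>D\<^esub> FArr S f" if "f \<in> Arr C" for f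
    using assms(1) that by (auto simp: nat_iso_def nat_trans_def)
  have "\<exists>v. v \<in> Arr D \<and> Dom D v = FObj T X \<and> Cod D v = FObj S X \<and>
      v \<odot>\<^bsub>D\<^esub> \<tau> X = Idn D (FObj S X) \<and> \<tau> X \<odot>\<^bsub>D\<^esub> v = Idn D (FObj T X)" if "X \<in> Obj C" for X
    using S.D.is_isoD[OF \<tau>(4)[OF that]] \<tau>(1-3)[OF that] by metis
  then obtain \<sigma> where \<sigma>: "\<sigma> X \<in> Arr D" "Dom D (\<sigma> X) = FObj T X" "Cod D (\<sigma> X) = FObj S X"
    "\<sigma> X \<odot>\<^bsub>D\<^esub> \<tau> X = Idn D (FObj S X)" "\<tau> X \<odot>\<^bsub>D\<^esub> \<sigma> X = Idn D (FObj T X)"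
    if "X \<in> Obj C" for X by metis
  have iso: "is_iso D (\<sigma> X)" if "X \<in> Obj C" for X
    by (rule S.D.is_isoI[of _ "\<tau> X"]) (use \<tau>[OF that] \<sigma>[OF that] in simp_all)
  have "FArr S f \<odot>\<^bsub>D\<^esub> \<sigma> (Dom C f) = \<sigma> (Cod C f) \<odot>\<^bsub>D\<^esub> FArr T f" if f: "f \<in> Arr C" for f
  proof -
    have ob: "Dom C f \<in> Obj C" "Cod C f \<in> Obj C" using f by simp_all
    note ty = \<tau>(1-3)[OF ob(1)] \<tau>(1-3)[OF ob(2)] \<sigma>(1-3)[OF ob(1)] \<sigma>(1-3)[OF ob(2)] f
    have "\<sigma> (Cod C f) \<odot>\<^bsub>D\<^esub> FArr T f = \<sigma> (Cod C f) \<odot>\<^bsub>D\<^esub> FArr T f \<odot>\<^bsub>D\<^esub> \<tau> (Dom C f) \<odot>\<^bsub>D\<^esub> \<sigma> (Dom C f)"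
      using ty \<sigma>(5)[OF ob(1)] by simp
    also have "FArr T f \<odot>\<^bsub>D\<^esub> \<tau> (Dom C f) \<odot>\<^bsub>D\<^esub> \<sigma> (Dom C f) = \<tau> (Cod C f) \<odot>\<^bsub>D\<^esub> FArr S f \<odot>\<^bsub>D\<^esub> \<sigma> (Dom C f)"
      by (rule S.D.Cmp_eq_Cmp[OF nat[OF f]]) (use ty in simp_all)
    also have "\<sigma> (Cod C f) \<odot>\<^bsub>D\<^esub> \<tau> (Cod C f) \<odot>\<^bsub>D\<^esub> FArr S f \<odot>\<^bsub>D\<^esub> \<sigma> (Dom C f) =
        Idn D (FObj S (Cod C f)) \<odot>\<^bsub>D\<^esub> FArr S f \<odot>\<^bsub>D\<^esub> \<sigma> (Dom C f)"
      by (rule S.D.Cmp_eq[OF \<sigma>(4)[OF ob(2)]]) (use ty in simp_all)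
    also have "\<dots> = FArr S f \<odot>\<^bsub>D\<^esub> \<sigma> (Dom C f)" using ty by simp
    finally show ?thesis by simp
  qed
  then have "nat_iso C D T S \<sigma>" using \<sigma> iso by (simp add: nat_iso_def nat_trans_def Hom_iff)
  then show thesis using that \<sigma> by blast
qed

lemma adjunction_fcomp:
  assumes "adjoint_pair C D L R \<eta> \<epsilon>" "adjoint_pair D E L' R' \<eta>' \<epsilon>'"
  shows "adjunction C E (L' \<circ>\<^sub>F L) (R \<circ>\<^sub>F R')
    (\<lambda>X. FArr R (\<eta>' (FObj L X)) \<odot>\<^bsub>C\<^esub> \<eta> X) (\<lambda>Y. \<epsilon>' Y \<odot>\<^bsub>E\<^esub> FArr L' (\<epsilon> (FObj R' Y)))"
proof -
  interpret a: adjoint_pair C D L R \<eta> \<epsilon> by (rule assms)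
  interpret b: adjoint_pair D E L' R' \<eta>' \<epsilon>' by (rule assms)
  have 1: "FArr R (FArr R' (FArr L' (FArr L f))) \<odot>\<^bsub>C\<^esub> FArr R (\<eta>' (FObj L (Dom C f))) \<odot>\<^bsub>C\<^esub> \<eta> (Dom C f) =
      FArr R (\<eta>' (FObj L (Cod C f))) \<odot>\<^bsub>C\<^esub> \<eta> (Cod C f) \<odot>\<^bsub>C\<^esub> f" if f: "f \<in> Arr C" for f
  proof -
    have sq: "FArr R (FArr R' (FArr L' (FArr L f))) \<odot>\<^bsub>C\<^esub> FArr R (\<eta>' (FObj L (Dom C f))) =
        FArr R (\<eta>' (FObj L (Cod C f))) \<odot>\<^bsub>C\<^esub> FArr R (FArr L f)"
      by (rule a.R.T_square[OF b.unit_natural]) (use f in simp_all)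
    have "FArr R (FArr R' (FArr L' (FArr L f))) \<odot>\<^bsub>C\<^esub> FArr R (\<eta>' (FObj L (Dom C f))) \<odot>\<^bsub>C\<^esub> \<eta> (Dom C f) =
      FArr R (\<eta>' (FObj L (Cod C f))) \<odot>\<^bsub>C\<^esub> FArr R (FArr L f) \<odot>\<^bsub>C\<^esub> \<eta> (Dom C f)"
      by (rule a.C.Cmp_eq_Cmp[OF sq]) (use f in simp_all)
    then show ?thesis using a.unit_natural[OF f refl refl] by simp
  qed
  have 2: "g \<odot>\<^bsub>E\<^esub> \<epsilon>' (Dom E g) \<odot>\<^bsub>E\<^esub> FArr L' (\<epsilon> (FObj R' (Dom E g))) =
      \<epsilon>' (Cod E g) \<odot>\<^bsub>E\<^esub> FArr L' (\<epsilon> (FObj R' (Cod E g))) \<odot>\<^bsub>E\<^esub> FArr L' (FArr L (FArr R (FArr R' g)))"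
    if g: "g \<in> Arr E" for g
  proof -
    have "g \<odot>\<^bsub>E\<^esub> \<epsilon>' (Dom E g) \<odot>\<^bsub>E\<^esub> FArr L' (\<epsilon> (FObj R' (Dom E g))) =
        \<epsilon>' (Cod E g) \<odot>\<^bsub>E\<^esub> FArr L' (FArr R' g) \<odot>\<^bsub>E\<^esub> FArr L' (\<epsilon> (FObj R' (Dom E g)))"
      by (rule b.D.Cmp_eq_Cmp[OF b.counit_natural]) (use g in simp_all)
    also have "FArr L' (FArr R' g) \<odot>\<^bsub>E\<^esub> FArr L' (\<epsilon> (FObj R' (Dom E g))) =
        FArr L' (\<epsilon> (FObj R' (Cod E g))) \<odot>\<^bsub>E\<^esub> FArr L' (FArr L (FArr R (FArr R' g)))"
      by (rule b.L.T_square[OF a.counit_natural]) (use g in simp_all)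
    finally show ?thesis .
  qed
  have 3: "\<epsilon>' (FObj L' (FObj L X)) \<odot>\<^bsub>E\<^esub> FArr L' (\<epsilon> (FObj R' (FObj L' (FObj L X)))) \<odot>\<^bsub>E\<^esub>
      FArr L' (FArr L (FArr R (\<eta>' (FObj L X)))) \<odot>\<^bsub>E\<^esub> FArr L' (FArr L (\<eta> X)) = Idn E (FObj L' (FObj L X))"
    if X: "X \<in> Obj C" for X
  proof -
    have sq: "FArr L' (\<eta>' (FObj L X)) \<odot>\<^bsub>E\<^esub> FArr L' (\<epsilon> (FObj L X)) =
        FArr L' (\<epsilon> (FObj R' (FObj L' (FObj L X)))) \<odot>\<^bsub>E\<^esub> FArr L' (FArr L (FArr R (\<eta>' (FObj L X))))"
      by (rule b.L.T_square[OF a.counit_natural]) (use X in simp_all)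
    have "FArr L' (\<epsilon> (FObj R' (FObj L' (FObj L X)))) \<odot>\<^bsub>E\<^esub>
        FArr L' (FArr L (FArr R (\<eta>' (FObj L X)))) \<odot>\<^bsub>E\<^esub> FArr L' (FArr L (\<eta> X)) =
        FArr L' (\<eta>' (FObj L X)) \<odot>\<^bsub>E\<^esub> FArr L' (\<epsilon> (FObj L X)) \<odot>\<^bsub>E\<^esub> FArr L' (FArr L (\<eta> X))"
      by (rule b.D.Cmp_eq_Cmp[OF sq[symmetric]]) (use X in simp_all)
    also have "FArr L' (\<epsilon> (FObj L X)) \<odot>\<^bsub>E\<^esub> FArr L' (FArr L (\<eta> X)) = Idn E (FObj L' (FObj L X))"
      using b.L.T_eq[OF a.triangle_L[OF X]] X by simp
    finally show ?thesis using b.triangle_L[of "FObj L X"] X by simp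
  qed
  have 4: "FArr R (FArr R' (\<epsilon>' Y)) \<odot>\<^bsub>C\<^esub> FArr R (FArr R' (FArr L' (\<epsilon> (FObj R' Y)))) \<odot>\<^bsub>C\<^esub>
      FArr R (\<eta>' (FObj L (FObj R (FObj R' Y)))) \<odot>\<^bsub>C\<^esub> \<eta> (FObj R (FObj R' Y)) = Idn C (FObj R (FObj R' Y))"
    if Y: "Y \<in> Obj E" for Y
  proof -
    have sq: "FArr R (FArr R' (FArr L' (\<epsilon> (FObj R' Y)))) \<odot>\<^bsub>C\<^esub> FArr R (\<eta>' (FObj L (FObj R (FObj R' Y)))) =
        FArr R (\<eta>' (FObj R' Y)) \<odot>\<^bsub>C\<^esub> FArr R (\<epsilon> (FObj R' Y))"
      by (rule a.R.T_square[OF b.unit_natural]) (use Y in simp_all)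
    have "FArr R (FArr R' (FArr L' (\<epsilon> (FObj R' Y)))) \<odot>\<^bsub>C\<^esub>
        FArr R (\<eta>' (FObj L (FObj R (FObj R' Y)))) \<odot>\<^bsub>C\<^esub> \<eta> (FObj R (FObj R' Y)) =
        FArr R (\<eta>' (FObj R' Y)) \<odot>\<^bsub>C\<^esub> FArr R (\<epsilon> (FObj R' Y)) \<odot>\<^bsub>C\<^esub> \<eta> (FObj R (FObj R' Y))"
      by (rule a.C.Cmp_eq_Cmp[OF sq]) (use Y in simp_all)
    also have "\<dots> = FArr R (\<eta>' (FObj R' Y))" using a.triangle_R[of "FObj R' Y"] Y by simp
    finally show ?thesis using a.R.T_eq[OF b.triangle_R[OF Y]] Y by simp
  qed
  show ?thesis
    unfolding adjunction_def nat_trans_def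
    using 1 2 3 4 functor_on_fcomp[OF a.L.functor_on_axioms b.L.functor_on_axioms]
      functor_on_fcomp[OF b.R.functor_on_axioms a.R.functor_on_axioms]
    by (simp add: Hom_iff functor_on_def functor_on_axioms_def)
qed

text \<open>Transposition, followed by \<open>\<theta>\<close>, identifies the arrows out of \<open>L X\<close> with the arrows out of \<open>X\<close>, so
  that \<open>L X\<close> and \<open>X\<close> are isomorphic.\<close>

lemma left_adjoint_of_identity:
  assumes adj: "adjoint_pair C C L R \<eta> \<epsilon>" and \<theta>: "nat_iso C C R fid \<theta>"
  shows "nat_iso C C fid L (\<lambda>X. \<theta> (FObj L X) \<odot>\<^bsub>C\<^esub> \<eta> X)"
proof -
  interpret adjoint_pair C C L R \<eta> \<epsilon> by (rule adj)
  have \<theta>: "\<theta> X \<in> Arr C" "Dom C (\<theta> X) = FObj R X" "Cod C (\<theta> X) = X"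
    if "X \<in> Obj C" for X
    using \<theta> that by (auto simp: nat_iso_def nat_trans_def Hom_iff)
  have nat: "f \<odot>\<^bsub>C\<^esub> \<theta> X = \<theta> Y \<odot>\<^bsub>C\<^esub> FArr R f" if "f \<in> Arr C" "Dom C f = X" "Cod C f = Y" for f X Y
    using assms(2) that by (auto simp: nat_iso_def nat_trans_def)
  obtain \<sigma> where \<sigma>nat: "nat_iso C C fid R \<sigma>"
    and \<sigma>i: "\<And>X. X \<in> Obj C \<Longrightarrow> \<theta> X \<odot>\<^bsub>C\<^esub> \<sigma> X = Idn C X"
      "\<And>X. X \<in> Obj C \<Longrightarrow> \<sigma> X \<odot>\<^bsub>C\<^esub> \<theta> X = Idn C (FObj R X)"
    using nat_iso_inverse[OF assms(2) R.functor_on_axioms functor_on_fid[OF C.category_axioms]] by auto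
  have \<sigma>: "\<sigma> X \<in> Arr C" "Dom C (\<sigma> X) = X" "Cod C (\<sigma> X) = FObj R X" if "X \<in> Obj C" for X
    using \<sigma>nat that by (auto simp: nat_iso_def nat_trans_def Hom_iff)
  define \<psi> where "\<psi> X = \<theta> (FObj L X) \<odot>\<^bsub>C\<^esub> \<eta> X" for X
  have \<psi>: "\<psi> X \<in> Arr C" "Dom C (\<psi> X) = X" "Cod C (\<psi> X) = FObj L X" if "X \<in> Obj C" for X
    using that \<theta> by (simp_all add: \<psi>_def)
  \<comment> \<open>Arrows out of \<open>L X\<close> are determined by their composite with \<open>\<psi> X\<close>, since \<open>\<theta>\<close> turns that
    composite into the transpose.\<close>
  have comp: "g \<odot>\<^bsub>C\<^esub> \<psi> X = \<theta> (Cod C g) \<odot>\<^bsub>C\<^esub> FArr R g \<odot>\<^bsub>C\<^esub> \<eta> X"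
    if "X \<in> Obj C" "g \<in> Arr C" "Dom C g = FObj L X" for g X
    unfolding \<psi>_def by (rule C.Cmp_eq_Cmp[OF nat]) (use that \<theta> in simp_all)
  have uniq: "g = h" if "X \<in> Obj C" "g \<in> Arr C" "h \<in> Arr C" "Dom C g = FObj L X" "Dom C h = FObj L X"
      "Cod C g = Cod C h" "g \<odot>\<^bsub>C\<^esub> \<psi> X = h \<odot>\<^bsub>C\<^esub> \<psi> X" for g h X
  proof -
    have red: "\<sigma> (Cod C k) \<odot>\<^bsub>C\<^esub> k \<odot>\<^bsub>C\<^esub> \<psi> X = FArr R k \<odot>\<^bsub>C\<^esub> \<eta> X" if k: "k \<in> Arr C" "Dom C k = FObj L X" for k
    proof -
      have "\<sigma> (Cod C k) \<odot>\<^bsub>C\<^esub> \<theta> (Cod C k) \<odot>\<^bsub>C\<^esub> FArr R k \<odot>\<^bsub>C\<^esub> \<eta> X =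
          Idn C (FObj R (Cod C k)) \<odot>\<^bsub>C\<^esub> FArr R k \<odot>\<^bsub>C\<^esub> \<eta> X"
        by (rule C.Cmp_eq[OF \<sigma>i(2)]) (use k \<open>X \<in> Obj C\<close> \<sigma> \<theta> in simp_all)
      then show ?thesis using comp[OF \<open>X \<in> Obj C\<close> k] k \<open>X \<in> Obj C\<close> by simp
    qed
    have "FArr R g \<odot>\<^bsub>C\<^esub> \<eta> X = FArr R h \<odot>\<^bsub>C\<^esub> \<eta> X"
      using red[of g] red[of h] that by metis
    then show ?thesis using that transpose_inject[of g X h] by simp
  qed
  have nat\<psi>: "FArr L f \<odot>\<^bsub>C\<^esub> \<psi> (Dom C f) = \<psi> (Cod C f) \<odot>\<^bsub>C\<^esub> f" if f: "f \<in> Arr C" for f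
  proof -
    have "FArr L f \<odot>\<^bsub>C\<^esub> \<psi> (Dom C f) = \<theta> (FObj L (Cod C f)) \<odot>\<^bsub>C\<^esub> FArr R (FArr L f) \<odot>\<^bsub>C\<^esub> \<eta> (Dom C f)"
      using comp[of "Dom C f" "FArr L f"] f by simp
    then show ?thesis using f \<theta> by (simp add: unit_natural[OF f refl refl] \<psi>_def)
  qed
  have iso: "is_iso C (\<psi> X)" if X: "X \<in> Obj C" for X
  proof (rule C.is_isoI)
    define \<phi> where "\<phi> = \<epsilon> X \<odot>\<^bsub>C\<^esub> FArr L (\<sigma> X)"
    show \<phi>: "\<phi> \<in> Arr C" "Dom C \<phi> = Cod C (\<psi> X)" "Cod C \<phi> = Dom C (\<psi> X)"
      using X \<sigma> \<psi> by (simp_all add: \<phi>_def)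
    have "\<phi> \<odot>\<^bsub>C\<^esub> \<psi> X = \<theta> X \<odot>\<^bsub>C\<^esub> FArr R \<phi> \<odot>\<^bsub>C\<^esub> \<eta> X"
      using comp[OF X, of \<phi>] \<phi> \<psi> X by simp
    also have "FArr R \<phi> \<odot>\<^bsub>C\<^esub> \<eta> X = \<sigma> X"
      unfolding \<phi>_def by (rule transpose_untranspose) (use X \<sigma> in simp_all)
    also have "\<theta> X \<odot>\<^bsub>C\<^esub> \<sigma> X = Idn C X" by (rule \<sigma>i(1)[OF X])
    finally show \<phi>\<psi>: "\<phi> \<odot>\<^bsub>C\<^esub> \<psi> X = Idn C (Dom C (\<psi> X))" using \<psi> X by simp
    show "\<psi> X \<odot>\<^bsub>C\<^esub> \<phi> = Idn C (Cod C (\<psi> X))"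
      by (rule uniq[OF X]) (use \<phi> \<psi> X \<phi>\<psi> in simp_all)
  qed (use \<psi> X in simp_all)
  have "nat_iso C C fid L \<psi>"
    using \<psi> nat\<psi> iso by (simp add: nat_iso_def nat_trans_def Hom_iff)
  then show ?thesis by (simp add: \<psi>_def[abs_def])
qed

section \<open>Cleft extensions\<close>

text \<open>A cleft extension together with the adjoint \<open>q\<close>, the kernel \<open>\<kappa> : G \<rightarrow> le\<close> of the counit and a chosen
  isomorphism \<open>\<theta> : ei \<cong> Id\<close>.\<close>

locale cleft =
  B: abelian_category B + A: abelian_category A +
  le: adjoint_pair B A l e \<eta> \<epsilon> + qi: adjoint_pair A B q i \<eta>' \<epsilon>' + G: functor_on A A G
  for B :: "('b, 'g) cat" and A :: "('a, 'f) cat"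
    and e :: "('a, 'f, 'b, 'g) func" and i l :: "('b, 'g, 'a, 'f) func"
    and q :: "('a, 'f, 'b, 'g) func" and G :: "('a, 'f, 'a, 'f) func"
    and \<eta> :: "'b \<Rightarrow> 'g" and \<epsilon> :: "'a \<Rightarrow> 'f"
    and \<eta>' :: "'a \<Rightarrow> 'f" and \<epsilon>' :: "'b \<Rightarrow> 'g" +
  fixes \<kappa> :: "'a \<Rightarrow> 'f" and \<theta> :: "'b \<Rightarrow> 'g"
  assumes faithful: "faithful_functor A e" and exact: "exact_functor A B e"
    and \<theta>: "nat_iso B B (e \<circ>\<^sub>F i) fid \<theta>"
    and kernel: "kernel_functor A A (l \<circ>\<^sub>F e) \<epsilon> G \<kappa>"
    and enough: "enough_projectives B" "enough_projectives A"
begin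

abbreviation F :: "('b, 'g, 'b, 'g) func" where
  "F \<equiv> e \<circ>\<^sub>F G \<circ>\<^sub>F i"

subsection \<open>Exactness along \<open>e\<close>\<close>

lemma e_faithful:
  "\<lbrakk>FArr e f = FArr e g; f \<in> Arr A; g \<in> Arr A; Dom A f = Dom A g; Cod A f = Cod A g\<rbrakk> \<Longrightarrow> f = g"
  using faithful unfolding faithful_functor_def inj_on_def by (metis A.Dom_Obj A.Cod_Obj Hom_iff)

lemma e_epi:
  assumes "is_epi A g"
  shows "is_epi B (FArr e g)"
proof -
  have g: "g \<in> Arr A" using assms by (simp add: is_epi_def)
  obtain k where k: "is_kernel A k g" using A.has_kernels g by blast
  then have "short_exact A k g"
    using A.epi_cokernel_of_kernel[OF assms k] by (simp add: short_exact_def)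
  then show ?thesis
    using exact B.cokernel_epi by (auto simp: exact_functor_def short_exact_def)
qed

lemma e_reflects_epi:
  assumes "g \<in> Arr A" "is_epi B (FArr e g)"
  shows "is_epi A g"
proof (rule A.is_epiI)
  fix a b assume ab: "a \<in> Arr A" "b \<in> Arr A" "Dom A a = Cod A g" "Dom A b = Cod A g"
    "Cod A a = Cod A b" "a \<odot>\<^bsub>A\<^esub> g = b \<odot>\<^bsub>A\<^esub> g"
  have "FArr e a \<odot>\<^bsub>B\<^esub> FArr e g = FArr e b \<odot>\<^bsub>B\<^esub> FArr e g"
    by (rule le.R.T_square[OF ab(6)]) (use ab assms in simp_all)
  then have "FArr e a = FArr e b"
    by (rule B.epiD[OF assms(2)]) (use ab assms in simp_all)
  then show "a = b" using ab by (intro e_faithful) simp_all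
qed (rule assms)

lemma \<theta>_Arr [simp]:
  assumes "X \<in> Obj B"
  shows "\<theta> X \<in> Arr B" "Dom B (\<theta> X) = FObj e (FObj i X)" "Cod B (\<theta> X) = X" "is_iso B (\<theta> X)"
  using \<theta> assms by (auto simp: nat_iso_def nat_trans_def Hom_iff)

lemma \<theta>_natural:
  assumes "f \<in> Arr B" "Dom B f = X" "Cod B f = Y"
  shows "f \<odot>\<^bsub>B\<^esub> \<theta> X = \<theta> Y \<odot>\<^bsub>B\<^esub> FArr e (FArr i f)"
  using \<theta> assms by (auto simp: nat_iso_def nat_trans_def)

text \<open>\<open>e\<close> reflects epimorphisms, and \<open>e (i p)\<close> is conjugate to \<open>p\<close> by \<open>\<theta>\<close>.\<close>

lemma i_epi:
  assumes "is_epi B p"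
  shows "is_epi A (FArr i p)"
proof (rule e_reflects_epi)
  have p: "p \<in> Arr B" using assms by (simp add: is_epi_def)
  then show "FArr i p \<in> Arr A" by simp
  have ob: "Dom B p \<in> Obj B" "Cod B p \<in> Obj B" using p by simp_all
  obtain v where v: "v \<in> Arr B" "Dom B v = Cod B p" "Cod B v = FObj e (FObj i (Cod B p))"
    "v \<odot>\<^bsub>B\<^esub> \<theta> (Cod B p) = Idn B (FObj e (FObj i (Cod B p)))"
    "\<theta> (Cod B p) \<odot>\<^bsub>B\<^esub> v = Idn B (Cod B p)"
    using B.is_isoD[OF \<theta>_Arr(4)[OF ob(2)]] \<theta>_Arr(1-3)[OF ob(2)] by metis
  obtain w where w: "w \<in> Arr B" "Dom B w = Dom B p" "Cod B w = FObj e (FObj i (Dom B p))"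
    "\<theta> (Dom B p) \<odot>\<^bsub>B\<^esub> w = Idn B (Dom B p)"
    using B.is_isoD[OF \<theta>_Arr(4)[OF ob(1)]] \<theta>_Arr(1-3)[OF ob(1)] by metis
  have e1: "is_epi B (\<theta> (Dom B p))" by (rule B.split_epi[of _ w]) (use w ob in \<open>simp_all add: Hom_iff\<close>)
  have e2: "is_epi B v"
    by (rule B.split_epi[of _ "\<theta> (Cod B p)"]) (use v ob in \<open>simp_all add: Hom_iff\<close>)
  have "FArr e (FArr i p) = v \<odot>\<^bsub>B\<^esub> \<theta> (Cod B p) \<odot>\<^bsub>B\<^esub> FArr e (FArr i p)"
    using B.Cmp_eq[OF v(4), of "FArr e (FArr i p)"] v(1-3) p ob by simp
  also have "\<dots> = v \<odot>\<^bsub>B\<^esub> p \<odot>\<^bsub>B\<^esub> \<theta> (Dom B p)" by (simp add: \<theta>_natural[OF p refl refl])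
  finally show "is_epi B (FArr e (FArr i p))"
    using B.is_epi_Cmp[OF B.is_epi_Cmp[OF e1 assms] e2] v(1-3) p ob by simp
qed

lemma counit_epi:
  assumes "Y \<in> Obj A"
  shows "is_epi A (\<epsilon> Y)"
  by (rule e_reflects_epi, simp add: assms, rule B.split_epi[of _ "\<eta> (FObj e Y)"])
    (use assms le.triangle_R[OF assms] in \<open>simp_all add: Hom_iff\<close>)

lemma l_projective: "projective B P \<Longrightarrow> projective A (FObj l P)"
  by (rule le.L_projective[OF e_epi])

text \<open>The objects \<open>l P\<close> with \<open>P\<close> projective cover all objects of \<open>A\<close>, and arrows out of them
  correspond to arrows out of \<open>P\<close>.\<close>

lemma cover_by_l:
  assumes "Y \<in> Obj A"
  obtains P p where "projective B P" "is_epi A p" "Dom A p = FObj l P" "Cod A p = Y"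
proof -
  obtain p where p: "is_epi B p" "projective B (Dom B p)" "Cod B p = FObj e Y"
    using enough(1) le.R.T_Obj[OF assms] unfolding enough_projectives_def by blast
  have pa: "p \<in> Arr B" using p by (simp add: is_epi_def)
  have "is_epi A (\<epsilon> Y \<odot>\<^bsub>A\<^esub> FArr l p)"
    by (rule A.is_epi_Cmp[OF le.L_epi[OF p(1)] counit_epi[OF assms]]) (use assms p pa in simp)
  then show thesis using that[OF p(2), of "\<epsilon> Y \<odot>\<^bsub>A\<^esub> FArr l p"] assms p pa by simp
qed

text \<open>Transposition translates lifting problems for arrows out of \<open>l P\<close> in \<open>A\<close> into lifting problems for
  arrows out of \<open>P\<close> in \<open>B\<close>. So exactness before and after applying \<open>e\<close> can be tested on the same
  arrows.\<close>

lemma exact_at_if_e: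
  assumes fg: "f \<in> Arr A" "g \<in> Arr A" "Cod A f = Dom A g" and ex: "exact_at B (FArr e f) (FArr e g)"
  shows "exact_at A f g"
proof (rule A.exact_atI[of "FObj l ` Collect (projective B)"])
  show "\<exists>p. is_epi A p \<and> Dom A p \<in> FObj l ` Collect (projective B) \<and> Cod A p = Y"
    if "Y \<in> Obj A" for Y
    using cover_by_l[OF that] by blast
  show "g \<odot>\<^bsub>A\<^esub> f = Zero A (Dom A f) (Cod A g)"
    by (rule e_faithful) (use B.exact_atD(4)[OF ex] fg in simp_all)
  fix y assume y: "y \<in> Arr A" "Dom A y \<in> FObj l ` Collect (projective B)" "Cod A y = Dom A g"
    "g \<odot>\<^bsub>A\<^esub> y = Zero A (Dom A y) (Cod A g)"
  obtain P where P: "projective B P" "Dom A y = FObj l P" using y(2) by auto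
  have "FArr e g \<odot>\<^bsub>B\<^esub> FArr e y = Zero B (FObj e (FObj l P)) (FObj e (Cod A g))"
    using le.R.T_eq[OF y(4)] y P fg by simp
  then have "FArr e g \<odot>\<^bsub>B\<^esub> FArr e y \<odot>\<^bsub>B\<^esub> \<eta> P = Zero B P (FObj e (Cod A g))"
    using B.Cmp_eq_Zero[of "FArr e g" "FArr e y" _ _ "\<eta> P"] y P fg by simp
  then obtain x where x: "x \<in> Arr B" "Dom B x = P" "Cod B x = FObj e (Dom A f)"
    "FArr e f \<odot>\<^bsub>B\<^esub> x = FArr e y \<odot>\<^bsub>B\<^esub> \<eta> P"
    using B.exact_at_lift[OF ex P(1), of "FArr e y \<odot>\<^bsub>B\<^esub> \<eta> P"] y P fg by auto
  have "f \<odot>\<^bsub>A\<^esub> \<epsilon> (Dom A f) \<odot>\<^bsub>A\<^esub> FArr l x = \<epsilon> (Cod A f) \<odot>\<^bsub>A\<^esub> FArr l (FArr e f) \<odot>\<^bsub>A\<^esub> FArr l x"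
    by (rule A.Cmp_eq_Cmp[OF le.counit_natural]) (use fg x in simp_all)
  also have "\<dots> = \<epsilon> (Cod A f) \<odot>\<^bsub>A\<^esub> FArr l (FArr e y \<odot>\<^bsub>B\<^esub> \<eta> P)"
    using le.L.T_eq[OF x(4)] x(1-3) fg by simp
  also have "\<dots> = y" by (rule le.untranspose_transpose) (use y P fg in simp_all)
  finally show "\<exists>x. x \<in> Arr A \<and> Dom A x = Dom A y \<and> Cod A x = Dom A f \<and> f \<odot>\<^bsub>A\<^esub> x = y"
    using x P fg by (intro exI[of _ "\<epsilon> (Dom A f) \<odot>\<^bsub>A\<^esub> FArr l x"]) simp
qed (use fg in simp_all)

lemma e_exact_at:
  assumes ex: "exact_at A f g"
  shows "exact_at B (FArr e f) (FArr e g)"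
proof (rule B.exact_atI[of "Collect (projective B)"])
  note fg = A.exact_atD[OF ex]
  show "\<exists>p. is_epi B p \<and> Dom B p \<in> Collect (projective B) \<and> Cod B p = Y" if "Y \<in> Obj B" for Y
    using enough(1) that by (auto simp: enough_projectives_def)
  show "FArr e f \<in> Arr B" "FArr e g \<in> Arr B" "Cod B (FArr e f) = Dom B (FArr e g)"
    using fg by simp_all
  show "FArr e g \<odot>\<^bsub>B\<^esub> FArr e f = Zero B (Dom B (FArr e f)) (Cod B (FArr e g))"
    using le.R.T_eq[OF fg(4)] fg by simp
  fix y assume y: "y \<in> Arr B" "Dom B y \<in> Collect (projective B)" "Cod B y = Dom B (FArr e g)"
    "FArr e g \<odot>\<^bsub>B\<^esub> y = Zero B (Dom B y) (Cod B (FArr e g))"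
  have "g \<odot>\<^bsub>A\<^esub> \<epsilon> (Dom A g) \<odot>\<^bsub>A\<^esub> FArr l y = \<epsilon> (Cod A g) \<odot>\<^bsub>A\<^esub> FArr l (FArr e g) \<odot>\<^bsub>A\<^esub> FArr l y"
    by (rule A.Cmp_eq_Cmp[OF le.counit_natural]) (use fg y in simp_all)
  also have "\<dots> = Zero A (FObj l (Dom B y)) (Cod A g)"
    using le.L.T_eq[OF y(4)] y(1-3) fg by simp
  finally obtain x where x: "x \<in> Arr A" "Dom A x = FObj l (Dom B y)" "Cod A x = Dom A f"
    "f \<odot>\<^bsub>A\<^esub> x = \<epsilon> (Dom A g) \<odot>\<^bsub>A\<^esub> FArr l y"
    using A.exact_at_lift[OF ex l_projective[of "Dom B y"], of "\<epsilon> (Dom A g) \<odot>\<^bsub>A\<^esub> FArr l y"] y fg by auto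
  have "FArr e f \<odot>\<^bsub>B\<^esub> FArr e x \<odot>\<^bsub>B\<^esub> \<eta> (Dom B y) =
      FArr e (\<epsilon> (Dom A g) \<odot>\<^bsub>A\<^esub> FArr l y) \<odot>\<^bsub>B\<^esub> \<eta> (Dom B y)"
    by (rule B.Cmp_eq[OF le.R.T_eq[OF x(4)]]) (use x(1-3) y(1) fg in simp_all)
  also have "\<dots> = y" by (rule le.transpose_untranspose) (use y fg in simp_all)
  finally show "\<exists>x. x \<in> Arr B \<and> Dom B x = Dom B y \<and> Cod B x = Dom B (FArr e f) \<and> FArr e f \<odot>\<^bsub>B\<^esub> x = y"
    using x(1-3) y(1) fg by (intro exI[of _ "FArr e x \<odot>\<^bsub>B\<^esub> \<eta> (Dom B y)"]) simp
qed

lemma acyclic_if_e: "\<lbrakk>is_complex A d; acyclic_complex B (FArr e \<circ> d)\<rbrakk> \<Longrightarrow> acyclic_complex A d"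
  unfolding acyclic_complex_def using exact_at_if_e is_complexD by (metis comp_apply)

lemma e_acyclic: "acyclic_complex A d \<Longrightarrow> acyclic_complex B (FArr e \<circ> d)"
  unfolding acyclic_complex_def using e_exact_at by simp

subsection \<open>The kernel of the counit\<close>

lemma \<kappa>_Arr [simp]:
  assumes "Y \<in> Obj A"
  shows "\<kappa> Y \<in> Arr A" "Dom A (\<kappa> Y) = FObj G Y" "Cod A (\<kappa> Y) = FObj l (FObj e Y)"
  using kernel assms by (auto simp: kernel_functor_def nat_trans_def Hom_iff)

lemma \<kappa>_natural:
  assumes "f \<in> Arr A" "Dom A f = Y" "Cod A f = Y'"
  shows "FArr l (FArr e f) \<odot>\<^bsub>A\<^esub> \<kappa> Y = \<kappa> Y' \<odot>\<^bsub>A\<^esub> FArr G f"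
  using kernel assms by (auto simp: kernel_functor_def nat_trans_def)

lemma counit_short_exact:
  assumes "Y \<in> Obj A"
  shows "short_exact A (\<kappa> Y) (\<epsilon> Y)"
proof -
  have "is_kernel A (\<kappa> Y) (\<epsilon> Y)" using kernel assms by (simp add: kernel_functor_def)
  then show ?thesis
    using A.epi_cokernel_of_kernel[OF counit_epi[OF assms]] by (simp add: short_exact_def)
qed

lemma e_counit_short_exact: "Y \<in> Obj A \<Longrightarrow> short_exact B (FArr e (\<kappa> Y)) (FArr e (\<epsilon> Y))"
  using counit_short_exact exact by (simp add: exact_functor_def)

lemma G_zero: "zero_preserving A A G"
  unfolding zero_preserving_def
proof (intro ballI)
  fix X Y assume XY: "X \<in> Obj A" "Y \<in> Obj A"
  have "\<kappa> Y \<odot>\<^bsub>A\<^esub> FArr G (Zero A X Y) = Zero A (FObj G X) (FObj l (FObj e Y))"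
    using \<kappa>_natural[of "Zero A X Y" X Y] XY by simp
  then show "FArr G (Zero A X Y) = Zero A (FObj G X) (FObj G Y)"
    using A.mono_Cmp_eq_Zero[OF A.short_exactD(3)[OF counit_short_exact[OF XY(2)]]] XY by simp
qed

text \<open>The unit is a section of \<open>e \<epsilon>\<close>, so that \<open>1 - \<eta> \<odot> e \<epsilon>\<close> is killed by \<open>e \<epsilon>\<close> and factors through its
  kernel \<open>e \<kappa>\<close>. The factor is a retraction of \<open>e \<kappa>\<close> that vanishes on the unit.\<close>

lemma kernel_retraction:
  assumes "Y \<in> Obj A"
  shows "\<exists>r. r \<in> Arr B \<and> Dom B r = FObj e (FObj l (FObj e Y)) \<and> Cod B r = FObj e (FObj G Y) \<and>
    FArr e (\<kappa> Y) \<odot>\<^bsub>B\<^esub> r =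
      Diff B (Idn B (FObj e (FObj l (FObj e Y)))) (\<eta> (FObj e Y) \<odot>\<^bsub>B\<^esub> FArr e (\<epsilon> Y))"
proof -
  note E = B.short_exactD[OF e_counit_short_exact[OF assms]]
  have "FArr e (\<epsilon> Y) \<odot>\<^bsub>B\<^esub> \<eta> (FObj e Y) \<odot>\<^bsub>B\<^esub> FArr e (\<epsilon> Y) = FArr e (\<epsilon> Y)"
    using B.Cmp_eq[OF le.triangle_R[OF assms], of "FArr e (\<epsilon> Y)"] assms by simp
  then show ?thesis
    using B.kernel_factor[OF E(1), of "Diff B (Idn B (FObj e (FObj l (FObj e Y)))) (\<eta> (FObj e Y) \<odot>\<^bsub>B\<^esub> FArr e (\<epsilon> Y))"]
      assms by (auto simp: B.Cmp_Diff)
qed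

definition \<rho> :: "'a \<Rightarrow> 'g" where
  "\<rho> Y = (SOME r. r \<in> Arr B \<and> Dom B r = FObj e (FObj l (FObj e Y)) \<and> Cod B r = FObj e (FObj G Y) \<and>
    FArr e (\<kappa> Y) \<odot>\<^bsub>B\<^esub> r =
      Diff B (Idn B (FObj e (FObj l (FObj e Y)))) (\<eta> (FObj e Y) \<odot>\<^bsub>B\<^esub> FArr e (\<epsilon> Y)))"

lemma \<rho>_Arr [simp]:
  assumes "Y \<in> Obj A"
  shows "\<rho> Y \<in> Arr B" "Dom B (\<rho> Y) = FObj e (FObj l (FObj e Y))" "Cod B (\<rho> Y) = FObj e (FObj G Y)"
  and \<kappa>_\<rho>: "FArr e (\<kappa> Y) \<odot>\<^bsub>B\<^esub> \<rho> Y =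
      Diff B (Idn B (FObj e (FObj l (FObj e Y)))) (\<eta> (FObj e Y) \<odot>\<^bsub>B\<^esub> FArr e (\<epsilon> Y))"
  using someI_ex[OF kernel_retraction[OF assms]] unfolding \<rho>_def by blast+

lemma \<rho>_\<kappa>:
  assumes "Y \<in> Obj A"
  shows "\<rho> Y \<odot>\<^bsub>B\<^esub> FArr e (\<kappa> Y) = Idn B (FObj e (FObj G Y))"
proof (rule B.monoD[OF B.short_exactD(3)[OF e_counit_short_exact[OF assms]]])
  have "FArr e (\<kappa> Y) \<odot>\<^bsub>B\<^esub> \<rho> Y \<odot>\<^bsub>B\<^esub> FArr e (\<kappa> Y) =
      Diff B (Idn B (FObj e (FObj l (FObj e Y)))) (\<eta> (FObj e Y) \<odot>\<^bsub>B\<^esub> FArr e (\<epsilon> Y)) \<odot>\<^bsub>B\<^esub> FArr e (\<kappa> Y)"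
    by (rule B.Cmp_eq[OF \<kappa>_\<rho>[OF assms]]) (use assms in simp_all)
  then show "FArr e (\<kappa> Y) \<odot>\<^bsub>B\<^esub> \<rho> Y \<odot>\<^bsub>B\<^esub> FArr e (\<kappa> Y) = FArr e (\<kappa> Y) \<odot>\<^bsub>B\<^esub> Idn B (FObj e (FObj G Y))"
    using assms B.short_exactD(8)[OF e_counit_short_exact[OF assms]] by (simp add: B.Diff_Cmp)
qed (use assms in simp_all)

lemma \<rho>_\<eta>:
  assumes "Y \<in> Obj A"
  shows "\<rho> Y \<odot>\<^bsub>B\<^esub> \<eta> (FObj e Y) = Zero B (FObj e Y) (FObj e (FObj G Y))"
proof -
  have "FArr e (\<kappa> Y) \<odot>\<^bsub>B\<^esub> \<rho> Y \<odot>\<^bsub>B\<^esub> \<eta> (FObj e Y) =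
      Diff B (Idn B (FObj e (FObj l (FObj e Y)))) (\<eta> (FObj e Y) \<odot>\<^bsub>B\<^esub> FArr e (\<epsilon> Y)) \<odot>\<^bsub>B\<^esub> \<eta> (FObj e Y)"
    by (rule B.Cmp_eq[OF \<kappa>_\<rho>[OF assms]]) (use assms in simp_all)
  also have "\<dots> = Zero B (FObj e Y) (FObj e (FObj l (FObj e Y)))"
    using assms le.triangle_R[OF assms] by (simp add: B.Diff_Cmp)
  finally show ?thesis
    using B.mono_Cmp_eq_Zero[OF B.short_exactD(3)[OF e_counit_short_exact[OF assms]]] assms by simp
qed

text \<open>\<open>e G Y\<close> depends on \<open>e Y\<close> only, being isomorphic to the cokernel of \<open>\<eta> (e Y)\<close>: arrows
  \<open>e Y \<rightarrow> e Y'\<close> act on it functorially, even if they do not come from \<open>A\<close>.\<close>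

definition \<Phi> :: "'a \<Rightarrow> 'a \<Rightarrow> 'g \<Rightarrow> 'g" where
  "\<Phi> Y Y' u = \<rho> Y' \<odot>\<^bsub>B\<^esub> FArr e (FArr l u) \<odot>\<^bsub>B\<^esub> FArr e (\<kappa> Y)"

lemma \<Phi>_Arr [simp]:
  assumes "Y \<in> Obj A" "Y' \<in> Obj A" "u \<in> Arr B" "Dom B u = FObj e Y" "Cod B u = FObj e Y'"
  shows "\<Phi> Y Y' u \<in> Arr B" "Dom B (\<Phi> Y Y' u) = FObj e (FObj G Y)" "Cod B (\<Phi> Y Y' u) = FObj e (FObj G Y')"
  using assms by (simp_all add: \<Phi>_def)

lemma \<Phi>_e:
  assumes "f \<in> Arr A" "Dom A f = Y" "Cod A f = Y'"
  shows "\<Phi> Y Y' (FArr e f) = FArr e (FArr G f)"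
proof -
  have ob: "Y \<in> Obj A" "Y' \<in> Obj A" using assms by auto
  have "FArr e (FArr l (FArr e f)) \<odot>\<^bsub>B\<^esub> FArr e (\<kappa> Y) = FArr e (\<kappa> Y') \<odot>\<^bsub>B\<^esub> FArr e (FArr G f)"
    by (rule le.R.T_square[OF \<kappa>_natural[OF assms]]) (use assms ob in simp_all)
  moreover have "\<rho> Y' \<odot>\<^bsub>B\<^esub> FArr e (\<kappa> Y') \<odot>\<^bsub>B\<^esub> FArr e (FArr G f) =
      Idn B (FObj e (FObj G Y')) \<odot>\<^bsub>B\<^esub> FArr e (FArr G f)"
    by (rule B.Cmp_eq[OF \<rho>_\<kappa>]) (use assms ob in simp_all)
  ultimately show ?thesis using assms by (simp add: \<Phi>_def)
qed

text \<open>In the composite, \<open>e \<kappa> \<odot> \<rho>\<close> differs from the identity by a term that factors through the unit. By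
  naturality the unit moves past \<open>e l v\<close>, where \<open>\<rho>\<close> kills it.\<close>

lemma \<Phi>_Cmp:
  assumes "Y \<in> Obj A" "Y' \<in> Obj A" "Y'' \<in> Obj A" "u \<in> Arr B" "Dom B u = FObj e Y" "Cod B u = FObj e Y'"
    "v \<in> Arr B" "Dom B v = FObj e Y'" "Cod B v = FObj e Y''"
  shows "\<Phi> Y' Y'' v \<odot>\<^bsub>B\<^esub> \<Phi> Y Y' u = \<Phi> Y Y'' (v \<odot>\<^bsub>B\<^esub> u)"
proof -
  let ?x = "FArr e (FArr l u) \<odot>\<^bsub>B\<^esub> FArr e (\<kappa> Y)" and ?v = "FArr e (FArr l v)"
  let ?z = "FArr e (\<epsilon> Y') \<odot>\<^bsub>B\<^esub> ?x"
  have x: "?x \<in> Arr B" "Dom B ?x = FObj e (FObj G Y)" "Cod B ?x = FObj e (FObj l (FObj e Y'))"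
    using assms by simp_all
  have z: "?z \<in> Arr B" "Dom B ?z = FObj e (FObj G Y)" "Cod B ?z = FObj e Y'"
    using assms x by simp_all
  have "FArr e (\<kappa> Y') \<odot>\<^bsub>B\<^esub> \<rho> Y' \<odot>\<^bsub>B\<^esub> ?x =
      Diff B (Idn B (FObj e (FObj l (FObj e Y')))) (\<eta> (FObj e Y') \<odot>\<^bsub>B\<^esub> FArr e (\<epsilon> Y')) \<odot>\<^bsub>B\<^esub> ?x"
    by (rule B.Cmp_eq[OF \<kappa>_\<rho>]) (use assms x in simp_all)
  also have "\<dots> = Diff B ?x (\<eta> (FObj e Y') \<odot>\<^bsub>B\<^esub> ?z)"
    using assms by (simp add: B.Diff_Cmp)
  finally have 1: "FArr e (\<kappa> Y') \<odot>\<^bsub>B\<^esub> \<rho> Y' \<odot>\<^bsub>B\<^esub> ?x = Diff B ?x (\<eta> (FObj e Y') \<odot>\<^bsub>B\<^esub> ?z)" .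
  have "?v \<odot>\<^bsub>B\<^esub> \<eta> (FObj e Y') \<odot>\<^bsub>B\<^esub> ?z = \<eta> (FObj e Y'') \<odot>\<^bsub>B\<^esub> v \<odot>\<^bsub>B\<^esub> ?z"
    by (rule B.Cmp_eq_Cmp[OF le.unit_natural]) (use assms z in simp_all)
  moreover have "\<rho> Y'' \<odot>\<^bsub>B\<^esub> \<eta> (FObj e Y'') \<odot>\<^bsub>B\<^esub> v \<odot>\<^bsub>B\<^esub> ?z = Zero B (FObj e (FObj G Y)) (FObj e (FObj G Y''))"
    using B.Cmp_eq_Zero[OF \<rho>_\<eta>, of Y'' "v \<odot>\<^bsub>B\<^esub> ?z"] assms z by simp
  ultimately have 2: "\<rho> Y'' \<odot>\<^bsub>B\<^esub> ?v \<odot>\<^bsub>B\<^esub> \<eta> (FObj e Y') \<odot>\<^bsub>B\<^esub> ?z = Zero B (FObj e (FObj G Y)) (FObj e (FObj G Y''))"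
    by simp
  have "\<Phi> Y' Y'' v \<odot>\<^bsub>B\<^esub> \<Phi> Y Y' u = \<rho> Y'' \<odot>\<^bsub>B\<^esub> ?v \<odot>\<^bsub>B\<^esub> FArr e (\<kappa> Y') \<odot>\<^bsub>B\<^esub> \<rho> Y' \<odot>\<^bsub>B\<^esub> ?x"
    using assms by (simp add: \<Phi>_def)
  also have "\<dots> = \<rho> Y'' \<odot>\<^bsub>B\<^esub> ?v \<odot>\<^bsub>B\<^esub> Diff B ?x (\<eta> (FObj e Y') \<odot>\<^bsub>B\<^esub> ?z)"
    by (simp only: 1)
  also have "\<dots> = Diff B (\<rho> Y'' \<odot>\<^bsub>B\<^esub> ?v \<odot>\<^bsub>B\<^esub> ?x) (\<rho> Y'' \<odot>\<^bsub>B\<^esub> ?v \<odot>\<^bsub>B\<^esub> \<eta> (FObj e Y') \<odot>\<^bsub>B\<^esub> ?z)"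
    using assms by (simp add: B.Cmp_Diff)
  also have "\<dots> = \<rho> Y'' \<odot>\<^bsub>B\<^esub> ?v \<odot>\<^bsub>B\<^esub> ?x" unfolding 2 using assms by simp
  also have "\<dots> = \<Phi> Y Y'' (v \<odot>\<^bsub>B\<^esub> u)" using assms by (simp add: \<Phi>_def)
  finally show ?thesis .
qed

lemma \<Phi>_Idn: "Y \<in> Obj A \<Longrightarrow> \<Phi> Y Y (Idn B (FObj e Y)) = Idn B (FObj e (FObj G Y))"
  using \<Phi>_e[of "Idn A Y" Y Y] by simp

lemma \<Phi>_iso:
  assumes "Y \<in> Obj A" "Y' \<in> Obj A" "is_iso B u" "Dom B u = FObj e Y" "Cod B u = FObj e Y'"
  shows "is_iso B (\<Phi> Y Y' u)"
proof -
  have u: "u \<in> Arr B" using assms by (simp add: is_iso_def)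
  obtain v where v: "v \<in> Arr B" "Dom B v = FObj e Y'" "Cod B v = FObj e Y"
    "v \<odot>\<^bsub>B\<^esub> u = Idn B (FObj e Y)" "u \<odot>\<^bsub>B\<^esub> v = Idn B (FObj e Y')"
    using B.is_isoD[OF assms(3)] assms by metis
  show ?thesis
    by (rule B.is_isoI[of _ "\<Phi> Y' Y v"]) (use assms u v in \<open>simp_all add: \<Phi>_Cmp \<Phi>_Idn\<close>)
qed

text \<open>\<open>\<theta>\<close> identifies \<open>e i e Y\<close> with \<open>e Y\<close>, and \<open>\<Phi>\<close> carries this over to \<open>F e Y = e G i e Y\<close> and \<open>e G Y\<close>.\<close>

lemma F_e_iso_e_G: "nat_iso A B (F \<circ>\<^sub>F e) (e \<circ>\<^sub>F G) (\<lambda>Y. \<Phi> (FObj i (FObj e Y)) Y (\<theta> (FObj e Y)))"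
  unfolding nat_iso_def nat_trans_def
proof (intro conjI ballI)
  fix f assume f: "f \<in> Arr A"
  let ?Y = "Dom A f" and ?Y' = "Cod A f"
  have ob: "?Y \<in> Obj A" "?Y' \<in> Obj A" using f by simp_all
  have "FArr e (FArr G f) \<odot>\<^bsub>B\<^esub> \<Phi> (FObj i (FObj e ?Y)) ?Y (\<theta> (FObj e ?Y)) =
      \<Phi> (FObj i (FObj e ?Y)) ?Y' (FArr e f \<odot>\<^bsub>B\<^esub> \<theta> (FObj e ?Y))"
    using f ob by (simp add: \<Phi>_Cmp flip: \<Phi>_e)
  also have "FArr e f \<odot>\<^bsub>B\<^esub> \<theta> (FObj e ?Y) = \<theta> (FObj e ?Y') \<odot>\<^bsub>B\<^esub> FArr e (FArr i (FArr e f))"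
    by (rule \<theta>_natural) (use f in simp_all)
  also have "\<Phi> (FObj i (FObj e ?Y)) ?Y' \<dots> =
      \<Phi> (FObj i (FObj e ?Y')) ?Y' (\<theta> (FObj e ?Y')) \<odot>\<^bsub>B\<^esub>
      \<Phi> (FObj i (FObj e ?Y)) (FObj i (FObj e ?Y')) (FArr e (FArr i (FArr e f)))"
    using f ob by (simp add: \<Phi>_Cmp)
  also have "\<Phi> (FObj i (FObj e ?Y)) (FObj i (FObj e ?Y')) (FArr e (FArr i (FArr e f))) = 
      FArr e (FArr G (FArr i (FArr e f)))"
    by (rule \<Phi>_e) (use f in simp_all)
  finally show "FArr (e \<circ>\<^sub>F G) f \<odot>\<^bsub>B\<^esub> \<Phi> (FObj i (FObj e ?Y)) ?Y (\<theta> (FObj e ?Y)) =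
      \<Phi> (FObj i (FObj e ?Y')) ?Y' (\<theta> (FObj e ?Y')) \<odot>\<^bsub>B\<^esub> FArr (F \<circ>\<^sub>F e) f" by simp
qed (simp_all add: Hom_iff \<Phi>_iso)

end

context cleft
begin

subsection \<open>Objects with split counit\<close>

definition split_counit :: "'a \<Rightarrow> bool" where
  "split_counit Y \<longleftrightarrow> Y \<in> Obj A \<and> (\<exists>s\<in>Hom A Y (FObj l (FObj e Y)). \<epsilon> Y \<odot>\<^bsub>A\<^esub> s = Idn A Y)"

lemma split_counit_projective:
  assumes "projective A Q"
  shows "split_counit Q"
proof -
  have Q: "Q \<in> Obj A" using assms by simp
  obtain s where "s \<in> Arr A" "Dom A s = Q" "Cod A s = FObj l (FObj e Q)" "\<epsilon> Q \<odot>\<^bsub>A\<^esub> s = Idn A Q"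
    using A.projective_lift[OF assms counit_epi[OF Q], of "Idn A Q"] Q by auto
  then show ?thesis using Q by (auto simp: split_counit_def Hom_iff)
qed

lemma split_counit_retraction:
  assumes "split_counit Y"
  obtains r where "r \<in> Arr A" "Dom A r = FObj l (FObj e Y)" "Cod A r = FObj G Y"
    "r \<odot>\<^bsub>A\<^esub> \<kappa> Y = Idn A (FObj G Y)"
proof -
  have Y: "Y \<in> Obj A" using assms by (simp add: split_counit_def)
  obtain s where s: "s \<in> Arr A" "Dom A s = Y" "Cod A s = FObj l (FObj e Y)" "\<epsilon> Y \<odot>\<^bsub>A\<^esub> s = Idn A Y"
    using assms by (auto simp: split_counit_def Hom_iff)
  note E = A.short_exactD[OF counit_short_exact[OF Y]]
  let ?d = "Diff A (Idn A (FObj l (FObj e Y))) (s \<odot>\<^bsub>A\<^esub> \<epsilon> Y)"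
  have d: "?d \<in> Arr A" "Dom A ?d = FObj l (FObj e Y)" "Cod A ?d = FObj l (FObj e Y)"
    using Y s by simp_all
  have "\<epsilon> Y \<odot>\<^bsub>A\<^esub> s \<odot>\<^bsub>A\<^esub> \<epsilon> Y = \<epsilon> Y" using A.Cmp_eq[OF s(4), of "\<epsilon> Y"] s Y by simp
  then have "\<epsilon> Y \<odot>\<^bsub>A\<^esub> ?d = Zero A (FObj l (FObj e Y)) Y"
    using Y s(1-3) by (simp add: A.Cmp_Diff)
  then obtain r where r: "r \<in> Arr A" "Dom A r = FObj l (FObj e Y)" "Cod A r = FObj G Y" "\<kappa> Y \<odot>\<^bsub>A\<^esub> r = ?d"
    using A.kernel_factor[OF E(1), of ?d] Y d by auto
  have "\<kappa> Y \<odot>\<^bsub>A\<^esub> r \<odot>\<^bsub>A\<^esub> \<kappa> Y = ?d \<odot>\<^bsub>A\<^esub> \<kappa> Y"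
    by (rule A.Cmp_eq[OF r(4)]) (use r(1-3) Y in simp_all)
  also have "\<dots> = \<kappa> Y" using Y s(1-3) E(8) by (simp add: A.Diff_Cmp)
  finally have kk: "\<kappa> Y \<odot>\<^bsub>A\<^esub> r \<odot>\<^bsub>A\<^esub> \<kappa> Y = \<kappa> Y" .
  have "r \<odot>\<^bsub>A\<^esub> \<kappa> Y = Idn A (FObj G Y)"
    by (rule A.monoD[OF E(3)]) (use kk r(1-3) Y in simp_all)
  then show thesis using that r by blast
qed

text \<open>\<open>G Y\<close> is a retract of \<open>l e Y\<close>, and the counit at any object in the range of \<open>l\<close> is split by the
  unit.\<close>

lemma split_counit_G:
  assumes "split_counit Y"
  shows "split_counit (FObj G Y)"
proof -
  have Y: "Y \<in> Obj A" using assms by (simp add: split_counit_def)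
  obtain r where r: "r \<in> Arr A" "Dom A r = FObj l (FObj e Y)" "Cod A r = FObj G Y"
    "r \<odot>\<^bsub>A\<^esub> \<kappa> Y = Idn A (FObj G Y)"
    using split_counit_retraction[OF assms] .
  let ?s = "FArr l (FArr e r) \<odot>\<^bsub>A\<^esub> FArr l (\<eta> (FObj e Y)) \<odot>\<^bsub>A\<^esub> \<kappa> Y"
  have s: "?s \<in> Hom A (FObj G Y) (FObj l (FObj e (FObj G Y)))"
    using r Y by (simp add: Hom_iff)
  have "\<epsilon> (FObj G Y) \<odot>\<^bsub>A\<^esub> ?s = r \<odot>\<^bsub>A\<^esub> \<epsilon> (FObj l (FObj e Y)) \<odot>\<^bsub>A\<^esub> FArr l (\<eta> (FObj e Y)) \<odot>\<^bsub>A\<^esub> \<kappa> Y"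
    by (rule A.Cmp_eq_Cmp[OF le.counit_natural[symmetric]]) (use r(1-3) Y in simp_all)
  also have "\<epsilon> (FObj l (FObj e Y)) \<odot>\<^bsub>A\<^esub> FArr l (\<eta> (FObj e Y)) \<odot>\<^bsub>A\<^esub> \<kappa> Y =
      Idn A (FObj l (FObj e Y)) \<odot>\<^bsub>A\<^esub> \<kappa> Y"
    by (rule A.Cmp_eq[OF le.triangle_L]) (use Y in simp_all)
  finally have "\<epsilon> (FObj G Y) \<odot>\<^bsub>A\<^esub> ?s = Idn A (FObj G Y)" using r(4) Y by simp
  then show ?thesis using s Y by (auto simp: split_counit_def)
qed

text \<open>\<open>q\<close> preserves cokernels, and a split mono is the kernel of its cokernel.\<close>

lemma q_short_exact:
  assumes "split_counit Y"
  shows "short_exact B (FArr q (\<kappa> Y)) (FArr q (\<epsilon> Y))"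
proof -
  have Y: "Y \<in> Obj A" using assms by (simp add: split_counit_def)
  obtain r where r: "r \<in> Arr A" "Dom A r = FObj l (FObj e Y)" "Cod A r = FObj G Y"
    "r \<odot>\<^bsub>A\<^esub> \<kappa> Y = Idn A (FObj G Y)"
    using split_counit_retraction[OF assms] .
  have c: "is_cokernel B (FArr q (\<epsilon> Y)) (FArr q (\<kappa> Y))"
    using qi.L_cokernel A.short_exactD(2)[OF counit_short_exact[OF Y]] by blast
  have "is_mono B (FArr q (\<kappa> Y))"
    by (rule B.split_mono[of _ "FArr q r"]) (use r(1-3) Y qi.L.T_eq[OF r(4)] in \<open>simp_all add: Hom_iff\<close>)
  then show ?thesis using c B.mono_kernel_of_cokernel by (simp add: short_exact_def)
qed

subsection \<open>Acyclicity\<close>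

sublocale F: functor_on B B F
  by (intro functor_on_fcomp[of B A] functor_on_fcomp[of A A] qi.R.functor_on_axioms
    G.functor_on_axioms le.R.functor_on_axioms)

sublocale Fj: functor_on B B "fpow F j" for j
  by (rule functor_on_fpow[OF F.functor_on_axioms])

lemma F_zero: "zero_preserving B B F"
  by (intro zero_preserving_fcomp[of B A] zero_preserving_fcomp[of A A] functor_on_fcomp[of B A]
    qi.R.functor_on_axioms G.functor_on_axioms qi.R_zero G_zero le.R_zero)

lemma ei_functor: "functor_on B B (e \<circ>\<^sub>F i)"
  by (rule functor_on_fcomp[OF qi.R.functor_on_axioms le.R.functor_on_axioms])

lemma el_functor: "functor_on B B (e \<circ>\<^sub>F l)"
  by (rule functor_on_fcomp[OF le.L.functor_on_axioms le.R.functor_on_axioms])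

lemma el_zero: "zero_preserving B B (e \<circ>\<^sub>F l)"
  by (rule zero_preserving_fcomp[OF le.L.functor_on_axioms le.L_zero le.R_zero])

lemma F_short_exact:
  "X \<in> Obj B \<Longrightarrow> short_exact B (FArr e (\<kappa> (FObj i X))) (FArr e (\<epsilon> (FObj i X)))"
  by (rule e_counit_short_exact) simp

lemma ei_iso:
  obtains \<sigma> where "nat_iso B B fid (e \<circ>\<^sub>F i) \<sigma>"
    "\<And>X. X \<in> Obj B \<Longrightarrow> is_iso B (\<sigma> X) \<and> Dom B (\<sigma> X) = X \<and> Cod B (\<sigma> X) = FObj e (FObj i X)"
proof (rule nat_iso_inverse[OF \<theta> ei_functor functor_on_fid[OF B.category_axioms]])
  fix \<sigma> assume "nat_iso B B fid (e \<circ>\<^sub>F i) \<sigma>"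
  then show thesis using that[of \<sigma>] by (simp add: nat_iso_def nat_trans_def Hom_iff)
qed

text \<open>In \<open>0 \<rightarrow> F d \<rightarrow> elei d \<rightarrow> ei d \<rightarrow> 0\<close> the outer complexes are acyclic, hence so is \<open>elei d \<cong> el d\<close>.\<close>

lemma l_acyclic:
  assumes d: "acyclic_complex B d" and Fd: "acyclic_complex B (FArr F \<circ> d)"
  shows "acyclic_complex A (FArr l \<circ> d)"
proof -
  note dc = B.acyclic_is_complex[OF d]
  note dd = is_complexD[OF dc]
  obtain \<sigma> where \<sigma>: "nat_iso B B fid (e \<circ>\<^sub>F i) \<sigma>" using ei_iso .
  have eizero: "zero_preserving B B (e \<circ>\<^sub>F i)"
    by (rule zero_preserving_fcomp[OF qi.R.functor_on_axioms qi.R_zero le.R_zero])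
  have eid: "is_complex B (FArr (e \<circ>\<^sub>F i) \<circ> d)"
    using functor_on.T_is_complex[OF ei_functor eizero dc] .
  have elei: "is_complex B (FArr ((e \<circ>\<^sub>F l) \<circ>\<^sub>F (e \<circ>\<^sub>F i)) \<circ> d)"
    using functor_on.T_is_complex[OF el_functor el_zero eid] by (simp add: comp_def)
  have eld: "is_complex B (FArr (e \<circ>\<^sub>F l) \<circ> d)"
    using functor_on.T_is_complex[OF el_functor el_zero dc] .
  have id_d: "acyclic_complex B (FArr (fid :: ('b, 'g, 'b, 'g) func) \<circ> d)"
    using d by (simp add: comp_def)
  have m: "acyclic_complex B (FArr (e \<circ>\<^sub>F i) \<circ> d)"
    using acyclic_nat_iso[OF B.abelian_category_axioms enough(1) ei_functor \<sigma> dc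
      functor_on_fid[OF B.category_axioms] id_d eid] .
  have sq1: "FArr e (\<kappa> (FObj i (Cod B f))) \<odot>\<^bsub>B\<^esub> FArr F f =
      FArr e (FArr l (FArr e (FArr i f))) \<odot>\<^bsub>B\<^esub> FArr e (\<kappa> (FObj i (Dom B f)))" if "f \<in> Arr B" for f
    using le.R.T_square[OF \<kappa>_natural[of "FArr i f", symmetric]] that by simp
  have sq2: "FArr e (\<epsilon> (FObj i (Cod B f))) \<odot>\<^bsub>B\<^esub> FArr e (FArr l (FArr e (FArr i f))) =
      FArr e (FArr i f) \<odot>\<^bsub>B\<^esub> FArr e (\<epsilon> (FObj i (Dom B f)))" if "f \<in> Arr B" for f
    using le.R.T_square[OF le.counit_natural[of "FArr i f", symmetric]] that by simp
  have "acyclic_complex B (FArr ((e \<circ>\<^sub>F l) \<circ>\<^sub>F (e \<circ>\<^sub>F i)) \<circ> d)"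
  proof (rule B.acyclic_middle[OF enough(1) Fd elei m])
    show "chain_map B (FArr F \<circ> d) (FArr ((e \<circ>\<^sub>F l) \<circ>\<^sub>F (e \<circ>\<^sub>F i)) \<circ> d)
      (\<lambda>n. FArr e (\<kappa> (FObj i (Dom B (d n)))))"
      using sq1[OF dd(1)] dd(1,2) by (simp add: chain_map_def Hom_iff)
    show "chain_map B (FArr ((e \<circ>\<^sub>F l) \<circ>\<^sub>F (e \<circ>\<^sub>F i)) \<circ> d) (FArr (e \<circ>\<^sub>F i) \<circ> d)
      (\<lambda>n. FArr e (\<epsilon> (FObj i (Dom B (d n)))))"
      using sq2[OF dd(1)] dd(1,2) by (simp add: chain_map_def Hom_iff)
  qed (use F_short_exact dd(1) in simp)
  moreover have "nat_iso B B ((e \<circ>\<^sub>F l) \<circ>\<^sub>F (e \<circ>\<^sub>F i)) ((e \<circ>\<^sub>F l) \<circ>\<^sub>F fid) (\<lambda>X. FArr (e \<circ>\<^sub>F l) (\<theta> X))"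
    by (rule nat_iso_postcompose[OF \<theta> ei_functor functor_on_fid[OF B.category_axioms] el_functor])
  ultimately have "acyclic_complex B (FArr ((e \<circ>\<^sub>F l) \<circ>\<^sub>F fid) \<circ> d)"
    using acyclic_nat_iso[OF B.abelian_category_axioms enough(1)
        functor_on_fcomp[OF functor_on_fid[OF B.category_axioms] el_functor] _ dc
        functor_on_fcomp[OF ei_functor el_functor]] eld
    by (simp add: comp_def)
  then show ?thesis
    using acyclic_if_e[OF le.L.T_is_complex[OF le.L_zero dc]] by (simp add: comp_def)
qed

text \<open>\<open>Q\<close> is a retract of some \<open>l P\<close>, and \<open>el P\<close> is an extension of \<open>P\<close> by \<open>F P\<close> up to isomorphism.\<close>

lemma hom_acyclic_e_projective:
  assumes d: "is_complex B d" and proj: "\<And>n. projective B (Dom B (d n))"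
    and hom: "\<And>P. projective B P \<Longrightarrow> hom_acyclic B d P"
    and homF: "\<And>P. projective B P \<Longrightarrow> hom_acyclic B d (FObj F P)"
    and Q: "projective A Q"
  shows "hom_acyclic B d (FObj e Q)"
proof -
  obtain P p where P: "projective B P" and p: "is_epi A p" "Dom A p = FObj l P" "Cod A p = Q"
    using cover_by_l[OF A.projective_Obj[OF Q]] .
  have pa: "p \<in> Arr A" and PO: "P \<in> Obj B" using p P by (simp_all add: is_epi_def)
  obtain s where s: "s \<in> Arr A" "Dom A s = Q" "Cod A s = FObj l P" "p \<odot>\<^bsub>A\<^esub> s = Idn A Q"
    using A.projective_lift[OF Q p(1), of "Idn A Q"] Q p by auto
  obtain \<sigma> where \<sigma>: "\<And>X. X \<in> Obj B \<Longrightarrow> is_iso B (\<sigma> X) \<and> Dom B (\<sigma> X) = X \<and> Cod B (\<sigma> X) = FObj e (FObj i X)"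
    using ei_iso by metis
  have "hom_acyclic B d (FObj e (FObj i P))"
    using B.hom_acyclic_iso[OF d hom[OF P]] \<sigma>[OF PO] by blast
  then have "hom_acyclic B d (FObj e (FObj l (FObj e (FObj i P))))"
    using B.hom_acyclic_middle[OF d proj F_short_exact[OF PO]] homF[OF P] PO by simp
  moreover have "is_iso B (FArr e (FArr l (\<theta> P)))"
    using le.R.T_iso le.L.T_iso PO by simp
  ultimately have "hom_acyclic B d (FObj e (FObj l P))"
    using B.hom_acyclic_iso[OF d] PO by simp
  moreover have "FArr e p \<odot>\<^bsub>B\<^esub> FArr e s = Idn B (FObj e Q)"
    using le.R.T_eq[OF s(4)] s pa p Q by simp
  ultimately show ?thesis
    using B.hom_acyclic_retract[OF d, of "FObj e (FObj l P)" "FArr e s" "FObj e Q" "FArr e p"] s pa p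
    by (simp add: Hom_iff)
qed

lemma zero_object_if_e:
  assumes "Y \<in> Obj A" "is_zero_object B (FObj e Y)"
  shows "is_zero_object A Y"
  using assms e_faithful[of "Idn A Y" "Zero A Y Y"]
  by (simp add: A.is_zero_object_iff B.is_zero_object_iff)

lemma Fj_e_iso_Fj_e_G:
  assumes "Y \<in> Obj A"
  obtains u where "is_iso B u" "u \<in> Arr B" "Dom B u = FObj (fpow F (Suc j)) (FObj e Y)"
    "Cod B u = FObj (fpow F j) (FObj e (FObj G Y))"
proof -
  let ?u = "\<Phi> (FObj i (FObj e Y)) Y (\<theta> (FObj e Y))"
  have u: "is_iso B ?u" "?u \<in> Arr B" "Dom B ?u = FObj F (FObj e Y)" "Cod B ?u = FObj e (FObj G Y)"
    using assms by (simp_all add: \<Phi>_iso)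
  show thesis
    by (rule that[of "FArr (fpow F j) ?u"]) (use u Fj.T_iso fpow_shift(1)[of F j] in simp_all)
qed

text \<open>Induction along \<open>0 \<rightarrow> G Y \<rightarrow> l e Y \<rightarrow> Y \<rightarrow> 0\<close>: the hypotheses pass from \<open>Y\<close> to \<open>G Y\<close> with \<open>s\<close> lowered by
  one, since \<open>F\<^sup>j e G Y \<cong> F\<^sup>j\<^sup>+\<^sup>1 e Y\<close>.\<close>

lemma hom_acyclic_nilpotent:
  assumes d: "is_complex A d" and proj: "\<And>n. projective A (Dom A (d n))"
  shows "\<lbrakk>Y \<in> Obj A; is_zero_object B (FObj (fpow F s) (FObj e Y));
    \<And>j. hom_acyclic A d (FObj l (FObj (fpow F j) (FObj e Y)))\<rbrakk> \<Longrightarrow> hom_acyclic A d Y"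
proof (induction s arbitrary: Y)
  case 0
  then show ?case using zero_object_if_e A.hom_acyclic_zero_object[OF d] by simp
next
  case (Suc s)
  have "hom_acyclic A d (FObj G Y)"
  proof (rule Suc.IH)
    show "FObj G Y \<in> Obj A" using Suc.prems(1) by simp
    show "is_zero_object B (FObj (fpow F s) (FObj e (FObj G Y)))"
      using Fj_e_iso_Fj_e_G[OF Suc.prems(1), of s] B.iso_zero_object Suc.prems(2) by metis
    fix j
    obtain u where "is_iso B u" "u \<in> Arr B" "Dom B u = FObj (fpow F (Suc j)) (FObj e Y)"
      "Cod B u = FObj (fpow F j) (FObj e (FObj G Y))"
      using Fj_e_iso_Fj_e_G[OF Suc.prems(1), of j] .
    then show "hom_acyclic A d (FObj l (FObj (fpow F j) (FObj e (FObj G Y))))"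
      using A.hom_acyclic_iso[OF d Suc.prems(3)[of "Suc j"], of "FArr l u"] le.L.T_iso by simp
  qed
  then show ?case
    using A.hom_acyclic_quotient[OF d proj counit_short_exact[OF Suc.prems(1)]] Suc.prems(1)
      Suc.prems(3)[of 0] by simp
qed

text \<open>\<open>q l\<close> is left adjoint to \<open>e i\<close>.\<close>

lemma q_l_iso: obtains \<tau> where "nat_iso B B fid (q \<circ>\<^sub>F l) \<tau>"
proof -
  have "adjoint_pair B B (q \<circ>\<^sub>F l) (e \<circ>\<^sub>F i)
      (\<lambda>X. FArr e (\<eta>' (FObj l X)) \<odot>\<^bsub>B\<^esub> \<eta> X) (\<lambda>Y. \<epsilon>' Y \<odot>\<^bsub>B\<^esub> FArr q (\<epsilon> (FObj i Y)))"
    using adjunction_fcomp[OF le.adjoint_pair_axioms qi.adjoint_pair_axioms]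
    by (simp add: adjoint_pair_def adjoint_pair_axioms_def B.abelian_category_axioms)
  from left_adjoint_of_identity[OF this \<theta>] show thesis using that by blast
qed

text \<open>The same induction for complexes, along \<open>0 \<rightarrow> q G d \<rightarrow> q l e d \<rightarrow> q d \<rightarrow> 0\<close>. This sequence is exact
  because the counits split termwise, and its middle term is isomorphic to \<open>e d\<close>.\<close>

lemma q_acyclic_nilpotent:
  "\<lbrakk>is_complex A d; \<And>n. split_counit (Dom A (d n));
    \<And>n. is_zero_object B (FObj (fpow F s) (FObj e (Dom A (d n))));
    \<And>j. acyclic_complex B (FArr (fpow F j \<circ>\<^sub>F e) \<circ> d)\<rbrakk> \<Longrightarrow> acyclic_complex B (FArr q \<circ> d)"
proof (induction s arbitrary: d)
  case 0
  note dd = is_complexD[OF 0(1)]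
  note qc = qi.L.T_is_complex[OF qi.L_zero 0(1)]
  have Z: "is_zero_object B (FObj q (Dom A (d n)))" for n
  proof -
    have "is_zero_object A (Dom A (d n))" using 0(3)[of n] dd(1) zero_object_if_e by simp
    then have "FArr q (Idn A (Dom A (d n))) = FArr q (Zero A (Dom A (d n)) (Dom A (d n)))"
      by (simp add: A.is_zero_object_iff)
    then show ?thesis using dd(1) by (simp add: B.is_zero_object_iff)
  qed
  show ?case
  proof (rule B.acyclic_complexI[OF enough(1) qc])
    fix n n' :: int and y
    assume y: "y \<in> Arr B" "Cod B y = Dom B ((FArr q \<circ> d) n')" and n': "n' = n + 1"
    have "FArr q (d n) \<odot>\<^bsub>B\<^esub> Zero B (Dom B y) (FObj q (Dom A (d n))) = y"
      by (rule B.zero_object_maps_into[OF Z[of n'], of _ "Dom B y"])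
        (use y dd(1) dd(2)[OF n'] in \<open>simp_all add: Hom_iff\<close>)
    then show "\<exists>x. x \<in> Arr B \<and> Dom B x = Dom B y \<and> Cod B x = Dom B ((FArr q \<circ> d) n) \<and>
        (FArr q \<circ> d) n \<odot>\<^bsub>B\<^esub> x = y"
      using y dd(1) by (intro exI[of _ "Zero B (Dom B y) (FObj q (Dom A (d n)))"]) simp
  qed
next
  case (Suc s)
  note d = Suc.prems(1)
  note dd = is_complexD[OF d]
  note Gd = G.T_is_complex[OF G_zero d]
  note qd = qi.L.T_is_complex[OF qi.L_zero d]
  have ed: "is_complex B (FArr e \<circ> d)" by (rule le.R.T_is_complex[OF le.R_zero d])
  have qG: "acyclic_complex B (FArr q \<circ> (FArr G \<circ> d))"
  proof (rule Suc.IH[OF Gd])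
    fix n
    show "split_counit (Dom A ((FArr G \<circ> d) n))" using split_counit_G[OF Suc.prems(2)] dd(1) by simp
    show "is_zero_object B (FObj (fpow F s) (FObj e (Dom A ((FArr G \<circ> d) n))))"
      using Fj_e_iso_Fj_e_G[of "Dom A (d n)" s] B.iso_zero_object Suc.prems(3) dd(1)
      by (metis A.Dom_Obj G.T_Arr(2) comp_apply)
  next
    fix j
    have Fe: "functor_on A B (F \<circ>\<^sub>F e)" and eG: "functor_on A B (e \<circ>\<^sub>F G)"
      by (rule functor_on_fcomp[OF le.R.functor_on_axioms F.functor_on_axioms]
        functor_on_fcomp[OF G.functor_on_axioms le.R.functor_on_axioms])+
    have nat: "nat_iso A B (fpow F j \<circ>\<^sub>F (F \<circ>\<^sub>F e)) (fpow F j \<circ>\<^sub>F (e \<circ>\<^sub>F G))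
        (\<lambda>X. FArr (fpow F j) (\<Phi> (FObj i (FObj e X)) X (\<theta> (FObj e X))))"
      by (rule nat_iso_postcompose[OF F_e_iso_e_G Fe eG Fj.functor_on_axioms])
    have ac: "acyclic_complex B (FArr (fpow F j \<circ>\<^sub>F (F \<circ>\<^sub>F e)) \<circ> d)"
      using Suc.prems(4)[of "Suc j"] fpow_shift(2)[of F j] by (simp add: comp_def)
    have cx: "is_complex B (FArr (fpow F j \<circ>\<^sub>F (e \<circ>\<^sub>F G)) \<circ> d)"
      using Fj.T_is_complex[OF zero_preserving_fpow[OF F.functor_on_axioms F_zero]
        le.R.T_is_complex[OF le.R_zero Gd]] by (simp add: comp_def)
    have "acyclic_complex B (FArr (fpow F j \<circ>\<^sub>F (e \<circ>\<^sub>F G)) \<circ> d)"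
      by (rule acyclic_nat_iso[OF B.abelian_category_axioms enough(1)
        functor_on_fcomp[OF eG Fj.functor_on_axioms] nat d
        functor_on_fcomp[OF Fe Fj.functor_on_axioms] ac cx])
    then show "acyclic_complex B (FArr (fpow F j \<circ>\<^sub>F e) \<circ> (FArr G \<circ> d))" by (simp add: comp_def)
  qed
  obtain \<tau> where \<tau>: "nat_iso B B fid (q \<circ>\<^sub>F l) \<tau>" using q_l_iso .
  have qled: "is_complex B (FArr (q \<circ>\<^sub>F l) \<circ> (FArr e \<circ> d))"
    using qi.L.T_is_complex[OF qi.L_zero le.L.T_is_complex[OF le.L_zero ed]] by (simp add: comp_def)
  have qle: "acyclic_complex B (FArr (q \<circ>\<^sub>F l) \<circ> (FArr e \<circ> d))"
    by (rule acyclic_nat_iso[OF B.abelian_category_axioms enough(1) _ \<tau> ed _ _ qled])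
      (use Suc.prems(4)[of 0] functor_on_fid[OF B.category_axioms]
        functor_on_fcomp[OF le.L.functor_on_axioms qi.L.functor_on_axioms] in \<open>simp_all add: comp_def\<close>)
  have sq1: "FArr q (\<kappa> (Cod A f)) \<odot>\<^bsub>B\<^esub> FArr q (FArr G f) =
      FArr q (FArr l (FArr e f)) \<odot>\<^bsub>B\<^esub> FArr q (\<kappa> (Dom A f))" if "f \<in> Arr A" for f
    using qi.L.T_square[OF \<kappa>_natural[of f, symmetric]] that by simp
  have sq2: "FArr q (\<epsilon> (Cod A f)) \<odot>\<^bsub>B\<^esub> FArr q (FArr l (FArr e f)) =
      FArr q f \<odot>\<^bsub>B\<^esub> FArr q (\<epsilon> (Dom A f))" if "f \<in> Arr A" for f
    using qi.L.T_square[OF le.counit_natural[of f, symmetric]] that by simp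
  show ?case
  proof (rule B.acyclic_quotient[OF enough(1) qG qle qd])
    show "chain_map B (FArr q \<circ> (FArr G \<circ> d)) (FArr (q \<circ>\<^sub>F l) \<circ> (FArr e \<circ> d)) (\<lambda>n. FArr q (\<kappa> (Dom A (d n))))"
      using sq1[OF dd(1)] dd(1,2) by (simp add: chain_map_def Hom_iff)
    show "chain_map B (FArr (q \<circ>\<^sub>F l) \<circ> (FArr e \<circ> d)) (FArr q \<circ> d) (\<lambda>n. FArr q (\<epsilon> (Dom A (d n))))"
      using sq2[OF dd(1)] dd(1,2) by (simp add: chain_map_def Hom_iff)
  qed (rule q_short_exact[OF Suc.prems(2)])
qed

lemma compatible_C2i_if_C2ii:
  assumes C2: "compatible_C2ii B A e l F"
  shows "compatible_C2i B A i q"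
  unfolding compatible_C2i_def
proof (intro allI impI, elim conjE, intro conjI)
  fix d P assume d: "complete_projective_resolution A d" and P: "projective B P"
  have dac: "acyclic_complex A d" and proj: "projective A (Dom A (d n))" 
    and hom: "projective A Q \<Longrightarrow> hom_acyclic A d Q" for n Q
    using d by (auto simp: complete_projective_resolution_def)
  note dc = A.acyclic_is_complex[OF dac]
  obtain s where s: "is_zero_object B (FObj (fpow F s) X)" if "X \<in> Obj B" for X
    using C2 by (auto simp: compatible_C2ii_def nilpotent_functor_def)
  show "acyclic_complex B (FArr q \<circ> d)"
  proof (rule q_acyclic_nilpotent[OF dc])
    show "split_counit (Dom A (d n))" for n by (rule split_counit_projective[OF proj])
    show "is_zero_object B (FObj (fpow F s) (FObj e (Dom A (d n))))" for n using s proj by simp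
    show "acyclic_complex B (FArr (fpow F j \<circ>\<^sub>F e) \<circ> d)" for j
    proof (cases "j = 0")
      case True
      then show ?thesis using e_acyclic[OF dac] by (simp add: comp_def)
    next
      case False
      then show ?thesis using C2 d P unfolding compatible_C2ii_def by blast
    qed
  qed
  have PO: "P \<in> Obj B" using P by simp
  obtain \<sigma> where \<sigma>: "\<And>X. X \<in> Obj B \<Longrightarrow> is_iso B (\<sigma> X) \<and> Dom B (\<sigma> X) = X \<and> Cod B (\<sigma> X) = FObj e (FObj i X)"
    using ei_iso by metis
  show "hom_acyclic A d (FObj i P)"
  proof (rule hom_acyclic_nilpotent[OF dc proj])
    show "FObj i P \<in> Obj A" using PO by simp
    show "is_zero_object B (FObj (fpow F s) (FObj e (FObj i P)))" using s PO by simp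
    fix j
    have "hom_acyclic A d (FObj l (FObj (fpow F j) P))"
    proof (cases "j = 0")
      case True
      then show ?thesis using hom[OF l_projective[OF P]] by simp
    next
      case False
      then have "hom_acyclic A d (FObj (l \<circ>\<^sub>F fpow F j) P)"
        using C2 d P unfolding compatible_C2ii_def by blast
      then show ?thesis by simp
    qed
    moreover have "is_iso A (FArr l (FArr (fpow F j) (\<sigma> P)))"
      using \<sigma>[OF PO] le.L.T_iso Fj.T_iso by blast
    moreover have "\<sigma> P \<in> Arr B" using \<sigma>[OF PO] by (simp add: is_iso_def)
    ultimately show "hom_acyclic A d (FObj l (FObj (fpow F j) (FObj e (FObj i P))))"
      using A.hom_acyclic_iso[OF dc] \<sigma>[OF PO] by simp
  qed
qed

theorem l_gorenstein_projective:
  assumes C1: "compatible_C1 B F" and X: "gorenstein_projective B X"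
  shows "gorenstein_projective A (FObj l X)"
proof (rule le.L_gorenstein_projective[OF enough(2) e_epi _ _ X])
  fix d assume d: "complete_projective_resolution B d"
  have dac: "acyclic_complex B d" and proj: "projective B (Dom B (d n))" 
    and hom: "projective B Q \<Longrightarrow> hom_acyclic B d Q" for n Q
    using d by (auto simp: complete_projective_resolution_def)
  show "acyclic_complex A (FArr l \<circ> d)"
    by (rule l_acyclic[OF dac]) (use C1 d proj in \<open>auto simp: compatible_C1_def\<close>)
  fix Q assume Q: "projective A Q"
  show "hom_acyclic B d (FObj e Q)"
    by (rule hom_acyclic_e_projective[OF B.acyclic_is_complex[OF dac] proj hom _ Q])
      (use C1 d in \<open>auto simp: compatible_C1_def\<close>)
qed

theorem q_gorenstein_projective:
  assumes C2: "compatible_C2i B A i q" and X: "gorenstein_projective A X"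
  shows "gorenstein_projective B (FObj q X)"
proof (rule qi.L_gorenstein_projective[OF enough(1) i_epi _ _ X])
  fix d assume d: "complete_projective_resolution A d"
  \<comment> \<open>The condition speaks of \<open>d\<close> and a projective object of \<open>B\<close> at once; the zero object is one.\<close>
  obtain Z where "is_zero_object B Z" using B.has_zero_object ..
  then have "projective B Z" by (rule B.zero_object_projective)
  then show "acyclic_complex B (FArr q \<circ> d)" using C2 d by (auto simp: compatible_C2i_def)
  show "hom_acyclic A d (FObj i P)" if "projective B P" for P
    using C2 d that by (auto simp: compatible_C2i_def)
qed

end

theorem theoremI:
  fixes B :: "('b, 'g) cat" and A :: "('a, 'f) cat"
    and e :: "('a, 'f, 'b, 'g) func" and i l :: "('b, 'g, 'a, 'f) func"
    and q :: "('a, 'f, 'b, 'g) func" and G :: "('a, 'f, 'a, 'f) func"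
    and \<eta> :: "'b \<Rightarrow> 'g" and \<epsilon> :: "'a \<Rightarrow> 'f"
    and \<eta>' :: "'a \<Rightarrow> 'f" and \<epsilon>' :: "'b \<Rightarrow> 'g" and \<kappa> :: "'a \<Rightarrow> 'f"
  assumes "cleft_extension B A e i l \<eta> \<epsilon>"
    and "enough_projectives B" and "enough_projectives A"
    and "adjunction A B q i \<eta>' \<epsilon>'"
    and "kernel_functor A A (l \<circ>\<^sub>F e) \<epsilon> G \<kappa>"
    and "compatible B A e i l q (e \<circ>\<^sub>F G \<circ>\<^sub>F i)"
  shows "(\<forall>X. gorenstein_projective B X \<longrightarrow> gorenstein_projective A (FObj l X)) \<and>
         (\<forall>X. gorenstein_projective A X \<longrightarrow> gorenstein_projective B (FObj q X))"
proof -
  obtain \<theta> where "nat_iso B B (e \<circ>\<^sub>F i) fid \<theta>"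
    using assms(1) by (auto simp: cleft_extension_def)
  moreover have ab: "abelian_category B" "abelian_category A"
    using assms(1) by (simp_all add: cleft_extension_def)
  moreover have "category A"
    using ab(2) by (simp add: abelian_category_def preadditive_category_def)
  ultimately interpret cleft B A e i l q G \<eta> \<epsilon> \<eta>' \<epsilon>' \<kappa> \<theta>
    using assms(1-5)
    by (simp add: cleft_def cleft_axioms_def adjoint_pair_def adjoint_pair_axioms_def
      functor_on_def functor_on_axioms_def cleft_extension_def kernel_functor_def)
  have "compatible_C2i B A i q" and "compatible_C1 B F"
    using assms(6) compatible_C2i_if_C2ii by (auto simp: compatible_def)
  then show ?thesis using l_gorenstein_projective q_gorenstein_projective by blast
qed

end
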